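(* Let $\alpha \in [0,\infty)\cup\{-\tfrac1d : d\in\mathbb{Z}, d\ge 2\}$ and $p\in[0,1]$, and let $R_n$ and $B_n$ denote the number of red and blue vertices, respectively, in the random preferential attachment tree $\mathcal{T}_n=\mathcal{T}_{\alpha,n}$ with broadcasting induced colouring $\sigma_n$ (with parameter $p$). As $n\to\infty$: (i) The following strong law of large numbers holds: $\frac{1}{n}(R_n,B_n)\to\left(\frac12,\frac12\right)$ almost surely. (ii) If $p<(3-\alpha)/4$ or if $p=1/2$, then $$\frac{(R_n,B_n)-n\left(\frac12,\frac12\right)}{\sqrt n}\xrightarrow{d}\mathcal{N}(\mathbf{0},\Sigma_I),\qquad \Sigma_I=c_{\alpha,p}\begin{pmatrix}1&-1\\-1&1\end{pmatrix},$$ where $c_{\alpha,p}=\frac{4\alpha p-\alpha-1}{4(4p+\alpha-3)}$ if $p\neq\frac12$ and $c_{\alpha,p}=\frac14$ if $p=\frac12$. (iii) If $p=(3-\alpha)/4$ and $p\ne\frac12$ (i.e. $\alpha\neq1$), then $$\frac{(R_n,B_n)-n\left(\frac12,\frac12\right)}{\sqrt{n\ln n}}\xrightarrow{d}\mathcal{N}(\mathbf{0},\Sigma_{II}),\qquad \Sigma_{II}=\frac{(\alpha-1)^2}{4(1+\alpha)}\begin{pmatrix}1&-1\\-1&1\end{pmatrix}.$$ (iv) If $p>(3-\alpha)/4$ and $p\neq\frac12$, then $$\frac{(R_n,B_n)-n\left(\frac12,\frac12\right)}{n^{(2p+\alpha-1)/(1+\alpha)}}\xrightarrow{d}\frac{BZ}{2(2p+\alpha-1)}(2p-1,\,1-2p),$$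 where $Z$ is a random variable with $$\mathbb{E}[Z]=\frac{\Gamma(1/(1+\alpha))}{\Gamma((2p+\alpha)/(1+\alpha))},\qquad \mathbb{E}[Z^2]=\frac{\Gamma(1/(1+\alpha))(1+\alpha)(4p+\alpha-2)}{\Gamma((4p+2\alpha-1)/(1+\alpha))(4p+\alpha-3)}.$$
   Context: The random (linear) preferential attachment trees $(\mathcal{T}_n)_{n\ge1}=(\mathcal{T}_{\alpha,n})_{n\ge1}$ are rooted trees grown recursively: $\mathcal{T}_1$ is a single vertex $\rho$, the root of all the trees; $\mathcal{T}_n$ is obtained from $\mathcal{T}_{n-1}$ by choosing a vertex $v$ of $\mathcal{T}_{n-1}$ at random with probability $\frac{\alpha\deg^+(v)+1}{\sum_{u\in V(\mathcal{T}_{n-1})}(\alpha\deg^+(u)+1)}$ and adding a new child to $v$, where $\deg^+(u)$ is the number of children of $u$ in $\mathcal{T}_{n-1}$. The broadcasting induced colourings $\sigma_n:V(\mathcal{T}_n)\to\{\text{red},\text{blue}\}$ with parameter $p$ are built along with the trees: the root is red or blue with probability $1/2$ each; every newly added vertex receives the colour of its parent with probability $p$ and the other colour with probability $1-p$, independently of everything else; colours never change, so $\sigma_n$ restricted to $V(\mathcal{T}_{n-1})$ equals $\sigma_{n-1}$. The random variable $B$ equals $1$ if the root is red and $-1$ if the root is blue. $\mathcal{N}(\mathbf{0},\Sigma)$ is the (possibly degenerate) centred multivariate normal law with covariance matrix $\Sigma$.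
   Formalization: Part (i) is stated only for p < 1: at p = 1 every vertex has the colour of the root, so (R_n,B_n)/n is constantly (1,0) or (0,1) and the strong law fails; parts (ii)–(iv) are stated for all p in [0,1]. *)

theory Defs
  imports "HOL-Probability.Probability"
begin

section \<open>Broadcasting induced colourings of preferential attachment trees\<close>

text \<open>
  Vertices are named by their order of arrival: the vertex set of the \<open>n\<close>-th tree is \<open>{1..n}\<close>, the
  root is \<open>1\<close>, and the tree is given by the map sending each vertex \<open>k \<in> {2..n}\<close> to its parent, an
  element of \<open>{1..<k}\<close>.  As neither parents nor colours ever change, one parent map and one
  colouring of the positive integers describe the trees and the colourings for all \<open>n\<close> at once, by
  restriction to \<open>{1..n}\<close>.
\<close>

datatype colour = Red | Blue

definition outdeg :: "(nat \<Rightarrow> nat) \<Rightarrow> nat \<Rightarrow> nat \<Rightarrow> nat" where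
  "outdeg par n u = card {k \<in> {2..n}. par k = u}"

definition attach_prob :: "real \<Rightarrow> (nat \<Rightarrow> nat) \<Rightarrow> nat \<Rightarrow> nat \<Rightarrow> real" where
  "attach_prob \<alpha> par n v =
     (\<alpha> * real (outdeg par n v) + 1) / (\<Sum>u\<in>{1..n}. \<alpha> * real (outdeg par n u) + 1)"

text \<open>
  In \<open>attachment\<close> and \<open>broadcast\<close>, \<open>t\<close> and \<open>s\<close> are a possible history: the parents and the colours of
  the vertices up to \<open>n\<close>.  Conditioning on the whole history, and in \<open>broadcast\<close> also on the new
  parent, expresses that the new random choices are independent of everything that happened before.
  The positivity assumptions are needed because \<open>cond_prob\<close> is \<open>0\<close> when conditioning on a null event.
\<close>

locale broadcast_pref_attachment = prob_space M for M :: "'w measure" +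
  fixes \<alpha> p :: real
    and parent :: "nat \<Rightarrow> 'w \<Rightarrow> nat"
    and \<sigma> :: "nat \<Rightarrow> 'w \<Rightarrow> colour"
  assumes parent_measurable: "\<And>k. k \<ge> 2 \<Longrightarrow> parent k \<in> M \<rightarrow>\<^sub>M count_space UNIV"
    and colour_measurable: "\<And>k. k \<ge> 1 \<Longrightarrow> \<sigma> k \<in> M \<rightarrow>\<^sub>M count_space UNIV"
    and parent_earlier: "\<And>k \<omega>. k \<ge> 2 \<Longrightarrow> \<omega> \<in> space M \<Longrightarrow> parent k \<omega> \<in> {1..<k}"
    and root_colour: "\<And>c. \<P>(\<omega> in M. \<sigma> 1 \<omega> = c) = 1 / 2"
    and attachment: "\<And>n v t s. n \<ge> 1 \<Longrightarrow> v \<in> {1..n} \<Longrightarrow>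
      \<P>(\<omega> in M. (\<forall>k\<in>{2..n}. parent k \<omega> = t k) \<and> (\<forall>k\<in>{1..n}. \<sigma> k \<omega> = s k)) > 0 \<Longrightarrow>
      \<P>(\<omega> in M. parent (Suc n) \<omega> = v \<bar>
         (\<forall>k\<in>{2..n}. parent k \<omega> = t k) \<and> (\<forall>k\<in>{1..n}. \<sigma> k \<omega> = s k))
        = attach_prob \<alpha> t n v"
    and broadcast: "\<And>n v t s c. n \<ge> 1 \<Longrightarrow> v \<in> {1..n} \<Longrightarrow>
      \<P>(\<omega> in M. parent (Suc n) \<omega> = v \<and>
         (\<forall>k\<in>{2..n}. parent k \<omega> = t k) \<and> (\<forall>k\<in>{1..n}. \<sigma> k \<omega> = s k)) > 0 \<Longrightarrow>
      \<P>(\<omega> in M. \<sigma> (Suc n) \<omega> = c \<bar> parent (Suc n) \<omega> = v \<and>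
         (\<forall>k\<in>{2..n}. parent k \<omega> = t k) \<and> (\<forall>k\<in>{1..n}. \<sigma> k \<omega> = s k))
        = (if c = s v then p else 1 - p)"

definition colour_count :: "(nat \<Rightarrow> 'w \<Rightarrow> colour) \<Rightarrow> colour \<Rightarrow> nat \<Rightarrow> 'w \<Rightarrow> nat" where
  "colour_count \<sigma> c n \<omega> = card {k \<in> {1..n}. \<sigma> k \<omega> = c}"

definition RB :: "(nat \<Rightarrow> 'w \<Rightarrow> colour) \<Rightarrow> nat \<Rightarrow> 'w \<Rightarrow> real^2" where
  "RB \<sigma> n \<omega> = vector [real (colour_count \<sigma> Red n \<omega>), real (colour_count \<sigma> Blue n \<omega>)]"

definition root_sign :: "(nat \<Rightarrow> 'w \<Rightarrow> colour) \<Rightarrow> 'w \<Rightarrow> real" where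
  "root_sign \<sigma> \<omega> = (if \<sigma> 1 \<omega> = Red then 1 else - 1)"


section \<open>Convergence in distribution and multivariate normal laws\<close>

text \<open>The library notion \<open>weak_conv_m\<close> covers real random variables only.\<close>

definition conv_in_distribution ::
    "'w measure \<Rightarrow> (nat \<Rightarrow> 'w \<Rightarrow> 'b::metric_space) \<Rightarrow> 'b measure \<Rightarrow> bool" where
  "conv_in_distribution M X N \<longleftrightarrow>
     (\<forall>n. X n \<in> borel_measurable M) \<and> prob_space N \<and> sets N = sets borel \<and>
     (\<forall>f :: 'b \<Rightarrow> real. continuous_on UNIV f \<longrightarrow> bounded (range f) \<longrightarrow>
        (\<lambda>n. \<integral>\<omega>. f (X n \<omega>) \<partial>M) \<longlonglongrightarrow> (\<integral>x. f x \<partial>N))"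

definition std_normal_vector :: "(real^'n) measure" where
  "std_normal_vector =
     distr (\<Pi>\<^sub>M i\<in>(UNIV :: 'n set). (std_normal_distribution :: real measure)) borel (\<lambda>x. \<chi> i. x i)"

text \<open>
  The law of \<open>A *v G\<close> with \<open>G\<close> standard normal depends only on the covariance matrix
  \<open>\<Sigma> = A ** transpose A\<close>; it is degenerate when \<open>\<Sigma>\<close> is singular.
\<close>

definition centred_normal :: "real^'n^'n \<Rightarrow> (real^'n) measure \<Rightarrow> bool" where
  "centred_normal \<Sigma> N \<longleftrightarrow>
     (\<exists>A :: real^'n^'n. A ** transpose A = \<Sigma> \<and> N = distr std_normal_vector borel ((*v) A))"

definition conv_to_centred_normal ::
    "'w measure \<Rightarrow> (nat \<Rightarrow> 'w \<Rightarrow> real^'n) \<Rightarrow> real^'n^'n \<Rightarrow> bool" where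
  "conv_to_centred_normal M X \<Sigma> \<longleftrightarrow> (\<exists>N. centred_normal \<Sigma> N \<and> conv_in_distribution M X N)"


section \<open>Constants\<close>

definition c_coeff :: "real \<Rightarrow> real \<Rightarrow> real" where
  "c_coeff \<alpha> p =
     (if p = 1 / 2 then 1 / 4 else (4 * \<alpha> * p - \<alpha> - 1) / (4 * (4 * p + \<alpha> - 3)))"

definition alternating_matrix :: "real^2^2" where
  "alternating_matrix = vector [vector [1, - 1], vector [- 1, 1]]"

end

theory Submission
  imports Defs "HOL-Real_Asymp.Real_Asymp"
begin

text \<open>
  Let \<open>X\<^sub>n = R\<^sub>n - B\<^sub>n\<close>.  Since \<open>R\<^sub>n + B\<^sub>n = n\<close>, the centred vector is \<open>X\<^sub>n / 2\<close> times \<open>(1, -1)\<close>, and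
  every claim is one about the real process \<open>X\<close>.  Let \<open>Y\<^sub>n\<close> be the sum of the attachment weights
  \<open>\<alpha> deg\<^sup>+ + 1\<close>, each with the sign of the colour of its vertex, and let \<open>W\<^sub>n = (1 + \<alpha>) n - \<alpha>\<close> be the total
  weight.  The next parent is red with probability \<open>(1 + Y\<^sub>n / W\<^sub>n) / 2\<close>.  If \<open>s\<close> is its sign and \<open>s'\<close> that of
  its child, then \<open>X\<close> grows by \<open>s'\<close> and \<open>Y\<close> by \<open>\<alpha> s + s'\<close>.  So \<open>(X, Y)\<close> is a Markov chain, in fact a
  two-colour urn, and \<open>one_step_expectation\<close> translates the growth of the trees into it.

  Given the past, \<open>Y\<close> is multiplied in mean by \<open>1 + \<delta> / W\<^sub>n\<close> with \<open>\<delta> = \<alpha> + 2p - 1\<close>, and \<open>X\<close> has drift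
  \<open>(2p - 1) Y\<^sub>n / W\<^sub>n\<close>.  Hence \<open>Y\<^sub>n\<close> has a systematic part of order \<open>n\<close> to the power \<open>\<lambda> = \<delta> / (1 + \<alpha>)\<close>, which
  competes with fluctuations of order \<open>\<surd>n\<close>; the three regimes are \<open>\<lambda>\<close> below, at and above \<open>1/2\<close>, that
  is, \<open>p\<close> below, at and above \<open>(3 - \<alpha>) / 4\<close>.  The second moments of \<open>(X, Y)\<close> solve linear recursions, whose
  growth comes from \<open>linear_recursion_tendsto\<close> (\<open>EXX_linear\<close>, \<open>EXX_linear_log\<close>).

  Strong law: for \<open>p < 1\<close> the second moment of \<open>X\<^sub>n\<close> is of smaller order than some \<open>n\<close> to the power \<open>\<theta> < 2\<close>,
  so \<open>\<Sum> X\<^sub>n\<^sup>2 / n\<^sup>3\<close> converges almost surely.  Because \<open>X\<close> moves by one at each step, one value with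
  \<open>\<bar>X\<^sub>n\<bar> \<ge> \<epsilon> n\<close> would force a fixed contribution to this series near \<open>n\<close>, so there are only finitely many.

  Gaussian regimes: the conditional expectation of \<open>X\<^sub>n\<close> given the first \<open>k\<close> vertices is \<open>X\<^sub>k + b\<^sub>n\<^sub>k Y\<^sub>k\<close> for a
  deterministic \<open>b\<^sub>n\<^sub>k\<close> (\<open>dual_freq\<close>).  The expectation of \<open>exp (\<i> x (X\<^sub>k + b\<^sub>n\<^sub>k Y\<^sub>k))\<close> therefore changes from
  \<open>k\<close> to \<open>k + 1\<close> only by a factor \<open>exp (- x\<^sup>2 Q / 2)\<close>, where \<open>Q\<close> is a deterministic mean square of the step,
  up to an error of third order and one governed by \<open>(Y\<^sub>k / W\<^sub>k)\<^sup>2\<close> (\<open>char_XY_step\<close>).  The bound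
  \<open>\<bar>b\<^sub>n\<^sub>k\<bar> \<le> C (n / k)\<close> to the power \<open>\<mu>\<close> makes the sum of the errors vanish, and the sum of the \<open>Q\<close> is \<open>E X\<^sub>n\<^sup>2\<close> up to a
  negligible term (\<open>variance_decomposition\<close>), so that the limiting variance is read off from the moment
  recursion.  Levy's continuity theorem concludes (\<open>central_limit\<close>).

  Supercritical regime: \<open>Y\<^sub>n\<close> divided by the product of its growth factors is a martingale bounded in mean
  square, hence it converges in mean square to some \<open>V\<close>.  With \<open>c = (2p - 1) / \<delta>\<close> the process \<open>X - c Y\<close> is a
  martingale with bounded increments, thus of order \<open>\<surd>n\<close> and negligible.  The growth product is a quotient
  of Pochhammer symbols, which yields the Gamma factors, and \<open>Z\<close> is the root sign times a multiple of
  \<open>V\<close> (\<open>supercritical\<close>).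
\<close>

section \<open>Growth of linear recursions\<close>

text \<open>
  Each step replaces \<open>x\<close> by a weighted mean of \<open>x\<close> and \<open>h\<close>.  The product condition says that the weight left on
  any starting value dies out, so \<open>x\<close> forgets its start and follows \<open>h\<close>.
\<close>
lemma contraction_tendsto:
  fixes x \<kappa> h :: "nat \<Rightarrow> real"
  assumes step: "eventually (\<lambda>n. x (Suc n) = (1 - \<kappa> n) * x n + \<kappa> n * h n) sequentially"
    and range: "eventually (\<lambda>n. 0 \<le> \<kappa> n \<and> \<kappa> n \<le> 1) sequentially"
    and prod: "\<And>N. eventually (\<lambda>N. (\<lambda>n. \<Prod>j=N..<n. 1 - \<kappa> j) \<longlonglongrightarrow> 0) sequentially"
    and h: "h \<longlonglongrightarrow> l"
  shows "x \<longlonglongrightarrow> l"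
proof (rule LIMSEQ_I)
  fix r :: real assume r: "r > 0"
  have "eventually (\<lambda>n. \<bar>h n - l\<bar> < r / 2) sequentially"
    using tendstoD[OF h, of "r/2"] r by (simp add: dist_real_def)
  with step range prod have "eventually (\<lambda>N. x (Suc N) = (1 - \<kappa> N) * x N + \<kappa> N * h N \<and>
      (0 \<le> \<kappa> N \<and> \<kappa> N \<le> 1) \<and> \<bar>h N - l\<bar> < r / 2 \<and> (\<lambda>n. \<Prod>j=N..<n. 1 - \<kappa> j) \<longlonglongrightarrow> 0) sequentially"
    by eventually_elim auto
  then obtain N where N: "\<And>n. n \<ge> N \<Longrightarrow> x (Suc n) = (1 - \<kappa> n) * x n + \<kappa> n * h n"
      "\<And>n. n \<ge> N \<Longrightarrow> 0 \<le> \<kappa> n" "\<And>n. n \<ge> N \<Longrightarrow> \<kappa> n \<le> 1" "\<And>n. n \<ge> N \<Longrightarrow> \<bar>h n - l\<bar> < r / 2"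
      "(\<lambda>n. \<Prod>j=N..<n. 1 - \<kappa> j) \<longlonglongrightarrow> 0"
    unfolding eventually_sequentially by blast
  have bound: "\<bar>x n - l\<bar> \<le> r / 2 + (\<Prod>j=N..<n. 1 - \<kappa> j) * \<bar>x N - l\<bar>" if "n \<ge> N" for n
    using that
  proof (induction n rule: dec_induct)
    case base
    then show ?case using r by simp
  next
    case (step n)
    have "x (Suc n) - l = (1 - \<kappa> n) * (x n - l) + \<kappa> n * (h n - l)"
      using N(1)[of n] step by (simp add: algebra_simps)
    also have "\<bar>\<dots>\<bar> \<le> (1 - \<kappa> n) * \<bar>x n - l\<bar> + \<kappa> n * \<bar>h n - l\<bar>"
      using N(2,3)[of n] step by (intro order_trans[OF abs_triangle_ineq]) (simp add: abs_mult)
    also have "\<dots> \<le> (1 - \<kappa> n) * (r / 2 + (\<Prod>j=N..<n. 1 - \<kappa> j) * \<bar>x N - l\<bar>) + \<kappa> n * (r / 2)"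
      using N(2,3,4)[of n] step by (intro add_mono mult_left_mono) auto
    also have "\<dots> = r / 2 + (\<Prod>j=N..<Suc n. 1 - \<kappa> j) * \<bar>x N - l\<bar>"
      using step by (simp add: algebra_simps add_divide_distrib diff_divide_distrib)
    finally show ?case .
  qed
  have "(\<lambda>n. r / 2 + (\<Prod>j=N..<n. 1 - \<kappa> j) * \<bar>x N - l\<bar>) \<longlonglongrightarrow> r / 2 + 0 * \<bar>x N - l\<bar>"
    by (intro tendsto_intros N)
  then have "eventually (\<lambda>n. r / 2 + (\<Prod>j=N..<n. 1 - \<kappa> j) * \<bar>x N - l\<bar> < r) sequentially"
    by (rule order_tendstoD(2)) (use r in simp)
  then have "eventually (\<lambda>n. \<bar>x n - l\<bar> < r) sequentially"
    using eventually_ge_at_top[of N] by eventually_elim (use bound in force)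
  then show "\<exists>no. \<forall>n\<ge>no. norm (x n - l) < r"
    by (simp add: eventually_sequentially)
qed

text \<open>The harmonic series diverges: compare \<open>1 - c / n\<close> with \<open>(n / (n + 1)) powr c\<close>, whose product telescopes.\<close>
lemma prod_one_minus_tendsto_0:
  fixes \<kappa> :: "nat \<Rightarrow> real"
  assumes c: "c > 0" and lower: "\<And>n. n \<ge> N \<Longrightarrow> c / real n \<le> \<kappa> n"
    and upper: "\<And>n. n \<ge> N \<Longrightarrow> \<kappa> n \<le> 1" and N: "N \<ge> 1"
  shows "(\<lambda>n. \<Prod>j=N..<n. 1 - \<kappa> j) \<longlonglongrightarrow> 0"
proof (rule tendsto_sandwich)
  show "(\<lambda>n. 0) \<longlonglongrightarrow> (0::real)" by simp
  show "eventually (\<lambda>n. 0 \<le> (\<Prod>j=N..<n. 1 - \<kappa> j)) sequentially"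
    using upper by (intro always_eventually allI prod_nonneg) auto
  have "(\<Prod>j=N..<n. 1 - \<kappa> j) \<le> (real N / real n) powr c" if "n \<ge> N" for n
    using that
  proof (induction n rule: dec_induct)
    case base
    then show ?case using N by simp
  next
    case (step n)
    have "ln (real (Suc n)) - ln (real n) \<le> 1 / real n"
      using step N ln_diff_le[of "real (Suc n)" "real n"] by simp
    then have "c * (ln (real (Suc n)) - ln (real n)) \<le> c * (1 / real n)"
      using c by (intro mult_left_mono) auto
    then have "- (c / real n) \<le> c * ln (real n) - c * ln (real (Suc n))"
      by (simp add: right_diff_distrib del: of_nat_Suc)
    then have "exp (- (c / real n)) \<le> exp (c * ln (real n) - c * ln (real (Suc n)))"
      by (simp only: exp_le_cancel_iff)
    also have "\<dots> = (real n / real (Suc n)) powr c"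
      using step N by (simp add: powr_def ln_div right_diff_distrib del: of_nat_Suc)
    finally have "exp (- (c / real n)) \<le> (real n / real (Suc n)) powr c" .
    then have *: "1 - \<kappa> n \<le> (real n / real (Suc n)) powr c"
      using lower[of n] step exp_ge_add_one_self[of "- (c / real n)"] by linarith
    have "(\<Prod>j=N..<Suc n. 1 - \<kappa> j) = (\<Prod>j=N..<n. 1 - \<kappa> j) * (1 - \<kappa> n)"
      using step by simp
    also have "\<dots> \<le> (real N / real n) powr c * (real n / real (Suc n)) powr c"
      using step * upper[of n] by (intro mult_mono prod_nonneg) (auto simp: upper)
    also have "\<dots> = (real N / real (Suc n)) powr c"
      using step N by (subst powr_mult[symmetric]) (auto simp del: of_nat_Suc)
    finally show ?case .
  qed
  then show "eventually (\<lambda>n. (\<Prod>j=N..<n. 1 - \<kappa> j) \<le> (real N / real n) powr c) sequentially"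
    by (rule eventually_sequentiallyI)
  show "(\<lambda>n. (real N / real n) powr c) \<longlonglongrightarrow> 0"
    using c N by real_asymp
qed

text \<open>
  Division by \<open>G (Suc n)\<close> turns the recursion into a weighted mean for \<open>r / G\<close> with weight about \<open>(\<gamma> - \<epsilon>) / n\<close> on
  the forcing: \<open>\<gamma>\<close> is the exponent at which \<open>G\<close> grows and \<open>\<epsilon>\<close> the one at which the homogeneous solution does.
\<close>
lemma linear_recursion_tendsto:
  fixes r e f G :: "nat \<Rightarrow> real"
  assumes rec: "\<And>n. n \<ge> 1 \<Longrightarrow> r (Suc n) = (1 + e n) * r n + f n"
    and G_pos: "eventually (\<lambda>n. G n > 0) sequentially"
    and G_ratio: "(\<lambda>n. G n / G (Suc n)) \<longlonglongrightarrow> 1"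
    and G_growth: "(\<lambda>n. real n * (1 - G n / G (Suc n))) \<longlonglongrightarrow> \<gamma>"
    and e: "(\<lambda>n. real n * e n) \<longlonglongrightarrow> \<epsilon>"
    and f: "(\<lambda>n. real n * f n / G (Suc n)) \<longlonglongrightarrow> \<phi>"
    and gap: "\<epsilon> < \<gamma>"
  shows "(\<lambda>n. r n / G n) \<longlonglongrightarrow> \<phi> / (\<gamma> - \<epsilon>)"
proof -
  define \<kappa> where "\<kappa> n = 1 - G n / G (Suc n) * (1 + e n)" for n
  define h where "h n = real n * f n / G (Suc n) / (real n * \<kappa> n)" for n
  have "(\<lambda>n. real n * (1 - G n / G (Suc n)) - G n / G (Suc n) * (real n * e n)) \<longlonglongrightarrow> \<gamma> - 1 * \<epsilon>"
    by (intro tendsto_intros G_ratio G_growth e)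
  then have n\<kappa>: "(\<lambda>n. real n * \<kappa> n) \<longlonglongrightarrow> \<gamma> - \<epsilon>"
    by (simp add: \<kappa>_def algebra_simps add_divide_distrib)
  have h: "h \<longlonglongrightarrow> \<phi> / (\<gamma> - \<epsilon>)"
    unfolding h_def using gap by (intro tendsto_intros f n\<kappa>) auto
  have "(\<lambda>n. real n * \<kappa> n * (1 / real n)) \<longlonglongrightarrow> (\<gamma> - \<epsilon>) * 0"
    by (intro tendsto_mult n\<kappa> lim_1_over_n)
  then have "(\<lambda>n. real n * \<kappa> n * (1 / real n)) \<longlonglongrightarrow> 0" by simp
  moreover have "eventually (\<lambda>n. real n * \<kappa> n * (1 / real n) = \<kappa> n) sequentially"
    using eventually_gt_at_top[of 0] by eventually_elim simp
  ultimately have "\<kappa> \<longlonglongrightarrow> 0" by (simp add: tendsto_cong)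
  then have \<kappa>1: "eventually (\<lambda>n. \<kappa> n < 1) sequentially" by (intro order_tendstoD(2)) auto
  define c where "c = (\<gamma> - \<epsilon>) / 2"
  have c: "c > 0" using gap by (simp add: c_def)
  have "eventually (\<lambda>n. real n * \<kappa> n > c) sequentially"
    using gap by (intro order_tendstoD(1)[OF n\<kappa>]) (simp add: c_def)
  then have \<kappa>0: "eventually (\<lambda>n. c / real n < \<kappa> n) sequentially"
    using eventually_gt_at_top[of 0] by eventually_elim (simp add: field_simps)
  obtain N0 where N0: "\<And>n. n \<ge> N0 \<Longrightarrow> c / real n < \<kappa> n \<and> \<kappa> n < 1"
    using eventually_conj[OF \<kappa>0 \<kappa>1] unfolding eventually_sequentially by blast
  show ?thesis
  proof (rule contraction_tendsto[OF _ _ _ h])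
    show "eventually (\<lambda>n. 0 \<le> \<kappa> n \<and> \<kappa> n \<le> 1) sequentially"
      using \<kappa>0 \<kappa>1 eventually_gt_at_top[of 0]
    proof eventually_elim
      case (elim n)
      then show ?case using c by (smt (verit) divide_pos_pos of_nat_0_less_iff)
    qed
    show "eventually (\<lambda>N. (\<lambda>n. \<Prod>j=N..<n. 1 - \<kappa> j) \<longlonglongrightarrow> 0) sequentially"
      using eventually_ge_at_top[of "max 1 N0"]
      by eventually_elim (rule prod_one_minus_tendsto_0[OF c], use N0 in \<open>auto intro: less_imp_le\<close>)
    show "eventually (\<lambda>n. r (Suc n) / G (Suc n) = (1 - \<kappa> n) * (r n / G n) + \<kappa> n * h n) sequentially"
      using \<kappa>0 eventually_gt_at_top[of 0] G_pos eventually_sequentially_Suc[of "\<lambda>n. G n > 0", THEN iffD2, OF G_pos]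
    proof eventually_elim
      case (elim n)
      then have "\<kappa> n > 0" using c by (smt (verit) divide_pos_pos of_nat_0_less_iff)
      with elim have "\<kappa> n * h n = f n / G (Suc n)" by (simp add: h_def)
      moreover have "(1 - \<kappa> n) * (r n / G n) = (1 + e n) * r n / G (Suc n)"
        using elim by (simp add: \<kappa>_def)
      ultimately show ?case using rec[of n] elim by (simp add: add_divide_distrib)
    qed
  qed
qed

text \<open>
  The Stolz-Cesaro theorem with denominator \<open>ln\<close>.  It serves the critical second moment of \<open>Y\<close>, where homogeneous
  solution and comparison sequence grow with the same exponent, the borderline \<open>\<epsilon> = \<gamma>\<close> of the previous lemma.
\<close>
lemma log_growth_tendsto:
  fixes x d :: "nat \<Rightarrow> real"
  assumes rec: "\<And>n. n \<ge> 1 \<Longrightarrow> x (Suc n) = x n + d n" and d: "(\<lambda>n. real n * d n) \<longlonglongrightarrow> l"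
  shows "(\<lambda>n. x n / ln (real n)) \<longlonglongrightarrow> l"
proof -
  define \<kappa> where "\<kappa> n = 1 - ln (real n) / ln (real (Suc n))" for n
  define h where "h n = d n / (ln (real (Suc n)) - ln (real n))" for n
  have "(\<lambda>n. 1 / (real n * (ln (real (Suc n)) - ln (real n)))) \<longlonglongrightarrow> 1" by real_asymp
  from tendsto_mult[OF d this] have "(\<lambda>n. real n * d n * (1 / (real n * (ln (real (Suc n)) - ln (real n))))) \<longlonglongrightarrow> l" by simp
  moreover have "eventually (\<lambda>n. real n * d n * (1 / (real n * (ln (real (Suc n)) - ln (real n)))) = h n) sequentially"
    using eventually_gt_at_top[of 0] by eventually_elim (simp add: h_def)
  ultimately have h: "h \<longlonglongrightarrow> l" by (simp add: tendsto_cong)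
  show ?thesis
  proof (rule contraction_tendsto[OF _ _ _ h])
    show "eventually (\<lambda>n. x (Suc n) / ln (real (Suc n)) = (1 - \<kappa> n) * (x n / ln (real n)) + \<kappa> n * h n) sequentially"
      using eventually_gt_at_top[of 1]
    proof eventually_elim
      case (elim n)
      have *: "ln (real n) > 0" "ln (real (Suc n)) > ln (real n)" using elim by simp_all
      then have "\<kappa> n = (ln (real (Suc n)) - ln (real n)) / ln (real (Suc n))"
        using elim by (simp add: \<kappa>_def diff_divide_distrib del: of_nat_Suc)
      then have "\<kappa> n * h n = d n / ln (real (Suc n))" using * elim by (simp add: h_def divide_simps del: of_nat_Suc)
      moreover have "(1 - \<kappa> n) * (x n / ln (real n)) = x n / ln (real (Suc n))" using * by (simp add: \<kappa>_def)
      ultimately show ?case using rec[of n] elim by (simp add: add_divide_distrib)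
    qed
    show "eventually (\<lambda>n. 0 \<le> \<kappa> n \<and> \<kappa> n \<le> 1) sequentially"
      using eventually_gt_at_top[of 1] by eventually_elim (simp add: \<kappa>_def)
    show "eventually (\<lambda>N. (\<lambda>n. \<Prod>j=N..<n. 1 - \<kappa> j) \<longlonglongrightarrow> 0) sequentially"
      using eventually_gt_at_top[of 1]
    proof eventually_elim
      case (elim N)
      have "(\<Prod>j=N..<n. 1 - \<kappa> j) = ln (real N) / ln (real n)" if "n \<ge> N" for n
        using that elim
        by (induction n rule: dec_induct) (auto simp: \<kappa>_def)
      then have "eventually (\<lambda>n. ln (real N) / ln (real n) = (\<Prod>j=N..<n. 1 - \<kappa> j)) sequentially"
        by (intro eventually_sequentiallyI[of N]) simp
      moreover have "(\<lambda>n. ln (real N) / ln (real n)) \<longlonglongrightarrow> 0" by real_asymp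
      ultimately show ?case by (rule Lim_transform_eventually[rotated])
    qed
  qed
qed

section \<open>One step of the coloured tree\<close>

definition spin :: "colour \<Rightarrow> real" where
  "spin c = (if c = Red then 1 else - 1)"

lemma spin_simps [simp]: "spin Red = 1" "spin Blue = - 1" "\<bar>spin c\<bar> = 1" "spin c * spin c = 1" "(spin c)\<^sup>2 = 1"
  by (auto simp: spin_def)

definition total_weight :: "real \<Rightarrow> nat \<Rightarrow> real" where
  "total_weight \<alpha> n = (1 + \<alpha>) * real n - \<alpha>"

lemma total_weight_Suc: "total_weight \<alpha> (Suc n) = total_weight \<alpha> n + (1 + \<alpha>)"
  by (simp add: total_weight_def algebra_simps)

lemma total_weight_ge:
  assumes "\<alpha> \<ge> -1/2" "n \<ge> 1"
  shows "total_weight \<alpha> n \<ge> real n / 2"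
proof -
  have "(\<alpha> + 1/2) * (real n - 1) \<ge> 0" using assms by (intro mult_nonneg_nonneg) auto
  then show ?thesis by (simp add: total_weight_def field_simps)
qed

lemma total_weight_pos: "\<alpha> \<ge> -1/2 \<Longrightarrow> n \<ge> 1 \<Longrightarrow> total_weight \<alpha> n > 0"
  using total_weight_ge[of \<alpha> n] by simp

lemma colour_UNIV: "(UNIV :: colour set) = {Red, Blue}"
  using colour.exhaust by auto

instance colour :: finite
  by standard (simp add: colour_UNIV)

lemma sum_outdeg:
  fixes f :: "nat \<Rightarrow> real"
  assumes "\<And>k. k \<in> {2..n} \<Longrightarrow> t k \<in> {1..n}"
  shows "(\<Sum>u\<in>{1..n}. f u * real (outdeg t n u)) = (\<Sum>k\<in>{2..n}. f (t k))"
proof -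
  have "(\<Sum>u\<in>{1..n}. f u * real (outdeg t n u)) = (\<Sum>u\<in>{1..n}. \<Sum>k\<in>{2..n}. if t k = u then f u else 0)"
    by (simp add: outdeg_def sum.If_cases Int_def mult.commute)
  also have "\<dots> = (\<Sum>k\<in>{2..n}. \<Sum>u\<in>{1..n}. if t k = u then f u else 0)" by (rule sum.swap)
  also have "\<dots> = (\<Sum>k\<in>{2..n}. f (t k))"
    using assms by (intro sum.cong refl) (simp add: sum.delta)
  finally show ?thesis .
qed

text \<open>Every vertex but the root adds its parent's \<open>\<alpha>\<close> and its own \<open>1\<close>, so the shape of the tree is irrelevant.\<close>
lemma total_weight_sum:
  assumes "\<And>k. k \<in> {2..n} \<Longrightarrow> t k \<in> {1..n}" "n \<ge> 1"
  shows "(\<Sum>u\<in>{1..n}. \<alpha> * real (outdeg t n u) + 1) = total_weight \<alpha> n"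
  using sum_outdeg[of n t "\<lambda>_. \<alpha>", OF assms(1)] assms(2)
  by (simp add: sum.distrib total_weight_def of_nat_diff algebra_simps)

lemma (in prob_space)
  fixes f :: "'t \<Rightarrow> 'b::{banach,second_countable_topology}"
  assumes fin: "finite A" and T: "\<And>\<omega>. \<omega> \<in> space M \<Longrightarrow> T \<omega> \<in> A"
    and ev: "\<And>a. a \<in> A \<Longrightarrow> {\<omega> \<in> space M. T \<omega> = a} \<in> events"
  shows finite_range_integrable: "integrable M (\<lambda>\<omega>. f (T \<omega>))"
    and finite_range_expectation:
      "expectation (\<lambda>\<omega>. f (T \<omega>)) = (\<Sum>a\<in>A. prob {\<omega> \<in> space M. T \<omega> = a} *\<^sub>R f a)"
proof -
  define g where "g \<omega> = (\<Sum>a\<in>A. indicator {\<omega> \<in> space M. T \<omega> = a} \<omega> *\<^sub>R f a)" for \<omega>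
  have eq: "f (T \<omega>) = g \<omega>" if "\<omega> \<in> space M" for \<omega>
  proof -
    have "g \<omega> = (\<Sum>a\<in>A. if T \<omega> = a then f a else 0)"
      using that unfolding g_def by (intro sum.cong) (auto simp: indicator_def)
    then show ?thesis using T[OF that] fin by simp
  qed
  have int: "integrable M (\<lambda>\<omega>. indicator {\<omega> \<in> space M. T \<omega> = a} \<omega> *\<^sub>R f a)" if "a \<in> A" for a
    using ev[OF that] by (intro integrable_scaleR_left) (simp add: integrable_indicator_iff emeasure_eq_measure)
  have "integrable M g"
    unfolding g_def by (intro Bochner_Integration.integrable_sum int)
  then show "integrable M (\<lambda>\<omega>. f (T \<omega>))"
    by (subst Bochner_Integration.integrable_cong[OF refl eq])
  have "expectation (\<lambda>\<omega>. f (T \<omega>)) = expectation g"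
    by (rule Bochner_Integration.integral_cong[OF refl eq])
  also have "\<dots> = (\<Sum>a\<in>A. expectation (\<lambda>\<omega>. indicator {\<omega> \<in> space M. T \<omega> = a} \<omega> *\<^sub>R f a))"
    unfolding g_def by (intro Bochner_Integration.integral_sum int)
  also have "\<dots> = (\<Sum>a\<in>A. prob {\<omega> \<in> space M. T \<omega> = a} *\<^sub>R f a)"
    using ev by (intro sum.cong refl) (simp add: integrable_indicator_iff emeasure_eq_measure)
  finally show "expectation (\<lambda>\<omega>. f (T \<omega>)) = (\<Sum>a\<in>A. prob {\<omega> \<in> space M. T \<omega> = a} *\<^sub>R f a)" .
qed

text \<open>
  Both parameter ranges of \<open>\<alpha>\<close> lie in \<open>\<alpha> \<ge> -1/2\<close>, and this bound keeps the total weight at least \<open>n / 2\<close>.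
\<close>
locale weighted_broadcast = broadcast_pref_attachment M \<alpha> p parent \<sigma>
  for M :: "'w measure" and \<alpha> p parent \<sigma> +
  assumes alpha_ge: "\<alpha> \<ge> -1/2" and p_range: "0 \<le> p" "p \<le> 1"
begin

abbreviation "W \<equiv> total_weight \<alpha>"

lemma W_pos: "n \<ge> 1 \<Longrightarrow> W n > 0" using alpha_ge by (rule total_weight_pos)

text \<open>
  The parents and colours of the first \<open>n\<close> vertices, cut off by \<open>restrict\<close> so that they take finitely many values;
  \<open>hists n\<close> collects them all, including those of probability zero.
\<close>
definition hist :: "nat \<Rightarrow> 'w \<Rightarrow> (nat \<Rightarrow> nat) \<times> (nat \<Rightarrow> colour)" where
  "hist n \<omega> = (restrict (\<lambda>k. parent k \<omega>) {2..n}, restrict (\<lambda>k. \<sigma> k \<omega>) {1..n})"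

definition hists :: "nat \<Rightarrow> ((nat \<Rightarrow> nat) \<times> (nat \<Rightarrow> colour)) set" where
  "hists n = (PiE {2..n} (\<lambda>k. {1..<k})) \<times> (PiE {1..n} (\<lambda>_. UNIV))"

lemma finite_hists: "finite (hists n)"
  by (auto simp: hists_def intro!: finite_PiE)

lemma hist_in_hists: "\<omega> \<in> space M \<Longrightarrow> hist n \<omega> \<in> hists n"
  using parent_earlier by (auto simp: hist_def hists_def restrict_PiE_iff)

lemma hist_eq_iff:
  assumes "h \<in> hists n"
  shows "hist n \<omega> = h \<longleftrightarrow> (\<forall>k\<in>{2..n}. parent k \<omega> = fst h k) \<and> (\<forall>k\<in>{1..n}. \<sigma> k \<omega> = snd h k)"
proof -
  obtain t s where h: "h = (t, s)" "t \<in> extensional {2..n}" "s \<in> extensional {1..n}"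
    using assms by (auto simp: hists_def PiE_def)
  have "restrict (\<lambda>k. parent k \<omega>) {2..n} = t \<longleftrightarrow> (\<forall>k\<in>{2..n}. parent k \<omega> = t k)"
    using h(2) by (auto intro!: extensionalityI[of _ "{2..n}"])
  moreover have "restrict (\<lambda>k. \<sigma> k \<omega>) {1..n} = s \<longleftrightarrow> (\<forall>k\<in>{1..n}. \<sigma> k \<omega> = s k)"
    using h(3) by (auto intro!: extensionalityI[of _ "{1..n}"])
  ultimately show ?thesis by (auto simp: hist_def h)
qed

lemma hist_event [measurable]:
  assumes "h \<in> hists n"
  shows "{\<omega> \<in> space M. hist n \<omega> = h} \<in> events"
proof -
  have [measurable]: "Measurable.pred M (\<lambda>\<omega>. parent k \<omega> = v)" if "k \<in> {2..n}" for k v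
    using measurable_compose[OF parent_measurable, of k "\<lambda>x. x = v"] that by auto
  have [measurable]: "Measurable.pred M (\<lambda>\<omega>. \<sigma> k \<omega> = v)" if "k \<in> {1..n}" for k v
    using measurable_compose[OF colour_measurable, of k "\<lambda>x. x = v"] that by auto
  show ?thesis unfolding hist_eq_iff[OF assms] by measurable
qed

lemma
  fixes f :: "_ \<Rightarrow> 'b::{banach,second_countable_topology}"
  shows integrable_hist: "integrable M (\<lambda>\<omega>. f (hist n \<omega>))"
    and expectation_hist:
      "expectation (\<lambda>\<omega>. f (hist n \<omega>)) = (\<Sum>h\<in>hists n. prob {\<omega> \<in> space M. hist n \<omega> = h} *\<^sub>R f h)"
  by (rule finite_range_integrable[OF finite_hists hist_in_hists hist_event]
      finite_range_expectation[OF finite_hists hist_in_hists hist_event]; assumption)+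

text \<open>
  Colour imbalance, unweighted and weighted by attractivity.  A vertex \<open>v\<close> has weight \<open>\<alpha>\<close> times its number
  of children plus \<open>1\<close>; summing the signed weights child by child gives the form used for \<open>hist_Y\<close>.
\<close>
definition hist_X :: "nat \<Rightarrow> (nat \<Rightarrow> nat) \<times> (nat \<Rightarrow> colour) \<Rightarrow> real" where
  "hist_X n h = (\<Sum>k\<in>{1..n}. spin (snd h k))"

definition hist_Y :: "nat \<Rightarrow> (nat \<Rightarrow> nat) \<times> (nat \<Rightarrow> colour) \<Rightarrow> real" where
  "hist_Y n h = hist_X n h + \<alpha> * (\<Sum>k\<in>{2..n}. spin (snd h (fst h k)))"

definition X :: "nat \<Rightarrow> 'w \<Rightarrow> real" where
  "X n \<omega> = hist_X n (hist n \<omega>)"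

definition Y :: "nat \<Rightarrow> 'w \<Rightarrow> real" where
  "Y n \<omega> = hist_Y n (hist n \<omega>)"

lemma X_eq: "X n \<omega> = (\<Sum>k\<in>{1..n}. spin (\<sigma> k \<omega>))"
  by (simp add: X_def hist_X_def hist_def)

lemma Y_eq:
  assumes "\<omega> \<in> space M"
  shows "Y n \<omega> = X n \<omega> + \<alpha> * (\<Sum>k\<in>{2..n}. spin (\<sigma> (parent k \<omega>) \<omega>))"
proof -
  have "snd (hist n \<omega>) (fst (hist n \<omega>) k) = \<sigma> (parent k \<omega>) \<omega>" if "k \<in> {2..n}" for k
    using parent_earlier[OF _ assms, of k] that by (auto simp: hist_def)
  then show ?thesis by (simp add: Y_def X_def hist_Y_def)
qed

lemma hist_restrict:
  assumes "m \<le> n"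
  shows "hist m \<omega> = (restrict (fst (hist n \<omega>)) {2..m}, restrict (snd (hist n \<omega>)) {1..m})"
  using assms by (auto simp: hist_def fun_eq_iff restrict_def)

lemma X_Suc: "X (Suc n) \<omega> = X n \<omega> + spin (\<sigma> (Suc n) \<omega>)"
  by (simp add: X_eq)

lemma Y_Suc:
  assumes "\<omega> \<in> space M" "n \<ge> 1"
  shows "Y (Suc n) \<omega> = Y n \<omega> + \<alpha> * spin (\<sigma> (parent (Suc n) \<omega>) \<omega>) + spin (\<sigma> (Suc n) \<omega>)"
  using assms by (simp add: Y_eq X_Suc sum.atLeast_Suc_atMost_Suc_shift algebra_simps)

lemma XY_1:
  assumes "\<omega> \<in> space M"
  shows "X 1 \<omega> = root_sign \<sigma> \<omega>" "Y 1 \<omega> = root_sign \<sigma> \<omega>"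
  using assms by (simp_all add: Y_eq X_eq root_sign_def spin_def)

text \<open>
  The parent has sign \<open>1\<close> with probability \<open>(1 + Y / W) / 2\<close>, because the attachment probabilities sum to \<open>1\<close> and their
  signed sum is \<open>Y / W\<close>.
\<close>
lemma sum_attach_weight:
  fixes f :: "real \<Rightarrow> 'b::real_vector"
  assumes "h \<in> hists n" "n \<ge> 1"
  shows "(\<Sum>v\<in>{1..n}. attach_prob \<alpha> (fst h) n v *\<^sub>R f (spin (snd h v))) =
    ((1 + hist_Y n h / W n) / 2) *\<^sub>R f 1 + ((1 - hist_Y n h / W n) / 2) *\<^sub>R f (- 1)"
proof -
  let ?t = "fst h" and ?s = "snd h"
  have t: "?t k \<in> {1..n}" if "k \<in> {2..n}" for k
  proof -
    have "?t k \<in> {1..<k}" using assms(1) that by (auto simp: hists_def PiE_def Pi_def)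
    then show ?thesis using that by auto
  qed
  have W: "(\<Sum>u\<in>{1..n}. \<alpha> * real (outdeg ?t n u) + 1) = W n"
    using total_weight_sum[OF t assms(2)] .
  have "hist_Y n h = (\<Sum>u\<in>{1..n}. spin (?s u) * (\<alpha> * real (outdeg ?t n u) + 1))"
    using sum_outdeg[of n ?t "\<lambda>u. \<alpha> * spin (?s u)", OF t]
    by (simp add: hist_Y_def hist_X_def algebra_simps sum.distrib sum_distrib_left)
  then have 1: "(\<Sum>v\<in>{1..n}. spin (?s v) * attach_prob \<alpha> ?t n v) = hist_Y n h / W n"
    unfolding attach_prob_def W by (simp add: sum_divide_distrib)
  have 2: "(\<Sum>v\<in>{1..n}. attach_prob \<alpha> ?t n v) = 1"
    unfolding attach_prob_def W by (subst sum_divide_distrib[symmetric]) (use W W_pos[OF assms(2)] in auto)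
  have "attach_prob \<alpha> ?t n v *\<^sub>R f (spin (?s v)) =
      attach_prob \<alpha> ?t n v *\<^sub>R ((1/2) *\<^sub>R (f 1 + f (-1))) +
      (spin (?s v) * attach_prob \<alpha> ?t n v) *\<^sub>R ((1/2) *\<^sub>R (f 1 - f (-1)))" for v
    by (cases "?s v") (auto simp: algebra_simps simp flip: scaleR_left.add)
  then have "(\<Sum>v\<in>{1..n}. attach_prob \<alpha> ?t n v *\<^sub>R f (spin (?s v))) =
      (1/2) *\<^sub>R (f 1 + f (-1)) + (hist_Y n h / W n) *\<^sub>R ((1/2) *\<^sub>R (f 1 - f (-1)))"
    by (simp only: sum.distrib scaleR_sum_left[symmetric] 1 2 scaleR_one)
  also have "\<dots> = ((1 + hist_Y n h / W n) / 2) *\<^sub>R f 1 + ((1 - hist_Y n h / W n) / 2) *\<^sub>R f (- 1)"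
    by (simp add: algebra_simps add_divide_distrib diff_divide_distrib)
  finally show ?thesis .
qed

lemma parent_event: "k \<ge> 2 \<Longrightarrow> {\<omega> \<in> space M. parent k \<omega> = v} \<in> events"
  using measurable_compose[OF parent_measurable, of k "\<lambda>x. x = v"] by (auto simp: pred_def)

lemma colour_event: "k \<ge> 1 \<Longrightarrow> {\<omega> \<in> space M. \<sigma> k \<omega> = c} \<in> events"
  using measurable_compose[OF colour_measurable, of k "\<lambda>x. x = c"] by (auto simp: pred_def)

text \<open>
  The model prescribes conditional probabilities only given events of positive probability.  The product formula holds
  without that proviso, since both sides vanish on a null event, and can then be summed over all histories.
\<close>
lemma joint_step_prob:
  assumes h: "h \<in> hists n" and n: "n \<ge> 1" and v: "v \<in> {1..n}"
  shows "prob {\<omega> \<in> space M. hist n \<omega> = h \<and> parent (Suc n) \<omega> = v \<and> \<sigma> (Suc n) \<omega> = c} =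
    prob {\<omega> \<in> space M. hist n \<omega> = h} * attach_prob \<alpha> (fst h) n v * (if c = snd h v then p else 1 - p)"
proof -
  let ?H = "{\<omega> \<in> space M. hist n \<omega> = h}"
  let ?V = "{\<omega> \<in> space M. parent (Suc n) \<omega> = v \<and> hist n \<omega> = h}"
  let ?C = "{\<omega> \<in> space M. hist n \<omega> = h \<and> parent (Suc n) \<omega> = v \<and> \<sigma> (Suc n) \<omega> = c}"
  have V: "?V \<in> events"
    using n by (intro sets.sets_Collect_conj parent_event hist_event h) auto
  note eq = hist_eq_iff[OF h, symmetric]
  have att: "prob ?V = prob ?H * attach_prob \<alpha> (fst h) n v"
  proof (cases "prob ?H = 0")
    case True
    then have "prob ?V = 0"
      using finite_measure_mono[of ?V ?H] hist_event[OF h] measure_nonneg[of M ?V] by auto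
    with True show ?thesis by simp
  next
    case False
    then have pos: "prob ?H > 0" by (simp add: zero_less_measure_iff)
    have "\<P>(\<omega> in M. parent (Suc n) \<omega> = v \<bar> hist n \<omega> = h) = attach_prob \<alpha> (fst h) n v"
      using attachment[OF n v, of "fst h" "snd h"] pos unfolding eq by simp
    then show ?thesis using pos by (simp add: cond_prob_def field_simps)
  qed
  show ?thesis
  proof (cases "prob ?V = 0")
    case True
    then have "prob ?C = 0"
      using finite_measure_mono[of ?C ?V] V measure_nonneg[of M ?C] by auto
    with True att show ?thesis by auto
  next
    case False
    then have pos: "prob ?V > 0" by (simp add: zero_less_measure_iff)
    have "\<P>(\<omega> in M. \<sigma> (Suc n) \<omega> = c \<bar> parent (Suc n) \<omega> = v \<and> hist n \<omega> = h) = (if c = snd h v then p else 1 - p)"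
      using broadcast[OF n v, of "fst h" "snd h"] pos unfolding eq by simp
    moreover have "{\<omega> \<in> space M. \<sigma> (Suc n) \<omega> = c \<and> parent (Suc n) \<omega> = v \<and> hist n \<omega> = h} = ?C" by auto
    ultimately have "prob ?C = prob ?V * (if c = snd h v then p else 1 - p)"
      using pos by (simp add: cond_prob_def field_simps split: if_splits)
    then show ?thesis by (simp only: att)
  qed
qed

text \<open>
  The mean of \<open>g\<close> over the increments of \<open>(X, Y)\<close> when \<open>\<eta> = Y / W\<close>: the outer weights choose the sign of the parent,
  the inner ones whether the child keeps it.
\<close>
definition step_mean :: "(real \<Rightarrow> real \<Rightarrow> 'b::real_vector) \<Rightarrow> real \<Rightarrow> 'b" where
  "step_mean g \<eta> =
     ((1 + \<eta>) / 2) *\<^sub>R (p *\<^sub>R g 1 (\<alpha> + 1) + (1 - p) *\<^sub>R g (- 1) (\<alpha> - 1)) +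
     ((1 - \<eta>) / 2) *\<^sub>R (p *\<^sub>R g (- 1) (- \<alpha> - 1) + (1 - p) *\<^sub>R g 1 (1 - \<alpha>))"

text \<open>
  The Markov property of \<open>(X, Y)\<close> in integrated form.  The function \<open>g\<close> may also depend on the history, which is what
  the martingale identities of the supercritical regime need.
\<close>
lemma one_step_expectation:
  fixes g :: "_ \<Rightarrow> real \<Rightarrow> real \<Rightarrow> 'b::{banach,second_countable_topology}"
  assumes n: "n \<ge> 1"
  shows "expectation (\<lambda>\<omega>. g (hist n \<omega>) (X (Suc n) \<omega>) (Y (Suc n) \<omega>)) =
    expectation (\<lambda>\<omega>. step_mean (\<lambda>a b. g (hist n \<omega>) (X n \<omega> + a) (Y n \<omega> + b)) (Y n \<omega> / W n))"
proof -
  define T where "T \<omega> = (hist n \<omega>, parent (Suc n) \<omega>, \<sigma> (Suc n) \<omega>)" for \<omega>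
  define F where "F = (\<lambda>(h, v, c). g h (hist_X n h + spin c) (hist_Y n h + \<alpha> * spin (snd h v) + spin c))"
  define A where "A = hists n \<times> {1..n} \<times> (UNIV :: colour set)"
  define P where "P h = prob {\<omega> \<in> space M. hist n \<omega> = h}" for h
  have T_event: "{\<omega> \<in> space M. T \<omega> = a} \<in> events" if aA: "a \<in> A" for a
  proof -
    obtain h v c where a: "a = (h, v, c)" "h \<in> hists n" using aA unfolding A_def by blast
    show ?thesis unfolding T_def a prod.inject using n
      by (intro sets.sets_Collect_conj parent_event colour_event hist_event a) auto
  qed
  have T_in: "T \<omega> \<in> A" if "\<omega> \<in> space M" for \<omega>
    using hist_in_hists[OF that] parent_earlier[of "Suc n", OF _ that] n by (auto simp: T_def A_def)
  have finA: "finite A" by (simp add: A_def finite_hists)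
  have "g (hist n \<omega>) (X (Suc n) \<omega>) (Y (Suc n) \<omega>) = F (T \<omega>)" if \<omega>: "\<omega> \<in> space M" for \<omega>
  proof -
    have "parent (Suc n) \<omega> \<in> {1..n}" using parent_earlier[of "Suc n", OF _ \<omega>] n by auto
    then have "snd (hist n \<omega>) (parent (Suc n) \<omega>) = \<sigma> (parent (Suc n) \<omega>) \<omega>" by (auto simp: hist_def)
    then show ?thesis by (simp add: T_def F_def X_Suc Y_Suc[OF \<omega> n] X_def[symmetric] Y_def[symmetric])
  qed
  then have "expectation (\<lambda>\<omega>. g (hist n \<omega>) (X (Suc n) \<omega>) (Y (Suc n) \<omega>)) = expectation (\<lambda>\<omega>. F (T \<omega>))"
    by (intro Bochner_Integration.integral_cong refl)
  also have "\<dots> = (\<Sum>a\<in>A. prob {\<omega> \<in> space M. T \<omega> = a} *\<^sub>R F a)"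
    by (rule finite_range_expectation[OF finA T_in T_event])
  also have "\<dots> = (\<Sum>h\<in>hists n. \<Sum>v\<in>{1..n}. \<Sum>c\<in>UNIV. prob {\<omega> \<in> space M. T \<omega> = (h, v, c)} *\<^sub>R F (h, v, c))"
    unfolding A_def by (simp add: sum.cartesian_product)
  also have "\<dots> = (\<Sum>h\<in>hists n. \<Sum>v\<in>{1..n}. \<Sum>c\<in>UNIV.
      (P h * attach_prob \<alpha> (fst h) n v * (if c = snd h v then p else 1 - p)) *\<^sub>R F (h, v, c))"
    using joint_step_prob[OF _ n] by (intro sum.cong refl) (simp add: T_def P_def)
  also have "\<dots> = (\<Sum>h\<in>hists n. P h *\<^sub>R step_mean (\<lambda>a b. g h (hist_X n h + a) (hist_Y n h + b)) (hist_Y n h / W n))"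
  proof (intro sum.cong refl)
    fix h assume h: "h \<in> hists n"
    define f where "f s = p *\<^sub>R g h (hist_X n h + s) (hist_Y n h + (\<alpha> * s + s)) +
        (1 - p) *\<^sub>R g h (hist_X n h - s) (hist_Y n h + (\<alpha> * s - s))" for s
    have "(\<Sum>c\<in>UNIV. (P h * attach_prob \<alpha> (fst h) n v * (if c = snd h v then p else 1 - p)) *\<^sub>R F (h, v, c)) =
      P h *\<^sub>R (attach_prob \<alpha> (fst h) n v *\<^sub>R f (spin (snd h v)))" for v
      by (cases "snd h v") (simp_all add: colour_UNIV F_def f_def algebra_simps)
    then have "(\<Sum>v\<in>{1..n}. \<Sum>c\<in>UNIV. (P h * attach_prob \<alpha> (fst h) n v * (if c = snd h v then p else 1 - p)) *\<^sub>R F (h, v, c))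
       = P h *\<^sub>R (\<Sum>v\<in>{1..n}. attach_prob \<alpha> (fst h) n v *\<^sub>R f (spin (snd h v)))"
      by (simp add: scaleR_sum_right)
    also have "(\<Sum>v\<in>{1..n}. attach_prob \<alpha> (fst h) n v *\<^sub>R f (spin (snd h v))) =
       step_mean (\<lambda>a b. g h (hist_X n h + a) (hist_Y n h + b)) (hist_Y n h / W n)"
      by (subst sum_attach_weight[OF h n]) (simp add: step_mean_def f_def algebra_simps)
    finally show "(\<Sum>v\<in>{1..n}. \<Sum>c\<in>UNIV. (P h * attach_prob \<alpha> (fst h) n v * (if c = snd h v then p else 1 - p)) *\<^sub>R F (h, v, c))
       = P h *\<^sub>R step_mean (\<lambda>a b. g h (hist_X n h + a) (hist_Y n h + b)) (hist_Y n h / W n)" .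
  qed
  also have "\<dots> = expectation (\<lambda>\<omega>. step_mean (\<lambda>a b. g (hist n \<omega>) (X n \<omega> + a) (Y n \<omega> + b)) (Y n \<omega> / W n))"
    unfolding P_def X_def Y_def by (rule expectation_hist[symmetric])
  finally show ?thesis .
qed

end

section \<open>Second moments\<close>

lemma weight_ratio:
  assumes "\<alpha> \<ge> -1/2"
  shows "(\<lambda>n. real n / total_weight \<alpha> n) \<longlonglongrightarrow> 1 / (1 + \<alpha>)"
  unfolding total_weight_def using assms by (real_asymp simp: field_simps)

lemma weighted_rate:
  assumes "\<alpha> \<ge> -1/2"
  shows "(\<lambda>n. real n * (\<epsilon> / total_weight \<alpha> n)) \<longlonglongrightarrow> \<epsilon> / (1 + \<alpha>)"
  using tendsto_mult[OF tendsto_const[of \<epsilon>] weight_ratio[OF assms]] by (simp add: mult.commute)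

text \<open>
  All moment recursions have a homogeneous factor \<open>1 + \<epsilon> / W\<close>, which is \<open>1 + \<epsilon> / ((1 + \<alpha>) n)\<close> to first order.
\<close>
context
  fixes \<alpha> \<epsilon> :: real and r f :: "nat \<Rightarrow> real"
  assumes \<alpha>: "\<alpha> \<ge> -1/2"
    and rec: "\<And>n. n \<ge> 1 \<Longrightarrow> r (Suc n) = (1 + \<epsilon> / total_weight \<alpha> n) * r n + f n"
begin

lemma linear_growth:
  assumes f: "f \<longlonglongrightarrow> \<phi>" and "\<epsilon> < 1 + \<alpha>"
  shows "(\<lambda>n. r n / real n) \<longlonglongrightarrow> \<phi> / (1 - \<epsilon> / (1 + \<alpha>))"
proof (rule linear_recursion_tendsto[OF rec _ _ _ weighted_rate[OF \<alpha>]])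
  show "(\<lambda>n. real n / real (Suc n)) \<longlonglongrightarrow> 1" "(\<lambda>n. real n * (1 - real n / real (Suc n))) \<longlonglongrightarrow> 1"
    by real_asymp+
  have "(\<lambda>n. real n / real (Suc n) * f n) \<longlonglongrightarrow> 1 * \<phi>"
    by (intro tendsto_mult f) real_asymp
  then show "(\<lambda>n. real n * f n / real (Suc n)) \<longlonglongrightarrow> \<phi>" by simp
  show "eventually (\<lambda>n. real n > 0) sequentially" by real_asymp
  show "\<epsilon> / (1 + \<alpha>) < 1" using assms \<alpha> by simp
qed

lemma linear_log_growth:
  assumes f: "(\<lambda>n. f n / ln (real n)) \<longlonglongrightarrow> \<phi>" and "\<epsilon> < 1 + \<alpha>"
  shows "(\<lambda>n. r n / (real n * ln (real n))) \<longlonglongrightarrow> \<phi> / (1 - \<epsilon> / (1 + \<alpha>))"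
proof (rule linear_recursion_tendsto[OF rec _ _ _ weighted_rate[OF \<alpha>]])
  show "(\<lambda>n. real n * ln (real n) / (real (Suc n) * ln (real (Suc n)))) \<longlonglongrightarrow> 1"
    by real_asymp
  have "(\<lambda>n. real n * (ln (real (Suc n)) - ln (real n)) * (1 / ln (real (Suc n)))) \<longlonglongrightarrow> 1 * 0"
    by (intro tendsto_mult) real_asymp+
  moreover have "eventually (\<lambda>n. real n * (ln (real (Suc n)) - ln (real n)) * (1 / ln (real (Suc n))) =
      real n * (1 - ln (real n) / ln (real (Suc n)))) sequentially"
    using eventually_gt_at_top[of 0] by eventually_elim (simp add: diff_divide_distrib right_diff_distrib)
  ultimately have ln_ratio: "(\<lambda>n. real n * (1 - ln (real n) / ln (real (Suc n)))) \<longlonglongrightarrow> 0"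
    by (simp add: tendsto_cong)
  have "(\<lambda>n. real n * (1 - real n / real (Suc n)) +
      real n / real (Suc n) * (real n * (1 - ln (real n) / ln (real (Suc n))))) \<longlonglongrightarrow> 1 + 1 * 0"
    by (intro tendsto_add tendsto_mult ln_ratio) real_asymp+
  moreover have "real n * (1 - real n / real (Suc n)) +
      real n / real (Suc n) * (real n * (1 - ln (real n) / ln (real (Suc n)))) =
      real n * (1 - real n * ln (real n) / (real (Suc n) * ln (real (Suc n))))" for n
    by (simp add: right_diff_distrib del: of_nat_Suc)
  ultimately show "(\<lambda>n. real n * (1 - real n * ln (real n) / (real (Suc n) * ln (real (Suc n))))) \<longlonglongrightarrow> 1"
    by simp
  have "(\<lambda>n. real n * ln (real n) / (real (Suc n) * ln (real (Suc n))) * (f n / ln (real n))) \<longlonglongrightarrow> 1 * \<phi>"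
    by (intro tendsto_mult f) real_asymp
  moreover have "eventually (\<lambda>n. real n * ln (real n) / (real (Suc n) * ln (real (Suc n))) * (f n / ln (real n)) =
      real n * f n / (real (Suc n) * ln (real (Suc n)))) sequentially"
    using eventually_gt_at_top[of 1] by eventually_elim simp
  ultimately show "(\<lambda>n. real n * f n / (real (Suc n) * ln (real (Suc n)))) \<longlonglongrightarrow> \<phi>"
    by (simp add: tendsto_cong)
  show "eventually (\<lambda>n. real n * ln (real n) > 0) sequentially" by real_asymp
  show "\<epsilon> / (1 + \<alpha>) < 1" using assms \<alpha> by simp
qed

lemma power_growth:
  assumes f: "(\<lambda>n. f n / real n powr (\<theta> - 1)) \<longlonglongrightarrow> 0" and "\<epsilon> / (1 + \<alpha>) < \<theta>"
  shows "(\<lambda>n. r n / real n powr \<theta>) \<longlonglongrightarrow> 0"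
proof -
  have "(\<lambda>n. r n / real n powr \<theta>) \<longlonglongrightarrow> 0 / (\<theta> - \<epsilon> / (1 + \<alpha>))"
  proof (rule linear_recursion_tendsto[OF rec _ _ _ weighted_rate[OF \<alpha>]])
    show "(\<lambda>n. real n powr \<theta> / real (Suc n) powr \<theta>) \<longlonglongrightarrow> 1"
         "(\<lambda>n. real n * (1 - real n powr \<theta> / real (Suc n) powr \<theta>)) \<longlonglongrightarrow> \<theta>"
      by real_asymp+
    have "(\<lambda>n. real n powr \<theta> / real (Suc n) powr \<theta> * (f n / real n powr (\<theta> - 1))) \<longlonglongrightarrow> 1 * 0"
      by (intro tendsto_mult f) real_asymp
    moreover have "eventually (\<lambda>n. real n powr \<theta> / real (Suc n) powr \<theta> * (f n / real n powr (\<theta> - 1)) =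
        real n * f n / real (Suc n) powr \<theta>) sequentially"
      using eventually_gt_at_top[of 0] by eventually_elim (simp add: powr_diff)
    ultimately show "(\<lambda>n. real n * f n / real (Suc n) powr \<theta>) \<longlonglongrightarrow> 0"
      by (simp add: tendsto_cong)
    show "eventually (\<lambda>n. real n powr \<theta> > 0) sequentially" by real_asymp
  qed (use assms in auto)
  then show ?thesis by simp
qed

end

context weighted_broadcast
begin

text \<open>
  Conditionally on the past, \<open>Y\<close> grows in mean by \<open>drift * Y / W\<close>, and \<open>step_var\<close> is the mean square of its
  increment.
\<close>
definition drift :: real where "drift = \<alpha> + 2 * p - 1"
definition step_var :: real where "step_var = 1 + \<alpha>\<^sup>2 + 2 * \<alpha> * (2 * p - 1)"

lemma integrable_XY:
  fixes g :: "real \<Rightarrow> real \<Rightarrow> 'b::{banach,second_countable_topology}"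
  shows "integrable M (\<lambda>\<omega>. g (X n \<omega>) (Y n \<omega>))"
  unfolding X_def Y_def by (rule integrable_hist)

lemmas integrable_moments = integrable_XY[of "\<lambda>x y. x\<^sup>2"] integrable_XY[of "\<lambda>x y. y\<^sup>2"]
  integrable_XY[of "\<lambda>x y. x * y"] integrable_XY[of "\<lambda>x y. x"] integrable_XY[of "\<lambda>x y. y"]

definition EYY where "EYY n = expectation (\<lambda>\<omega>. (Y n \<omega>)\<^sup>2)"
definition EXY where "EXY n = expectation (\<lambda>\<omega>. X n \<omega> * Y n \<omega>)"
definition EXX where "EXX n = expectation (\<lambda>\<omega>. (X n \<omega>)\<^sup>2)"

lemma EYY_Suc: assumes "n \<ge> 1" shows "EYY (Suc n) = (1 + 2 * drift / W n) * EYY n + step_var"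
proof -
  have "step_mean (\<lambda>a b. (y + b)\<^sup>2) (y / W n) = (1 + 2 * drift / W n) * y\<^sup>2 + step_var" for y
    using W_pos[OF assms]
    by (simp add: step_mean_def drift_def step_var_def field_simps power2_eq_square)
  then show ?thesis
    unfolding EYY_def by (subst one_step_expectation[OF assms, of "\<lambda>h x y. y\<^sup>2"]) (simp add: integrable_moments prob_space)
qed

lemma EXY_Suc:
  assumes "n \<ge> 1"
  shows "EXY (Suc n) = (1 + drift / W n) * EXY n + ((2 * p - 1) * EYY n / W n + (1 + \<alpha> * (2 * p - 1)))"
proof -
  have "step_mean (\<lambda>a b. (x + a) * (y + b)) (y / W n) =
     (1 + drift / W n) * (x * y) + ((2 * p - 1) / W n * y\<^sup>2 + (1 + \<alpha> * (2 * p - 1)))" for x y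
    using W_pos[OF assms]
    by (simp add: step_mean_def drift_def field_simps power2_eq_square)
  then show ?thesis
    unfolding EYY_def EXY_def by (subst one_step_expectation[OF assms, of "\<lambda>h x y. x * y"]) (simp add: integrable_moments prob_space)
qed

lemma EXX_Suc:
  assumes "n \<ge> 1"
  shows "EXX (Suc n) = EXX n + (2 * (2 * p - 1) * EXY n / W n + 1)"
proof -
  have "step_mean (\<lambda>a b. (x + a)\<^sup>2) (y / W n) = x\<^sup>2 + (2 * (2 * p - 1) / W n * (x * y) + 1)" for x y
    using W_pos[OF assms]
    by (simp add: step_mean_def field_simps power2_eq_square)
  then show ?thesis
    unfolding EXX_def EXY_def by (subst one_step_expectation[OF assms, of "\<lambda>h x y. x\<^sup>2"]) (simp add: integrable_moments prob_space)
qed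

lemma moments_1: "EYY 1 = 1" "EXY 1 = 1" "EXX 1 = 1"
proof -
  have *: "(root_sign \<sigma> \<omega>)\<^sup>2 = 1" "root_sign \<sigma> \<omega> * root_sign \<sigma> \<omega> = 1" for \<omega> :: 'w by (auto simp: root_sign_def)
  have "expectation (\<lambda>\<omega>. (Y 1 \<omega>)\<^sup>2) = expectation (\<lambda>\<omega>. 1)" "expectation (\<lambda>\<omega>. X 1 \<omega> * Y 1 \<omega>) = expectation (\<lambda>\<omega>. 1)"
      "expectation (\<lambda>\<omega>. (X 1 \<omega>)\<^sup>2) = expectation (\<lambda>\<omega>. 1)"
    by (intro Bochner_Integration.integral_cong refl; simp only: XY_1 *)+
  then show "EYY 1 = 1" "EXY 1 = 1" "EXX 1 = 1" unfolding EYY_def EXY_def EXX_def by (simp_all add: prob_space)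
qed

lemma X_bound: "\<bar>X n \<omega>\<bar> \<le> real n"
  unfolding X_eq by (rule order_trans[OF sum_abs]) simp

lemma Y_bound: assumes "\<omega> \<in> space M" shows "\<bar>Y n \<omega>\<bar> \<le> (1 + \<bar>\<alpha>\<bar>) * real n"
proof -
  have "\<bar>\<Sum>k\<in>{2..n}. spin (\<sigma> (parent k \<omega>) \<omega>)\<bar> \<le> real n"
    by (rule order_trans[OF sum_abs]) simp
  then have "\<bar>\<alpha>\<bar> * \<bar>\<Sum>k\<in>{2..n}. spin (\<sigma> (parent k \<omega>) \<omega>)\<bar> \<le> \<bar>\<alpha>\<bar> * real n"
    by (intro mult_left_mono) auto
  then show ?thesis unfolding Y_eq[OF assms] using X_bound[of n \<omega>]
    by (intro order_trans[OF abs_triangle_ineq]) (simp add: abs_mult algebra_simps)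
qed

lemma one_plus_alpha: "1 + \<alpha> > 0" using alpha_ge by simp

text \<open>
  The homogeneous solutions for the second moments grow like \<open>n\<close> to the powers \<open>2 \<lambda>\<close>, \<open>\<lambda>\<close> and \<open>0\<close> with
  \<open>\<lambda> = drift / (1 + \<alpha>)\<close>, and a bounded forcing adds order \<open>n\<close>.  A power beyond all of these dominates the three moments
  in turn, each entering the forcing of the next.
\<close>
lemma
  assumes \<theta>: "\<theta> > 1" "2 * drift / (1 + \<alpha>) < \<theta>"
  shows EYY_small: "(\<lambda>n. EYY n / real n powr \<theta>) \<longlonglongrightarrow> 0"
    and EXX_small: "(\<lambda>n. EXX n / real n powr \<theta>) \<longlonglongrightarrow> 0"
proof -
  have drift\<theta>: "drift / (1 + \<alpha>) < \<theta>"
  proof (cases "drift \<le> 0")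
    case True
    then have "drift / (1 + \<alpha>) \<le> 0" using one_plus_alpha by (simp add: divide_le_0_iff)
    then show ?thesis using \<theta> by simp
  next
    case False
    then have "drift / (1 + \<alpha>) \<le> 2 * drift / (1 + \<alpha>)" using one_plus_alpha by (intro divide_right_mono) auto
    then show ?thesis using \<theta> by simp
  qed
  have const: "(\<lambda>n. c / real n powr (\<theta> - 1)) \<longlonglongrightarrow> 0" for c :: real using \<theta> by real_asymp
  have shift: "(\<lambda>n. (c * x n / W n + d) / real n powr (\<theta> - 1)) \<longlonglongrightarrow> 0"
    if "(\<lambda>n. x n / real n powr \<theta>) \<longlonglongrightarrow> 0" for x and c d :: real
  proof -
    have "(\<lambda>n. c * (x n / real n powr \<theta>) * (real n / W n) + d / real n powr (\<theta> - 1)) \<longlonglongrightarrow> c * 0 * (1 / (1 + \<alpha>)) + 0"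
      by (intro tendsto_intros that weight_ratio alpha_ge const)
    moreover have "eventually (\<lambda>n. c * (x n / real n powr \<theta>) * (real n / W n) + d / real n powr (\<theta> - 1) =
        (c * x n / W n + d) / real n powr (\<theta> - 1)) sequentially"
      using eventually_gt_at_top[of 0] by eventually_elim (simp add: powr_diff field_simps)
    ultimately show ?thesis by (simp add: tendsto_cong)
  qed
  show u: "(\<lambda>n. EYY n / real n powr \<theta>) \<longlonglongrightarrow> 0"
    by (rule power_growth[OF alpha_ge EYY_Suc const \<theta>(2)])
  have w: "(\<lambda>n. EXY n / real n powr \<theta>) \<longlonglongrightarrow> 0"
    by (rule power_growth[OF alpha_ge EXY_Suc shift[OF u] drift\<theta>])
  show "(\<lambda>n. EXX n / real n powr \<theta>) \<longlonglongrightarrow> 0"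
    by (rule power_growth[OF alpha_ge _ shift[OF w], of EXX 0]) (use \<theta> EXX_Suc in auto)
qed

lemma EYY_powr_bound:
  assumes \<theta>: "\<theta> > 1" "2 * drift / (1 + \<alpha>) < \<theta>"
  obtains C where "C > 0" "\<And>n. n \<ge> 1 \<Longrightarrow> EYY n \<le> C * real n powr \<theta>"
proof -
  have "Bseq (\<lambda>n. EYY n / real n powr \<theta>)" by (rule convergent_imp_Bseq[OF convergentI[OF EYY_small[OF assms]]])
  then obtain C where C: "C > 0" "\<And>n. \<bar>EYY n / real n powr \<theta>\<bar> \<le> C" unfolding Bseq_def by auto
  have "EYY n \<le> C * real n powr \<theta>" if "n \<ge> 1" for n
    using C(2)[of n] that by (simp add: abs_le_iff divide_le_eq)
  with C(1) show thesis by (rule that)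
qed

text \<open>
  The limits of the three moments divided by \<open>n\<close> are computed in turn, each feeding the forcing of the next.
  For \<open>p = 1/2\<close> the colours are independent fair signs and the second moment of \<open>X\<close> is exactly \<open>n\<close>.
\<close>
lemma EXX_linear:
  assumes "p < (3 - \<alpha>) / 4 \<or> p = 1 / 2"
  shows "(\<lambda>n. EXX n / real n) \<longlonglongrightarrow> 4 * c_coeff \<alpha> p"
proof (cases "p = 1 / 2")
  case True
  have "EXX n = real n" if "n \<ge> 1" for n
    using that moments_1 by (induction n rule: dec_induct) (auto simp: EXX_Suc True)
  then have "eventually (\<lambda>n. 1 = EXX n / real n) sequentially"
    by (intro eventually_sequentiallyI[of 1]) auto
  then show ?thesis by (auto simp: c_coeff_def True intro: Lim_transform_eventually)
next
  case False
  then have p: "p < (3 - \<alpha>) / 4" using assms by simp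
  define k where "k = 3 - 4 * p - \<alpha>"
  define U where "U = step_var / (1 - 2 * drift / (1 + \<alpha>))"
  define V where "V = ((2 * p - 1) * U * (1 / (1 + \<alpha>)) + (1 + \<alpha> * (2 * p - 1))) / (1 - drift / (1 + \<alpha>))"
  have k: "k > 0" using p by (simp add: k_def)
  have p1: "p < 1" using p alpha_ge by simp
  have sc: "2 * drift < 1 + \<alpha>" "drift < 1 + \<alpha>" using p p1 by (auto simp: drift_def)
  have shift: "(\<lambda>n. c * x n / W n + d) \<longlonglongrightarrow> c * l * (1 / (1 + \<alpha>)) + d"
    if "(\<lambda>n. x n / real n) \<longlonglongrightarrow> l" for x l and c d :: real
  proof -
    have "(\<lambda>n. c * (x n / real n) * (real n / W n) + d) \<longlonglongrightarrow> c * l * (1 / (1 + \<alpha>)) + d"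
      by (intro tendsto_intros that weight_ratio alpha_ge)
    moreover have "eventually (\<lambda>n. c * (x n / real n) * (real n / W n) + d = c * x n / W n + d) sequentially"
      using eventually_gt_at_top[of 0] by eventually_elim simp
    ultimately show ?thesis by (rule Lim_transform_eventually)
  qed
  have u: "(\<lambda>n. EYY n / real n) \<longlonglongrightarrow> U"
    unfolding U_def by (rule linear_growth[OF alpha_ge EYY_Suc _ sc(1)]) auto
  have w: "(\<lambda>n. EXY n / real n) \<longlonglongrightarrow> V"
    unfolding V_def by (rule linear_growth[OF alpha_ge EXY_Suc shift[OF u] sc(2)])
  have "(\<lambda>n. EXX n / real n) \<longlonglongrightarrow> (2 * (2 * p - 1) * V * (1 / (1 + \<alpha>)) + 1) / (1 - 0 / (1 + \<alpha>))"
    by (rule linear_growth[OF alpha_ge _ shift[OF w]]) (use EXX_Suc one_plus_alpha in auto)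
  moreover have "2 * (2 * p - 1) * V * (1 / (1 + \<alpha>)) + 1 = 4 * c_coeff \<alpha> p"
  proof -
    have U: "U = step_var * (1 + \<alpha>) / k"
    proof -
      have "1 - 2 * drift / (1 + \<alpha>) = k / (1 + \<alpha>)"
        using one_plus_alpha by (simp add: k_def drift_def field_simps)
      then show ?thesis by (simp add: U_def)
    qed
    have "1 - drift / (1 + \<alpha>) = 2 * (1 - p) / (1 + \<alpha>)"
      using one_plus_alpha by (simp add: drift_def field_simps)
    then have "V = ((2 * p - 1) * step_var / k + (1 + \<alpha> * (2 * p - 1))) * (1 + \<alpha>) / (2 * (1 - p))"
      using one_plus_alpha by (simp add: V_def U)
    also have "(2 * p - 1) * step_var / k + (1 + \<alpha> * (2 * p - 1)) = 2 * (1 - p) * (1 - \<alpha>) / k"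
      using k by (simp add: field_simps step_var_def) (simp add: k_def algebra_simps power2_eq_square)
    finally have "V = (1 - \<alpha>) * (1 + \<alpha>) / k" using p1 by simp
    then have "2 * (2 * p - 1) * V * (1 / (1 + \<alpha>)) + 1 = 2 * (2 * p - 1) * (1 - \<alpha>) / k + 1"
      using one_plus_alpha by simp
    also have "\<dots> = (1 + \<alpha> - 4 * \<alpha> * p) / k"
      using k by (simp add: field_simps) (simp add: k_def algebra_simps)
    also have "\<dots> = (4 * \<alpha> * p - \<alpha> - 1) / (4 * p + \<alpha> - 3)"
      by (subst minus_divide_divide[symmetric]) (simp add: k_def algebra_simps)
    finally have *: "2 * (2 * p - 1) * V * (1 / (1 + \<alpha>)) + 1 = (4 * \<alpha> * p - \<alpha> - 1) / (4 * p + \<alpha> - 3)" .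
    have "4 * (a / (4 * b)) = a / b" for a b :: real by simp
    then show ?thesis by (simp only: * c_coeff_def False if_False)
  qed
  ultimately show ?thesis by simp
qed

text \<open>
  At criticality \<open>2 drift = 1 + \<alpha>\<close>, so the factor \<open>1 + 2 drift / W n\<close> is \<open>W (Suc n) / W n\<close> and the second moment of \<open>Y\<close>
  divided by \<open>W\<close> becomes a sum of reciprocals of the weights.  The logarithm then passes on to the
  other two moments, whose homogeneous solutions grow more slowly.
\<close>
lemma EXX_linear_log:
  assumes p: "p = (3 - \<alpha>) / 4"
  shows "(\<lambda>n. EXX n / (real n * ln (real n))) \<longlonglongrightarrow> (\<alpha> - 1)\<^sup>2 / (1 + \<alpha>)"
proof -
  have drift: "drift = (1 + \<alpha>) / 2" and q: "2 * p - 1 = (1 - \<alpha>) / 2"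
    using p by (auto simp: drift_def field_simps)
  have v: "step_var = 1 + \<alpha>" unfolding step_var_def q by (simp add: power2_eq_square field_simps)
  have "EYY (Suc n) / W (Suc n) = EYY n / W n + step_var / W (Suc n)" if "n \<ge> 1" for n
  proof -
    have "1 + 2 * drift / W n = W (Suc n) / W n"
      using W_pos[OF that] by (simp add: drift total_weight_Suc field_simps)
    then show ?thesis using W_pos[OF that] W_pos[of "Suc n"] EYY_Suc[OF that] by (simp add: add_divide_distrib)
  qed
  moreover have "(\<lambda>n. real n * (step_var / W (Suc n))) \<longlonglongrightarrow> 1"
    unfolding v total_weight_def using one_plus_alpha by real_asymp
  ultimately have u: "(\<lambda>n. EYY n / W n / ln (real n)) \<longlonglongrightarrow> 1"
    by (rule log_growth_tendsto)
  have const: "(\<lambda>n. c / ln (real n)) \<longlonglongrightarrow> 0" for c :: real by real_asymp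
  have "(\<lambda>n. (2 * p - 1) * (EYY n / W n / ln (real n)) + (1 + \<alpha> * (2 * p - 1)) / ln (real n)) \<longlonglongrightarrow> (2 * p - 1) * 1 + 0"
    by (intro tendsto_intros u const)
  then have f: "(\<lambda>n. ((2 * p - 1) * EYY n / W n + (1 + \<alpha> * (2 * p - 1))) / ln (real n)) \<longlonglongrightarrow> (2 * p - 1)"
    by (simp add: add_divide_distrib)
  have w: "(\<lambda>n. EXY n / (real n * ln (real n))) \<longlonglongrightarrow> (2 * p - 1) / (1 - drift / (1 + \<alpha>))"
    by (rule linear_log_growth[OF alpha_ge EXY_Suc f]) (use drift one_plus_alpha in auto)
  have "(\<lambda>n. 2 * (2 * p - 1) * (EXY n / (real n * ln (real n))) * (real n / W n) + 1 / ln (real n))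
     \<longlonglongrightarrow> 2 * (2 * p - 1) * ((2 * p - 1) / (1 - drift / (1 + \<alpha>))) * (1 / (1 + \<alpha>)) + 0"
    by (intro tendsto_intros w const weight_ratio alpha_ge)
  moreover have "eventually (\<lambda>n. 2 * (2 * p - 1) * (EXY n / (real n * ln (real n))) * (real n / W n) + 1 / ln (real n) =
      (2 * (2 * p - 1) * EXY n / W n + 1) / ln (real n)) sequentially"
    using eventually_gt_at_top[of 1] by eventually_elim (simp add: add_divide_distrib)
  ultimately have "(\<lambda>n. (2 * (2 * p - 1) * EXY n / W n + 1) / ln (real n)) \<longlonglongrightarrow>
      2 * (2 * p - 1) * ((2 * p - 1) / (1 - drift / (1 + \<alpha>))) * (1 / (1 + \<alpha>)) + 0"
    by (rule Lim_transform_eventually)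
  also have "2 * (2 * p - 1) * ((2 * p - 1) / (1 - drift / (1 + \<alpha>))) * (1 / (1 + \<alpha>)) + 0 = (\<alpha> - 1)\<^sup>2 / (1 + \<alpha>)"
  proof -
    have *: "1 - (1 + \<alpha>) / 2 / (1 + \<alpha>) = 1 / 2" using one_plus_alpha by simp
    have "2 * (a / 2) * (a / 2 / (1 / 2)) * (1 / d) + 0 = a\<^sup>2 / d" for a d :: real
      by (simp add: power2_eq_square)
    then show ?thesis unfolding q drift * by (simp only: power2_commute)
  qed
  finally have "(\<lambda>n. (2 * (2 * p - 1) * EXY n / W n + 1) / ln (real n)) \<longlonglongrightarrow> (\<alpha> - 1)\<^sup>2 / (1 + \<alpha>)" .
  from linear_log_growth[OF alpha_ge _ this, of EXX 0] EXX_Suc one_plus_alpha show ?thesis by simp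
qed

end

section \<open>Strong law of large numbers\<close>

text \<open>
  If \<open>\<bar>a n\<bar> \<ge> \<epsilon> n\<close>, then \<open>\<bar>a k\<bar> \<ge> \<epsilon> n / 2\<close> for about \<open>\<epsilon> n / 2\<close> indices \<open>k\<close> after \<open>n\<close>, since \<open>a\<close> moves by at most
  one per step.  Each contributes at least \<open>\<epsilon>\<^sup>2 / (32 n)\<close>, together at least \<open>\<epsilon>\<^sup>3 / 64\<close>, which the Cauchy
  criterion forbids for large \<open>n\<close>.
\<close>
lemma square_summable_imp_sublinear:
  fixes a :: "nat \<Rightarrow> real"
  assumes lip: "\<And>n. \<bar>a (Suc n) - a n\<bar> \<le> 1"
    and sum: "summable (\<lambda>n. (a n)\<^sup>2 / real n ^ 3)"
  shows "(\<lambda>n. a n / real n) \<longlonglongrightarrow> 0"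
proof (rule LIMSEQ_I)
  fix r :: real assume "r > 0"
  define \<epsilon> where "\<epsilon> = min r 1"
  have \<epsilon>: "\<epsilon> > 0" "\<epsilon> \<le> 1" "\<epsilon> \<le> r" using \<open>r > 0\<close> by (auto simp: \<epsilon>_def)
  have lip': "\<bar>a (n + i) - a n\<bar> \<le> real i" for n i
  proof (induction i)
    case (Suc i)
    then show ?case using lip[of "n + i"] by simp
  qed simp
  obtain N where N: "\<And>m n. m \<ge> N \<Longrightarrow> \<bar>\<Sum>k\<in>{m..<n}. (a k)\<^sup>2 / real k ^ 3\<bar> < \<epsilon> ^ 3 / 64"
    using sum \<epsilon> unfolding summable_Cauchy by (force dest!: spec[of _ "\<epsilon> ^ 3 / 64"])
  have "\<bar>a n\<bar> < \<epsilon> * real n" if n: "n \<ge> max N 1" for n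
  proof (rule ccontr)
    assume "\<not> \<bar>a n\<bar> < \<epsilon> * real n"
    then have an: "\<bar>a n\<bar> \<ge> \<epsilon> * real n" by simp
    define m where "m = nat \<lfloor>\<epsilon> * real n / 2\<rfloor>"
    have m: "real m \<le> \<epsilon> * real n / 2" "\<epsilon> * real n / 2 \<le> real m + 1"
    proof -
      have "real m = of_int \<lfloor>\<epsilon> * real n / 2\<rfloor>" using \<epsilon> by (simp add: m_def)
      then show "real m \<le> \<epsilon> * real n / 2" "\<epsilon> * real n / 2 \<le> real m + 1"
        using of_int_floor_le real_of_int_floor_add_one_ge by metis+
    qed
    have "\<epsilon> * real n / 2 \<le> real n" using \<epsilon> n by simp
    have lower: "\<epsilon>\<^sup>2 / (32 * real n) \<le> (a k)\<^sup>2 / real k ^ 3" if k: "k \<in> {n..<n + (m + 1)}" for k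
    proof -
      define i where "i = k - n"
      have i: "k = n + i" "i \<le> m" using k by (auto simp: i_def)
      have "\<epsilon> * real n / 2 \<le> \<bar>a k\<bar>" using lip'[of n i] an m i by simp
      then have "(\<epsilon> * real n / 2)\<^sup>2 \<le> \<bar>a k\<bar>\<^sup>2" using \<epsilon> by (intro power_mono) auto
      moreover have "real k \<le> 2 * real n" using i m \<open>\<epsilon> * real n / 2 \<le> real n\<close> by simp
      then have "real k ^ 3 \<le> (2 * real n) ^ 3" by (intro power_mono) auto
      ultimately have "(\<epsilon> * real n / 2)\<^sup>2 / (2 * real n) ^ 3 \<le> (a k)\<^sup>2 / real k ^ 3"
        using n k by (intro frac_le) auto
      also have "(\<epsilon> * real n / 2)\<^sup>2 / (2 * real n) ^ 3 = \<epsilon>\<^sup>2 / (32 * real n)"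
        using n by (simp add: power2_eq_square power3_eq_cube field_simps)
      finally show ?thesis .
    qed
    have "\<epsilon> ^ 3 / 64 = (\<epsilon> * real n / 2) * (\<epsilon>\<^sup>2 / (32 * real n))"
      using n by (simp add: power2_eq_square power3_eq_cube field_simps)
    also have "\<dots> \<le> (real m + 1) * (\<epsilon>\<^sup>2 / (32 * real n))"
      using m by (intro mult_right_mono) auto
    also have "\<dots> = (\<Sum>k\<in>{n..<n + (m + 1)}. \<epsilon>\<^sup>2 / (32 * real n))" by simp
    also have "\<dots> \<le> (\<Sum>k\<in>{n..<n + (m + 1)}. (a k)\<^sup>2 / real k ^ 3)" by (intro sum_mono lower)
    also have "\<dots> < \<epsilon> ^ 3 / 64" using n by (intro le_less_trans[OF abs_ge_self N]) simp
    finally show False by simp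
  qed
  moreover have "\<epsilon> * real n \<le> r * real n" for n using \<epsilon>(3) by (intro mult_right_mono) auto
  ultimately have "\<bar>a n\<bar> < r * real n" if "n \<ge> max N 1" for n
    using that less_le_trans by blast
  then have "norm (a n / real n - 0) < r" if "n \<ge> max N 1" for n
    using that by (simp add: divide_less_eq)
  then show "\<exists>no. \<forall>n\<ge>no. norm (a n / real n - 0) < r" by blast
qed

context weighted_broadcast
begin

lemma X_measurable [measurable]: "X n \<in> borel_measurable M"
  using integrable_XY[of "\<lambda>x y. x" n] by auto

lemma Y_measurable [measurable]: "Y n \<in> borel_measurable M"
  using integrable_XY[of "\<lambda>x y. y" n] by auto

lemma RB_eq:
  "RB \<sigma> n \<omega> = real n *\<^sub>R vector [1 / 2, 1 / 2] + (X n \<omega> / 2) *\<^sub>R vector [1, - 1]"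
proof -
  have "real (colour_count \<sigma> c n \<omega>) = (\<Sum>k\<in>{1..n}. if \<sigma> k \<omega> = c then 1 else 0)" for c
    by (simp add: colour_count_def sum.If_cases Int_def)
  moreover have "(\<Sum>k\<in>{1..n}. if \<sigma> k \<omega> = Red then 1 else 0) = (\<Sum>k\<in>{1..n}. (1 + spin (\<sigma> k \<omega>)) / 2)"
    by (intro sum.cong refl) (simp add: spin_def)
  moreover have "(\<Sum>k\<in>{1..n}. if \<sigma> k \<omega> = Blue then 1 else 0) = (\<Sum>k\<in>{1..n}. (1 - spin (\<sigma> k \<omega>)) / 2)"
    by (intro sum.cong refl) (auto simp: spin_def intro: colour.exhaust)
  ultimately show ?thesis
    by (simp add: RB_def vec_eq_iff forall_2 X_eq sum_divide_distrib[symmetric] sum.distrib sum_subtractf field_simps)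
qed

lemma X_sublinear:
  assumes "p < 1"
  shows "AE \<omega> in M. (\<lambda>n. X n \<omega> / real n) \<longlonglongrightarrow> 0"
proof -
  define \<theta> where "\<theta> = (max 1 (2 * drift / (1 + \<alpha>)) + 2) / 2"
  have "2 * drift / (1 + \<alpha>) < 2" using one_plus_alpha assms by (simp add: drift_def field_simps)
  then have \<theta>: "\<theta> > 1" "2 * drift / (1 + \<alpha>) < \<theta>" "\<theta> < 2"
    by (cases "2 * drift / (1 + \<alpha>) \<le> 1"; simp add: \<theta>_def max_def)+
  have "Bseq (\<lambda>n. EXX n / real n powr \<theta>)"
    by (rule convergent_imp_Bseq[OF convergentI[OF EXX_small[OF \<theta>(1,2)]]])
  then obtain C where C: "C > 0" "\<And>n. \<bar>EXX n / real n powr \<theta>\<bar> \<le> C" unfolding Bseq_def by auto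
  have z0: "EXX n \<ge> 0" for n unfolding EXX_def by simp
  have le: "EXX n / real n ^ 3 \<le> C * real n powr (\<theta> - 3)" for n
  proof (cases "n = 0")
    case False
    then have "EXX n \<le> C * real n powr \<theta>" using C(2)[of n] by (simp add: abs_le_iff divide_le_eq)
    then have "EXX n / real n ^ 3 \<le> C * real n powr \<theta> / real n ^ 3" by (intro divide_right_mono) auto
    also have "\<dots> = C * real n powr (\<theta> - 3)" using False by (simp add: powr_diff powr_numeral)
    finally show ?thesis .
  qed simp
  have "summable (\<lambda>n. C * real n powr (\<theta> - 3))"
    using \<theta> by (intro summable_mult) (simp add: summable_real_powr_iff)
  moreover have "norm (EXX n / real n ^ 3) \<le> C * real n powr (\<theta> - 3)" for n
    using le[of n] z0[of n] by simp
  ultimately have summ: "summable (\<lambda>n. EXX n / real n ^ 3)"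
    by (rule summable_comparison_test')
  have "(\<integral>\<^sup>+\<omega>. (\<Sum>n. ennreal ((X n \<omega>)\<^sup>2 / real n ^ 3)) \<partial>M) = (\<Sum>n. \<integral>\<^sup>+\<omega>. ennreal ((X n \<omega>)\<^sup>2 / real n ^ 3) \<partial>M)"
    by (intro nn_integral_suminf) measurable
  also have "\<dots> = (\<Sum>n. ennreal (EXX n / real n ^ 3))"
  proof (intro suminf_cong)
    fix n
    have "integrable M (\<lambda>\<omega>. (X n \<omega>)\<^sup>2 / real n ^ 3)" by (rule integrable_XY)
    then have "(\<integral>\<^sup>+\<omega>. ennreal ((X n \<omega>)\<^sup>2 / real n ^ 3) \<partial>M) = ennreal (expectation (\<lambda>\<omega>. (X n \<omega>)\<^sup>2 / real n ^ 3))"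
      by (rule nn_integral_eq_integral) simp
    then show "(\<integral>\<^sup>+\<omega>. ennreal ((X n \<omega>)\<^sup>2 / real n ^ 3) \<partial>M) = ennreal (EXX n / real n ^ 3)"
      by (simp add: EXX_def)
  qed
  also have "\<dots> = ennreal (\<Sum>n. EXX n / real n ^ 3)"
    using summ z0 by (intro suminf_ennreal2) auto
  finally have "(\<integral>\<^sup>+\<omega>. (\<Sum>n. ennreal ((X n \<omega>)\<^sup>2 / real n ^ 3)) \<partial>M) \<noteq> \<infinity>" by simp
  then have "AE \<omega> in M. (\<Sum>n. ennreal ((X n \<omega>)\<^sup>2 / real n ^ 3)) \<noteq> \<infinity>"
    by (intro nn_integral_PInf_AE) measurable
  then show ?thesis
  proof eventually_elim
    case (elim \<omega>)
    then have "summable (\<lambda>n. (X n \<omega>)\<^sup>2 / real n ^ 3)"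
      by (intro summable_suminf_not_top) auto
    then show ?case by (rule square_summable_imp_sublinear[rotated]) (simp add: X_Suc)
  qed
qed

lemma strong_law:
  assumes "p < 1"
  shows "AE \<omega> in M. (\<lambda>n. (1 / real n) *\<^sub>R RB \<sigma> n \<omega>) \<longlonglongrightarrow> vector [1 / 2, 1 / 2]"
  using X_sublinear[OF assms]
proof eventually_elim
  case (elim \<omega>)
  have "(\<lambda>n. vector [1 / 2, 1 / 2] + (X n \<omega> / real n / 2) *\<^sub>R vector [1, - 1] :: real^2) \<longlonglongrightarrow>
      vector [1 / 2, 1 / 2] + (0 / 2) *\<^sub>R vector [1, - 1]"
    by (intro tendsto_intros elim) auto
  moreover have "eventually (\<lambda>n. vector [1 / 2, 1 / 2] + (X n \<omega> / real n / 2) *\<^sub>R vector [1, - 1] =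
     (1 / real n) *\<^sub>R RB \<sigma> n \<omega>) sequentially"
    using eventually_gt_at_top[of 0] by eventually_elim (simp add: RB_eq scaleR_add_right field_simps)
  ultimately show ?case
    unfolding div_0 scaleR_zero_left add_0_right by (rule Lim_transform_eventually)
qed

end

section \<open>One step of the characteristic function\<close>

text \<open>
  The cubic bound holds for every \<open>h\<close>, so that frequencies need not be small: for \<open>h \<le> 1\<close> the quadratic Taylor remainder
  is of order \<open>h ^ 4\<close>, and for larger \<open>h\<close> the difference is at most \<open>r\<close>.
\<close>
lemma exp_minus_linear_approx:
  fixes h r :: real
  assumes "0 \<le> r" "r \<le> h\<^sup>2 / 2" "h \<ge> 0"
  shows "\<bar>1 - r - exp (- r)\<bar> \<le> h ^ 3"
proof -
  have "exp (- r) \<le> 1 / (1 + r)"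
    using exp_ge_add_one_self[of r] assms by (simp add: exp_minus inverse_eq_divide frac_le)
  also have "1 / (1 + r) = 1 - r + r\<^sup>2 / (1 + r)" using assms by (simp add: field_simps power2_eq_square)
  finally have upper: "exp (- r) - (1 - r) \<le> r\<^sup>2 / (1 + r)" by simp
  have "r\<^sup>2 / (1 + r) \<le> h ^ 3"
  proof (cases "h \<le> 1")
    case True
    have "r\<^sup>2 / (1 + r) \<le> r\<^sup>2" using assms by (simp add: divide_le_eq algebra_simps)
    also have "\<dots> \<le> (h\<^sup>2 / 2)\<^sup>2" using assms by (intro power_mono) auto
    also have "\<dots> = h ^ 3 * (h / 4)" by (simp add: power2_eq_square power3_eq_cube)
    also have "\<dots> \<le> h ^ 3 * 1" using True assms by (intro mult_left_mono) auto
    finally show ?thesis by simp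
  next
    case False
    have "r\<^sup>2 / (1 + r) \<le> r" using assms by (simp add: divide_le_eq algebra_simps power2_eq_square)
    also have "\<dots> \<le> h\<^sup>2 * 1" using assms by simp
    also have "\<dots> \<le> h\<^sup>2 * h" using False by (intro mult_left_mono) auto
    finally show ?thesis by (simp add: power2_eq_square power3_eq_cube)
  qed
  with upper exp_ge_add_one_self[of "- r"] show ?thesis by linarith
qed

lemma
  fixes x :: real
  shows cos_quadratic_approx: "\<bar>cos x - (1 - x\<^sup>2 / 2)\<bar> \<le> \<bar>x\<bar> ^ 3"
  and sin_linear_approx: "\<bar>sin x - x\<bar> \<le> \<bar>x\<bar> ^ 3"
proof -
  have "cmod (cis x - (1 + \<i> * x - of_real (x\<^sup>2 / 2))) \<le> \<bar>x\<bar> ^ 3 / 6"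
    using iexp_approx1[of x 2]
    by (simp add: cis_conv_exp numeral_2_eq_2 power2_eq_square fact_numeral eval_nat_numeral algebra_simps)
  moreover have "0 \<le> \<bar>x\<bar> ^ 3" by simp
  ultimately have *: "cmod (cis x - (1 + \<i> * x - of_real (x\<^sup>2 / 2))) \<le> \<bar>x\<bar> ^ 3" by linarith
  show "\<bar>cos x - (1 - x\<^sup>2 / 2)\<bar> \<le> \<bar>x\<bar> ^ 3"
    using order_trans[OF abs_Re_le_cmod *] by simp
  show "\<bar>sin x - x\<bar> \<le> \<bar>x\<bar> ^ 3"
    using order_trans[OF abs_Im_le_cmod *] by simp
qed

lemma cos_sin_square_approx:
  fixes x :: real
  shows "\<bar>cos x - 1\<bar> \<le> x\<^sup>2" "\<bar>sin x - x\<bar> \<le> x\<^sup>2"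
proof -
  have "cmod (cis x - (1 + \<i> * x)) \<le> x\<^sup>2 / 2"
    using iexp_approx1[of x 1]
    by (simp add: cis_conv_exp power2_eq_square)
  moreover have "0 \<le> x\<^sup>2" by simp
  ultimately have *: "cmod (cis x - (1 + \<i> * x)) \<le> x\<^sup>2" by linarith
  show "\<bar>cos x - 1\<bar> \<le> x\<^sup>2" using order_trans[OF abs_Re_le_cmod *] by simp
  show "\<bar>sin x - x\<bar> \<le> x\<^sup>2" using order_trans[OF abs_Im_le_cmod *] by simp
qed

lemma cis_minus_one: "cmod (cis x - 1) \<le> \<bar>x\<bar>"
  using iexp_approx1[of x 0] by (simp add: cis_conv_exp)

text \<open>
  The two parent signs give conjugate contributions, so the real part is the mean of the cosines, \<open>1 - q / 2\<close> to
  second order, and the imaginary part is \<open>\<eta>\<close> times the mean of the sines, \<open>\<eta> * \<beta>\<close> to second order.  The term with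
  \<open>\<eta>\<^sup>2\<close> is the price for writing \<open>1 + \<i> \<eta> \<beta>\<close> as \<open>cis (\<eta> * \<beta>)\<close>.
\<close>
lemma step_char_approx:
  fixes p \<eta> a a' h L :: real
  defines "\<beta> \<equiv> p * a + (1 - p) * a'" and "q \<equiv> p * a\<^sup>2 + (1 - p) * a'\<^sup>2"
  assumes p: "0 \<le> p" "p \<le> 1" and a: "\<bar>a\<bar> \<le> h" "\<bar>a'\<bar> \<le> h" and \<eta>: "\<bar>\<eta>\<bar> \<le> L" and L: "1 \<le> L"
  shows "cmod (((1 + \<eta>) / 2) *\<^sub>R (p *\<^sub>R cis a + (1 - p) *\<^sub>R cis a') +
      ((1 - \<eta>) / 2) *\<^sub>R (p *\<^sub>R cis (- a) + (1 - p) *\<^sub>R cis (- a')) - exp (- q / 2) *\<^sub>R cis (\<eta> * \<beta>))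
    \<le> 4 * L * (h ^ 3 + h\<^sup>2 * \<eta>\<^sup>2)" (is "cmod ?d \<le> _")
proof -
  have convex: "\<bar>p * r + (1 - p) * s\<bar> \<le> c" if "\<bar>r\<bar> \<le> c" "\<bar>s\<bar> \<le> c" for r s c :: real
  proof -
    have "\<bar>p * r + (1 - p) * s\<bar> \<le> p * \<bar>r\<bar> + (1 - p) * \<bar>s\<bar>"
      using p by (intro order_trans[OF abs_triangle_ineq]) (simp add: abs_mult)
    also have "\<dots> \<le> p * c + (1 - p) * c" using p that by (intro add_mono mult_left_mono) auto
    finally show ?thesis by (simp add: algebra_simps)
  qed
  have h: "h \<ge> 0" using a by simp
  have cube: "\<bar>r\<bar> ^ 3 \<le> h ^ 3" "r\<^sup>2 \<le> h\<^sup>2" if "\<bar>r\<bar> \<le> h" for r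
    using that power_mono[of "\<bar>r\<bar>" h 3] power_mono[of "\<bar>r\<bar>" h 2] by auto
  have \<beta>: "\<bar>\<beta>\<bar> \<le> h" unfolding \<beta>_def by (rule convex[OF a])
  have "\<bar>q\<bar> \<le> h\<^sup>2" unfolding q_def by (rule convex) (use cube a in auto)
  moreover have q0: "q \<ge> 0" unfolding q_def using p by simp
  ultimately have q: "q \<le> h\<^sup>2" by simp
  define A where "A = p * cos a + (1 - p) * cos a'"
  define B where "B = p * sin a + (1 - p) * sin a'"
  define e where "e = exp (- q / 2)"
  define \<tau> where "\<tau> = \<eta> * \<beta>"
  have e: "0 < e" "e \<le> 1" using q0 by (auto simp: e_def)
  have Re: "Re ?d = A - e * cos \<tau>" by (simp add: A_def e_def \<tau>_def algebra_simps add_divide_distrib diff_divide_distrib)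
  have Im: "Im ?d = \<eta> * B - e * sin \<tau>" by (simp add: B_def e_def \<tau>_def algebra_simps add_divide_distrib diff_divide_distrib)
  have A: "\<bar>A - (1 - q / 2)\<bar> \<le> h ^ 3"
  proof -
    have "A - (1 - q / 2) = p * (cos a - (1 - a\<^sup>2 / 2)) + (1 - p) * (cos a' - (1 - a'\<^sup>2 / 2))"
      by (simp add: A_def q_def field_simps)
    also have "\<bar>\<dots>\<bar> \<le> h ^ 3"
      by (rule convex) (use order_trans[OF cos_quadratic_approx] cube a in auto)
    finally show ?thesis .
  qed
  have Ae: "\<bar>A - e\<bar> \<le> 2 * h ^ 3"
    using A exp_minus_linear_approx[of "q / 2" h] q q0 h unfolding e_def by simp
  have B: "\<bar>B - \<beta>\<bar> \<le> h ^ 3"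
  proof -
    have "B - \<beta> = p * (sin a - a) + (1 - p) * (sin a' - a')" by (simp add: B_def \<beta>_def algebra_simps)
    also have "\<bar>\<dots>\<bar> \<le> h ^ 3" by (rule convex) (use order_trans[OF sin_linear_approx] cube a in auto)
    finally show ?thesis .
  qed
  have \<tau>: "\<tau>\<^sup>2 \<le> h\<^sup>2 * \<eta>\<^sup>2"
    unfolding \<tau>_def power_mult_distrib mult.commute[of "\<eta>\<^sup>2"] by (intro mult_right_mono cube(2)[OF \<beta>]) simp
  have "\<bar>e * (cos \<tau> - 1)\<bar> \<le> 1 * \<tau>\<^sup>2" unfolding abs_mult using e cos_sin_square_approx by (intro mult_mono) auto
  then have "\<bar>Re ?d\<bar> \<le> 2 * h ^ 3 + h\<^sup>2 * \<eta>\<^sup>2"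
    unfolding Re using Ae \<tau> by (simp add: algebra_simps)
  moreover have "\<bar>Im ?d\<bar> \<le> 2 * L * h ^ 3 + h\<^sup>2 * \<eta>\<^sup>2"
  proof -
    have 1: "\<bar>\<eta> * (B - \<beta>)\<bar> \<le> L * h ^ 3" unfolding abs_mult using \<eta> B L by (intro mult_mono) auto
    have "1 - e \<le> q / 2" using exp_ge_add_one_self[of "- q / 2"] by (simp add: e_def)
    then have "\<bar>1 - e\<bar> \<le> h\<^sup>2" using e q q0 by simp
    then have "\<bar>\<eta> * (\<beta> * (1 - e))\<bar> \<le> L * (h * h\<^sup>2)"
      unfolding abs_mult using \<eta> L \<beta> h by (intro mult_mono) auto
    then have 2: "\<bar>\<tau> * (1 - e)\<bar> \<le> L * h ^ 3" by (simp add: \<tau>_def power2_eq_square power3_eq_cube mult.assoc)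
    have 3: "\<bar>e * (sin \<tau> - \<tau>)\<bar> \<le> 1 * \<tau>\<^sup>2" unfolding abs_mult using e cos_sin_square_approx by (intro mult_mono) auto
    have "Im ?d = \<eta> * (B - \<beta>) + \<tau> * (1 - e) - e * (sin \<tau> - \<tau>)" unfolding Im by (simp add: \<tau>_def algebra_simps)
    then show ?thesis using 1 2 3 \<tau> by linarith
  qed
  ultimately have "cmod ?d \<le> (2 + 2 * L) * h ^ 3 + 2 * (h\<^sup>2 * \<eta>\<^sup>2)"
    using cmod_le[of ?d] by (simp add: algebra_simps)
  also have "\<dots> \<le> 4 * L * h ^ 3 + 4 * L * (h\<^sup>2 * \<eta>\<^sup>2)"
    using L h by (intro add_mono mult_right_mono) auto
  finally show ?thesis by (simp add: algebra_simps)
qed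

context weighted_broadcast
begin

definition char_XY :: "nat \<Rightarrow> real \<Rightarrow> real \<Rightarrow> complex" where
  "char_XY n x y = expectation (\<lambda>\<omega>. cis (x * X n \<omega> + y * Y n \<omega>))"

text \<open>
  The mean square of the increment of \<open>x X + y Y\<close>; it is the same for both signs of the parent, hence deterministic.
\<close>
definition step_form :: "real \<Rightarrow> real \<Rightarrow> real" where
  "step_form x y = (x + y)\<^sup>2 + \<alpha>\<^sup>2 * y\<^sup>2 + 2 * \<alpha> * (2 * p - 1) * y * (x + y)"

definition freq_bound :: "real \<Rightarrow> real \<Rightarrow> real" where
  "freq_bound x y = (1 + \<bar>\<alpha>\<bar>) * (\<bar>x\<bar> + \<bar>y\<bar>)"

text \<open>The conditional mean of the increment of \<open>x X + y Y\<close> is \<open>freq_drift x y * Y / W\<close>.\<close>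
definition freq_drift :: "real \<Rightarrow> real \<Rightarrow> real" where
  "freq_drift x y = (2 * p - 1) * x + drift * y"

lemma step_mean_mult:
  fixes c :: "'b::real_algebra"
  shows "step_mean (\<lambda>a b. c * f a b) \<eta> = c * step_mean f \<eta>"
  by (simp add: step_mean_def distrib_left)

lemma Y_ratio_bound:
  assumes "\<omega> \<in> space M" "n \<ge> 1"
  shows "\<bar>Y n \<omega> / W n\<bar> \<le> 2 * (1 + \<bar>\<alpha>\<bar>)"
proof -
  have "\<bar>Y n \<omega>\<bar> \<le> 2 * (1 + \<bar>\<alpha>\<bar>) * (real n / 2)" using Y_bound[OF assms(1), of n] by (simp add: algebra_simps)
  also have "\<dots> \<le> 2 * (1 + \<bar>\<alpha>\<bar>) * W n"
    using total_weight_ge[OF alpha_ge assms(2)] by (intro mult_left_mono) auto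
  finally show ?thesis using W_pos[OF assms(2)] by (simp add: divide_le_eq)
qed

text \<open>
  The conditional mean of the step is linear in \<open>Y\<close>, so it only changes the frequency at which \<open>Y\<close> is tested.  The
  remaining factor is deterministic.
\<close>
lemma char_XY_step:
  assumes n: "n \<ge> 1"
  shows "cmod (char_XY (Suc n) x y - exp (- step_form x y / 2) *\<^sub>R char_XY n x (y + freq_drift x y / W n))
    \<le> 8 * (1 + \<bar>\<alpha>\<bar>) * (freq_bound x y ^ 3 + (freq_bound x y)\<^sup>2 * EYY n / (W n)\<^sup>2)"
proof -
  let ?a = "x + y * (\<alpha> + 1)" and ?a' = "y * (\<alpha> - 1) - x" and ?h = "freq_bound x y"
  let ?L = "2 * (1 + \<bar>\<alpha>\<bar>)"
  define S where "S \<eta> = step_mean (\<lambda>a b. cis (x * a + y * b)) \<eta>" for \<eta>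
  have \<beta>: "p * ?a + (1 - p) * ?a' = freq_drift x y" by (simp add: freq_drift_def drift_def algebra_simps)
  have q: "p * ?a\<^sup>2 + (1 - p) * ?a'\<^sup>2 = step_form x y" by (simp add: step_form_def power2_eq_square algebra_simps)
  have ya: "\<bar>y * c\<bar> \<le> \<bar>y\<bar> * (1 + \<bar>\<alpha>\<bar>)" if "\<bar>c\<bar> \<le> 1 + \<bar>\<alpha>\<bar>" for c
    unfolding abs_mult using that by (intro mult_left_mono) auto
  have a: "\<bar>?a\<bar> \<le> ?h" "\<bar>?a'\<bar> \<le> ?h"
  proof -
    have base: "\<bar>x\<bar> + \<bar>y\<bar> * (1 + \<bar>\<alpha>\<bar>) \<le> ?h" "\<bar>y\<bar> * (1 + \<bar>\<alpha>\<bar>) + \<bar>x\<bar> \<le> ?h"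
      by (simp_all add: freq_bound_def algebra_simps)
    show "\<bar>?a\<bar> \<le> ?h"
      by (rule order_trans[OF abs_triangle_ineq order_trans[OF add_left_mono[OF ya] base(1)]]) simp
    show "\<bar>?a'\<bar> \<le> ?h"
      by (rule order_trans[OF abs_triangle_ineq4 order_trans[OF add_right_mono[OF ya] base(2)]]) simp
  qed
  have args: "x * 1 + y * (\<alpha> + 1) = ?a" "x * (- 1) + y * (\<alpha> - 1) = ?a'"
      "x * (- 1) + y * (- \<alpha> - 1) = - ?a" "x * 1 + y * (1 - \<alpha>) = - ?a'"
    by (simp_all add: algebra_simps)
  have S: "cmod (S \<eta> - exp (- step_form x y / 2) *\<^sub>R cis (\<eta> * freq_drift x y)) \<le> 4 * ?L * (?h ^ 3 + ?h\<^sup>2 * \<eta>\<^sup>2)"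
    if "\<bar>\<eta>\<bar> \<le> ?L" for \<eta>
  proof -
    have "S \<eta> = ((1 + \<eta>) / 2) *\<^sub>R (p *\<^sub>R cis ?a + (1 - p) *\<^sub>R cis ?a') +
      ((1 - \<eta>) / 2) *\<^sub>R (p *\<^sub>R cis (- ?a) + (1 - p) *\<^sub>R cis (- ?a'))"
      unfolding S_def step_mean_def args ..
    then show ?thesis using step_char_approx[OF p_range a that] unfolding \<beta> q by simp
  qed
  have "step_mean (\<lambda>a b. cis (x * (X n \<omega> + a) + y * (Y n \<omega> + b))) \<eta> = cis (x * X n \<omega> + y * Y n \<omega>) * S \<eta>" for \<omega> \<eta>
  proof -
    have "cis (x * (X n \<omega> + a) + y * (Y n \<omega> + b)) = cis (x * X n \<omega> + y * Y n \<omega>) * cis (x * a + y * b)" for a b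
      unfolding cis_mult by (rule arg_cong[of _ _ cis]) (simp add: algebra_simps)
    then show ?thesis unfolding S_def by (simp only: step_mean_mult)
  qed
  then have 1: "char_XY (Suc n) x y = expectation (\<lambda>\<omega>. cis (x * X n \<omega> + y * Y n \<omega>) * S (Y n \<omega> / W n))"
    unfolding char_XY_def by (subst one_step_expectation[OF n, of "\<lambda>h a b. cis (x * a + y * b)"]) simp
  have 2: "exp (- step_form x y / 2) *\<^sub>R char_XY n x (y + freq_drift x y / W n) =
      expectation (\<lambda>\<omega>. cis (x * X n \<omega> + y * Y n \<omega>) * (exp (- step_form x y / 2) *\<^sub>R cis (Y n \<omega> / W n * freq_drift x y)))"
  proof -
    have "cis (x * X n \<omega> + (y + freq_drift x y / W n) * Y n \<omega>) =
        cis (x * X n \<omega> + y * Y n \<omega>) * cis (Y n \<omega> / W n * freq_drift x y)" for \<omega>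
      unfolding cis_mult by (rule arg_cong[of _ _ cis]) (simp add: distrib_right)
    then show ?thesis
      unfolding char_XY_def by (subst integral_scaleR_right[symmetric]) (simp only: mult_scaleR_right)
  qed
  let ?D = "\<lambda>\<omega>. S (Y n \<omega> / W n) - exp (- step_form x y / 2) *\<^sub>R cis (Y n \<omega> / W n * freq_drift x y)"
  have diff: "char_XY (Suc n) x y - exp (- step_form x y / 2) *\<^sub>R char_XY n x (y + freq_drift x y / W n) =
     expectation (\<lambda>\<omega>. cis (x * X n \<omega> + y * Y n \<omega>) * ?D \<omega>)"
    unfolding 1 2 right_diff_distrib[where a = "cis _"]
    by (subst Bochner_Integration.integral_diff)
      (rule refl integrable_XY[of "\<lambda>a b. cis (x * a + y * b) * S (b / W n)"]
        integrable_XY[of "\<lambda>a b. cis (x * a + y * b) * (exp (- step_form x y / 2) *\<^sub>R cis (b / W n * freq_drift x y))"])+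
  have "cmod (char_XY (Suc n) x y - exp (- step_form x y / 2) *\<^sub>R char_XY n x (y + freq_drift x y / W n))
      \<le> expectation (\<lambda>\<omega>. cmod (cis (x * X n \<omega> + y * Y n \<omega>) * ?D \<omega>))"
    unfolding diff by (rule integral_norm_bound)
  also have "\<dots> \<le> expectation (\<lambda>\<omega>. 4 * ?L * (?h ^ 3 + ?h\<^sup>2 * (Y n \<omega> / W n)\<^sup>2))"
  proof (rule integral_mono)
    show "integrable M (\<lambda>\<omega>. cmod (cis (x * X n \<omega> + y * Y n \<omega>) * ?D \<omega>))"
      by (rule integrable_XY[of "\<lambda>a b. cmod (cis (x * a + y * b) * (S (b / W n) - exp (- step_form x y / 2) *\<^sub>R cis (b / W n * freq_drift x y)))"])
    show "integrable M (\<lambda>\<omega>. 4 * ?L * (?h ^ 3 + ?h\<^sup>2 * (Y n \<omega> / W n)\<^sup>2))"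
      by (rule integrable_XY[of "\<lambda>a b. 4 * ?L * (?h ^ 3 + ?h\<^sup>2 * (b / W n)\<^sup>2)"])
    show "cmod (cis (x * X n \<omega> + y * Y n \<omega>) * ?D \<omega>) \<le> 4 * ?L * (?h ^ 3 + ?h\<^sup>2 * (Y n \<omega> / W n)\<^sup>2)"
      if "\<omega> \<in> space M" for \<omega>
      using S[OF Y_ratio_bound[OF that n]] by (simp add: norm_mult)
  qed
  also have "\<dots> = 8 * (1 + \<bar>\<alpha>\<bar>) * (?h ^ 3 + ?h\<^sup>2 * EYY n / (W n)\<^sup>2)"
  proof -
    have "4 * ?L * (?h ^ 3 + ?h\<^sup>2 * (Y n \<omega> / W n)\<^sup>2) = 4 * ?L * ?h ^ 3 + 4 * ?L * ?h\<^sup>2 / (W n)\<^sup>2 * (Y n \<omega>)\<^sup>2" for \<omega>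
      by (simp only: power_divide distrib_left) simp
    then have "expectation (\<lambda>\<omega>. 4 * ?L * (?h ^ 3 + ?h\<^sup>2 * (Y n \<omega> / W n)\<^sup>2)) =
       4 * ?L * ?h ^ 3 + 4 * ?L * ?h\<^sup>2 / (W n)\<^sup>2 * EYY n"
      by (simp only: Bochner_Integration.integral_add[OF integrable_const integrable_mult_right[OF integrable_moments(2)]])
        (simp only: prob_space integral_mult_right_zero EYY_def lebesgue_integral_const real_scaleR_def mult_1)
    also have "\<dots> = 8 * (1 + \<bar>\<alpha>\<bar>) * (?h ^ 3 + ?h\<^sup>2 * EYY n / (W n)\<^sup>2)"
      by (simp only: distrib_left) simp
    finally show ?thesis .
  qed
  finally show ?thesis .
qed

end

section \<open>The backward recursion of the frequencies\<close>

context weighted_broadcast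
begin

text \<open>
  The coefficient for which \<open>X k + dual_freq n k * Y k\<close> is the conditional expectation of \<open>X n\<close> given the first \<open>k\<close>
  vertices.  If \<open>drift\<close> and all the factors are nonzero, it is
  \<open>(2 p - 1) / drift * ((\<Prod>i\<in>{k..<n}. 1 + drift / W i) - 1)\<close>; the sum also covers \<open>drift = 0\<close>.
\<close>
definition dual_freq :: "nat \<Rightarrow> nat \<Rightarrow> real" where
  "dual_freq n k = (2 * p - 1) * (\<Sum>j\<in>{k..<n}. 1 / W j * (\<Prod>i\<in>{k..<j}. 1 + drift / W i))"

lemma dual_freq_self [simp]: "dual_freq n n = 0"
  by (simp add: dual_freq_def)

lemma dual_freq_rec:
  assumes "k < n"
  shows "dual_freq n k = dual_freq n (Suc k) + ((2 * p - 1) + drift * dual_freq n (Suc k)) / W k"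
proof -
  define s where "s = (\<Sum>j\<in>{Suc k..<n}. 1 / W j * (\<Prod>i\<in>{Suc k..<j}. 1 + drift / W i))"
  have "(\<Sum>j\<in>{k..<n}. 1 / W j * (\<Prod>i\<in>{k..<j}. 1 + drift / W i)) =
    1 / W k + (\<Sum>j\<in>{Suc k..<n}. 1 / W j * (\<Prod>i\<in>{k..<j}. 1 + drift / W i))"
    using assms by (simp add: sum.atLeast_Suc_lessThan)
  also have "(\<Sum>j\<in>{Suc k..<n}. 1 / W j * (\<Prod>i\<in>{k..<j}. 1 + drift / W i)) =
     (\<Sum>j\<in>{Suc k..<n}. (1 + drift / W k) * (1 / W j * (\<Prod>i\<in>{Suc k..<j}. 1 + drift / W i)))"
    by (intro sum.cong refl) (simp add: prod.atLeast_Suc_lessThan)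
  also have "\<dots> = (1 + drift / W k) * s" by (simp only: s_def sum_distrib_left)
  finally have "dual_freq n k = (2 * p - 1) * (1 / W k + (1 + drift / W k) * s)" by (simp only: dual_freq_def)
  moreover have "dual_freq n (Suc k) = (2 * p - 1) * s" by (simp only: dual_freq_def s_def)
  ultimately show ?thesis by (simp add: add_divide_distrib distrib_left distrib_right)
qed

text \<open>
  Replacing \<open>W k\<close> by \<open>(1 + \<alpha>) k\<close> costs a relative error of order \<open>1 / k\<close>.  A negative factor occurs only for
  \<open>k < 2 \<bar>drift\<bar>\<close>, where the quadratic term can absorb it.
\<close>
lemma growth_factor_bound:
  assumes \<mu>: "\<mu> > 0" "drift / (1 + \<alpha>) \<le> \<mu>"
  obtains C where "C \<ge> 0" "\<And>k. k \<ge> 1 \<Longrightarrow> \<bar>1 + drift / W k\<bar> \<le> 1 + \<mu> / real k + C / (real k)\<^sup>2"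
proof
  define C where "C = 2 * \<bar>drift / (1 + \<alpha>) * \<alpha>\<bar> + 4 * drift\<^sup>2"
  show "C \<ge> 0" by (simp add: C_def)
  fix k :: nat assume k: "k \<ge> 1"
  have W: "W k > 0" "real k \<le> 2 * W k"
    using total_weight_ge[OF alpha_ge k] W_pos[OF k] by auto
  have \<mu>k: "\<mu> / real k \<ge> 0" using \<mu> by simp
  show "\<bar>1 + drift / W k\<bar> \<le> 1 + \<mu> / real k + C / (real k)\<^sup>2"
  proof (cases "1 + drift / W k \<ge> 0")
    case True
    have "drift / W k = drift / (1 + \<alpha>) / real k + drift / (1 + \<alpha>) * \<alpha> / (W k * real k)"
    proof -
      have eq: "W k + \<alpha> = (1 + \<alpha>) * real k" by (simp add: total_weight_def)
      have "drift / (1 + \<alpha>) / real k + drift / (1 + \<alpha>) * \<alpha> / (W k * real k) =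
          drift / ((1 + \<alpha>) * real k) * ((W k + \<alpha>) / W k)"
        using W by (simp add: add_divide_distrib distrib_left)
      then show ?thesis unfolding eq using k one_plus_alpha by simp
    qed
    also have "drift / (1 + \<alpha>) / real k \<le> \<mu> / real k" using \<mu> by (intro divide_right_mono) auto
    also have "drift / (1 + \<alpha>) * \<alpha> / (W k * real k) \<le> \<bar>drift / (1 + \<alpha>) * \<alpha>\<bar> / (real k / 2 * real k)"
      using W k by (intro frac_le mult_right_mono abs_ge_self) (auto simp del: abs_mult abs_divide)
    also have "\<dots> \<le> C / (real k)\<^sup>2"
      using k by (simp add: C_def power2_eq_square field_simps)
    finally show ?thesis using True by simp
  next
    case False
    then have neg: "drift / W k < - 1" by simp
    then have "\<bar>drift\<bar> \<ge> W k" using W by (simp add: field_simps)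
    then have "real k \<le> 2 * \<bar>drift\<bar>" using W by simp
    then have "1 \<le> 2 * \<bar>drift\<bar> / real k" using k by simp
    have "\<bar>1 + drift / W k\<bar> \<le> \<bar>drift\<bar> / W k" using neg W by (simp add: field_simps)
    also have "\<dots> \<le> \<bar>drift\<bar> / (real k / 2)" using W k by (intro divide_left_mono) auto
    also have "\<dots> = 2 * \<bar>drift\<bar> / real k * 1" by simp
    also have "\<dots> \<le> 2 * \<bar>drift\<bar> / real k * (2 * \<bar>drift\<bar> / real k)"
      using \<open>1 \<le> 2 * \<bar>drift\<bar> / real k\<close> by (intro mult_left_mono) auto
    also have "\<dots> = 4 * drift\<^sup>2 / (real k)\<^sup>2" by (simp add: power2_eq_square)
    also have "\<dots> \<le> C / (real k)\<^sup>2" by (intro divide_right_mono) (auto simp: C_def)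
    finally show ?thesis using \<mu>k by simp
  qed
qed

text \<open>
  Backward induction with the potential \<open>g k = k powr (- \<mu>) * exp (D / k)\<close>.  The power gains the factor
  \<open>1 + \<mu> / k\<close> up to order \<open>1 / k\<^sup>2\<close> at each step, and the bounded exponential pays for that quadratic error because
  \<open>1 / k - 1 / (k + 1)\<close> is at least \<open>1 / (2 k\<^sup>2)\<close>.  Adding the constant \<open>A\<close> to \<open>\<bar>dual_freq n k\<bar>\<close> absorbs the forcing.
\<close>
lemma dual_freq_bound:
  assumes \<mu>: "\<mu> > 0" "drift / (1 + \<alpha>) \<le> \<mu>"
  obtains C where "C > 0" "\<And>n k. 1 \<le> k \<Longrightarrow> k \<le> n \<Longrightarrow> 1 + \<bar>dual_freq n k\<bar> \<le> C * (real n / real k) powr \<mu>"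
proof -
  obtain C0 where C0: "C0 \<ge> 0" "\<And>k. k \<ge> 1 \<Longrightarrow> \<bar>1 + drift / W k\<bar> \<le> 1 + \<mu> / real k + C0 / (real k)\<^sup>2"
    using growth_factor_bound[OF \<mu>] by blast
  define D where "D = (C0 + \<mu>) * 2"
  define A where "A = 1 + 2 / \<mu>"
  define g where "g k = real k powr (- \<mu>) * exp (D / real k)" for k :: nat
  have gpos: "g k > 0" if "k \<ge> 1" for k using that by (simp add: g_def)
  have A: "A \<ge> 1" "A * \<mu> \<ge> 2" using \<mu> by (auto simp: A_def field_simps)
  have g_step: "(1 + \<mu> / real k + C0 / (real k)\<^sup>2) * g (Suc k) \<le> g k" if k: "k \<ge> 1" for k
  proof -
    have "1 / real k - (1 / real k)\<^sup>2 \<le> ln (1 + 1 / real k)"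
      using k by (intro ln_one_plus_pos_lower_bound) auto
    also have "1 + 1 / real k = real (Suc k) / real k" using k by (simp add: field_simps)
    finally have "1 / real k \<le> ln (real (Suc k) / real k) + 1 / (real k)\<^sup>2" by (simp add: power_one_over)
    then have "\<mu> * (1 / real k) \<le> \<mu> * (ln (real (Suc k) / real k) + 1 / (real k)\<^sup>2)"
      using \<mu> by (intro mult_left_mono) auto
    then have 1: "\<mu> / real k + C0 / (real k)\<^sup>2 \<le> \<mu> * ln (real (Suc k) / real k) + (C0 + \<mu>) / (real k)\<^sup>2"
      by (simp add: algebra_simps add_divide_distrib)
    have "real k * real (Suc k) \<le> 2 * (real k)\<^sup>2" using k by (simp add: power2_eq_square algebra_simps)
    then have "1 / (2 * (real k)\<^sup>2) \<le> 1 / (real k * real (Suc k))" using k by (intro divide_left_mono) auto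
    then have "D * (1 / (2 * (real k)\<^sup>2)) \<le> D * (1 / (real k * real (Suc k)))"
      using C0 \<mu> by (intro mult_left_mono) (auto simp: D_def)
    also have "1 / (real k * real (Suc k)) = 1 / real k - 1 / real (Suc k)" using k by (simp add: field_simps)
    finally have 2: "(C0 + \<mu>) / (real k)\<^sup>2 \<le> D / real k - D / real (Suc k)"
    proof -
      have "E * 2 * (1 / (2 * r)) = E / r" for E r :: real by simp
      then have "D * (1 / (2 * (real k)\<^sup>2)) = (C0 + \<mu>) / (real k)\<^sup>2" by (simp only: D_def)
      moreover assume "D * (1 / (2 * (real k)\<^sup>2)) \<le> D * (1 / real k - 1 / real (Suc k))"
      ultimately show ?thesis by (simp add: right_diff_distrib)
    qed
    have "1 + (\<mu> / real k + C0 / (real k)\<^sup>2) \<le> exp (\<mu> / real k + C0 / (real k)\<^sup>2)" by (rule exp_ge_add_one_self)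
    also have "\<dots> \<le> exp (\<mu> * ln (real (Suc k) / real k) + (D / real k - D / real (Suc k)))"
      using 1 2 by simp
    also have "\<dots> = g k / g (Suc k)"
    proof -
      have "real k powr (- \<mu>) / real (Suc k) powr (- \<mu>) = exp (\<mu> * ln (real (Suc k) / real k))"
        using k by (simp add: powr_def ln_div exp_diff[symmetric] right_diff_distrib del: of_nat_Suc)
      then show ?thesis by (simp only: g_def exp_add exp_diff times_divide_times_eq[symmetric])
    qed
    finally show ?thesis using gpos[of "Suc k"] by (simp add: pos_le_divide_eq add.assoc)
  qed
  have main: "\<bar>dual_freq n k\<bar> + A \<le> A * (g k / g n)" if "1 \<le> k" "k \<le> n" for n k
    using that(2,1)
  proof (induction k rule: inc_induct)
    case base
    then show ?case using gpos[of n] by simp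
  next
    case (step k)
    have k: "k \<ge> 1" using step by simp
    have "1 / W k \<le> 1 / (real k / 2)" using total_weight_ge[OF alpha_ge k] k W_pos[OF k] by (intro divide_left_mono) auto
    then have "\<bar>2 * p - 1\<bar> * (1 / W k) \<le> 1 * (2 / real k)" using p_range W_pos[OF k] by (intro mult_mono) auto
    also have "\<dots> \<le> A * \<mu> / real k" using A by (simp add: divide_right_mono)
    finally have q: "\<bar>(2 * p - 1) / W k\<bar> \<le> A * \<mu> / real k" using W_pos[OF k] by (simp add: abs_mult abs_divide)
    have "dual_freq n k = (1 + drift / W k) * dual_freq n (Suc k) + (2 * p - 1) / W k"
      using step by (subst dual_freq_rec) (auto simp: add_divide_distrib distrib_right)
    also have "\<bar>\<dots>\<bar> \<le> \<bar>1 + drift / W k\<bar> * \<bar>dual_freq n (Suc k)\<bar> + A * \<mu> / real k"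
      using q by (intro order_trans[OF abs_triangle_ineq]) (simp add: abs_mult)
    also have "\<dots> \<le> (1 + \<mu> / real k + C0 / (real k)\<^sup>2) * \<bar>dual_freq n (Suc k)\<bar> + A * \<mu> / real k"
      using C0(2)[OF k] by (intro add_right_mono mult_right_mono) auto
    finally have "\<bar>dual_freq n k\<bar> + A \<le> (1 + \<mu> / real k + C0 / (real k)\<^sup>2) * (\<bar>dual_freq n (Suc k)\<bar> + A) - A * C0 / (real k)\<^sup>2"
      by (simp add: algebra_simps)
    also have "\<dots> \<le> (1 + \<mu> / real k + C0 / (real k)\<^sup>2) * (\<bar>dual_freq n (Suc k)\<bar> + A)"
      using A C0 by simp
    also have "\<dots> \<le> (1 + \<mu> / real k + C0 / (real k)\<^sup>2) * (A * (g (Suc k) / g n))"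
      using step \<mu> C0 by (intro mult_left_mono) auto
    also have "\<dots> = A / g n * ((1 + \<mu> / real k + C0 / (real k)\<^sup>2) * g (Suc k))" by simp
    also have "\<dots> \<le> A / g n * g k"
      using g_step[OF k] A gpos[of n] step by (intro mult_left_mono) (auto intro: less_imp_le)
    finally show ?case by simp
  qed
  show thesis
  proof (rule that)
    show "A * exp D > 0" using A by simp
    fix n k :: nat assume nk: "1 \<le> k" "k \<le> n"
    have "D \<ge> 0" using C0 \<mu> by (simp add: D_def)
    then have "D / real k \<le> D" "0 \<le> D / real n" using nk by (auto simp: divide_le_eq mult_le_cancel_left1)
    then have le: "exp (D / real k - D / real n) \<le> exp D" by simp
    have "g k / g n = (real n / real k) powr \<mu> * exp (D / real k - D / real n)"
    proof -
      have "real k powr (- \<mu>) / real n powr (- \<mu>) = (real n / real k) powr \<mu>"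
        using nk by (simp add: powr_divide powr_minus field_simps)
      then show ?thesis by (simp only: g_def exp_diff times_divide_times_eq[symmetric])
    qed
    also have "\<dots> \<le> (real n / real k) powr \<mu> * exp D" using le by (intro mult_left_mono) auto
    finally have "A * (g k / g n) \<le> A * ((real n / real k) powr \<mu> * exp D)" using A by (intro mult_left_mono) auto
    then show "1 + \<bar>dual_freq n k\<bar> \<le> A * exp D * (real n / real k) powr \<mu>"
      using main[OF nk] A by (simp add: mult.commute mult.left_commute)
  qed
qed

text \<open>
  The second moment of the martingale \<open>X k + dual_freq n k * Y k\<close> grows in each step by its mean conditional variance,
  the mean square of the step less its squared mean.  Read backwards, this determines the sum of the \<open>step_form\<close>
  from the second moment of \<open>X n\<close>, so no Riemann sum has to be evaluated.
\<close>
lemma variance_decomposition: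
  assumes "1 \<le> m" "m \<le> n"
  shows "EXX m + 2 * dual_freq n m * EXY m + (dual_freq n m)\<^sup>2 * EYY m +
     (\<Sum>k\<in>{m..<n}. step_form 1 (dual_freq n (Suc k)) - (freq_drift 1 (dual_freq n (Suc k)) / W k)\<^sup>2 * EYY k) = EXX n"
  using assms(2,1)
proof (induction m rule: inc_induct)
  case (step k)
  have k: "k \<ge> 1" using step by simp
  define b' where "b' = dual_freq n (Suc k)"
  define d where "d = freq_drift 1 b' / W k"
  have b: "dual_freq n k = b' + d" using dual_freq_rec[OF step(2)] by (simp add: b'_def d_def freq_drift_def)
  have dW: "d = (2 * p - 1) / W k + drift * b' / W k" by (simp add: d_def freq_drift_def add_divide_distrib)
  have "EXX (Suc k) + 2 * b' * EXY (Suc k) + b'\<^sup>2 * EYY (Suc k) =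
     EXX k + 2 * (b' + d) * EXY k + (b'\<^sup>2 + 2 * b' * d) * EYY k +
       (1 + 2 * b' * (1 + \<alpha> * (2 * p - 1)) + b'\<^sup>2 * step_var)"
    unfolding EXX_Suc[OF k] EXY_Suc[OF k] EYY_Suc[OF k] dW by (simp add: algebra_simps power2_eq_square)
  also have "1 + 2 * b' * (1 + \<alpha> * (2 * p - 1)) + b'\<^sup>2 * step_var = step_form 1 b'"
    by (simp add: step_form_def step_var_def algebra_simps power2_eq_square)
  also have "b'\<^sup>2 + 2 * b' * d = (dual_freq n k)\<^sup>2 - d\<^sup>2" by (simp add: b power2_eq_square algebra_simps)
  finally have eq: "EXX (Suc k) + 2 * b' * EXY (Suc k) + b'\<^sup>2 * EYY (Suc k) =
      EXX k + 2 * dual_freq n k * EXY k + ((dual_freq n k)\<^sup>2 - d\<^sup>2) * EYY k + step_form 1 b'" by (simp add: b)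
  have "(\<Sum>j\<in>{k..<n}. step_form 1 (dual_freq n (Suc j)) - (freq_drift 1 (dual_freq n (Suc j)) / W j)\<^sup>2 * EYY j) =
     step_form 1 b' - d\<^sup>2 * EYY k + (\<Sum>j\<in>{Suc k..<n}. step_form 1 (dual_freq n (Suc j)) - (freq_drift 1 (dual_freq n (Suc j)) / W j)\<^sup>2 * EYY j)"
    using step(2) by (simp add: sum.atLeast_Suc_lessThan b'_def d_def)
  with step(3) eq show ?case using step k by (simp add: b'_def[symmetric] left_diff_distrib)
qed simp

lemma step_form_scale: "step_form x (x * c) = x\<^sup>2 * step_form 1 c"
  by (simp add: step_form_def power2_eq_square algebra_simps)

lemma step_form_nonneg: "step_form x y \<ge> 0"
proof -
  have "step_form x y = p * (x + y + \<alpha> * y)\<^sup>2 + (1 - p) * (x + y - \<alpha> * y)\<^sup>2"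
    by (simp add: step_form_def power2_eq_square algebra_simps)
  then show ?thesis using p_range by simp
qed

definition step_error where
  "step_error n x k = freq_bound x (x * dual_freq n (Suc k)) ^ 3 + (freq_bound x (x * dual_freq n (Suc k)))\<^sup>2 * EYY k / (W k)\<^sup>2"

lemma char_XY_telescope:
  assumes "1 \<le> m" "m \<le> n"
  shows "cmod (char_XY n x 0 - exp (- x\<^sup>2 * (\<Sum>k\<in>{m..<n}. step_form 1 (dual_freq n (Suc k))) / 2) *\<^sub>R char_XY m x (x * dual_freq n m))
    \<le> 8 * (1 + \<bar>\<alpha>\<bar>) * (\<Sum>k\<in>{m..<n}. step_error n x k)"
  using assms(2,1)
proof (induction m rule: inc_induct)
  case base
  then show ?case by simp
next
  case (step k)
  have k: "k \<ge> 1" using step by simp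
  let ?b' = "dual_freq n (Suc k)" and ?K = "8 * (1 + \<bar>\<alpha>\<bar>)"
  define S where "S = (\<Sum>j\<in>{Suc k..<n}. step_form 1 (dual_freq n (Suc j)))"
  have S: "(\<Sum>j\<in>{k..<n}. step_form 1 (dual_freq n (Suc j))) = step_form 1 ?b' + S"
    using step(2) by (simp add: sum.atLeast_Suc_lessThan S_def)
  have S0: "S \<ge> 0" unfolding S_def by (intro sum_nonneg step_form_nonneg)
  have b: "x * ?b' + freq_drift x (x * ?b') / W k = x * dual_freq n k"
    using dual_freq_rec[OF step(2)] by (simp add: freq_drift_def algebra_simps add_divide_distrib)
  have E: "exp (- x\<^sup>2 * (step_form 1 ?b' + S) / 2) = exp (- x\<^sup>2 * S / 2) * exp (- step_form x (x * ?b') / 2)"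
    unfolding step_form_scale exp_add[symmetric] by (rule arg_cong[of _ _ exp]) (simp add: field_simps)
  have "char_XY n x 0 - exp (- x\<^sup>2 * (step_form 1 ?b' + S) / 2) *\<^sub>R char_XY k x (x * dual_freq n k) =
     (char_XY n x 0 - exp (- x\<^sup>2 * S / 2) *\<^sub>R char_XY (Suc k) x (x * ?b')) +
     exp (- x\<^sup>2 * S / 2) *\<^sub>R (char_XY (Suc k) x (x * ?b') - exp (- step_form x (x * ?b') / 2) *\<^sub>R char_XY k x (x * dual_freq n k))"
    unfolding E by (simp add: algebra_simps)
  also have "cmod \<dots> \<le> ?K * (\<Sum>j\<in>{Suc k..<n}. step_error n x j) + 1 * (?K * step_error n x k)"
  proof (intro order_trans[OF norm_triangle_ineq] add_mono)
    show "cmod (char_XY n x 0 - exp (- x\<^sup>2 * S / 2) *\<^sub>R char_XY (Suc k) x (x * ?b')) \<le> ?K * (\<Sum>j\<in>{Suc k..<n}. step_error n x j)"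
      unfolding S_def using step by simp
    show "cmod (exp (- x\<^sup>2 * S / 2) *\<^sub>R (char_XY (Suc k) x (x * ?b') -
        exp (- step_form x (x * ?b') / 2) *\<^sub>R char_XY k x (x * dual_freq n k))) \<le> 1 * (?K * step_error n x k)"
      unfolding norm_scaleR
      using char_XY_step[OF k, of x "x * ?b'"] S0 unfolding b step_error_def
      by (intro mult_mono) auto
  qed
  also have "\<dots> = ?K * (\<Sum>j\<in>{k..<n}. step_error n x j)"
    using step(2) by (simp add: sum.atLeast_Suc_lessThan algebra_simps)
  finally show ?case unfolding S .
qed

end

section \<open>Gaussian limits\<close>

text \<open>The continuous mapping theorem along a line, which carries the real limit theorems over to vectors.\<close>
lemma conv_in_distribution_line:
  fixes v :: "real^'n" and T :: "nat \<Rightarrow> 'w \<Rightarrow> real"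
  assumes M: "prob_space M" and T [measurable]: "\<And>n. T n \<in> borel_measurable M"
    and weak: "weak_conv_m (\<lambda>n. distr M borel (T n)) N" and N: "real_distribution N"
  shows "conv_in_distribution M (\<lambda>n \<omega>. T n \<omega> *\<^sub>R v) (distr N borel (\<lambda>x. x *\<^sub>R v))"
proof -
  interpret M: prob_space M by fact
  interpret N: real_distribution N by fact
  have [measurable]: "(\<lambda>x :: real. x *\<^sub>R v) \<in> borel_measurable borel" by measurable
  have "(\<lambda>n. \<integral>\<omega>. f (T n \<omega> *\<^sub>R v) \<partial>M) \<longlonglongrightarrow> (\<integral>x. f x \<partial>distr N borel (\<lambda>x. x *\<^sub>R v))"
    if f: "continuous_on UNIV f" "bounded (range f)" for f :: "real^'n \<Rightarrow> real"
  proof -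
    have [measurable]: "f \<in> borel_measurable borel" using f(1) by (rule borel_measurable_continuous_onI)
    obtain B where B: "\<And>x. norm (f x) \<le> B" using f(2) by (auto simp: bounded_iff)
    have "isCont (\<lambda>x. f (x *\<^sub>R v)) x" for x
    proof -
      have "continuous_on UNIV (\<lambda>x. f (x *\<^sub>R v))"
        by (intro continuous_on_compose2[OF f(1)] continuous_intros) auto
      then show ?thesis by (simp add: continuous_on_eq_continuous_at)
    qed
    then have "(\<lambda>n. integral\<^sup>L (distr M borel (T n)) (\<lambda>x. f (x *\<^sub>R v))) \<longlonglongrightarrow> integral\<^sup>L N (\<lambda>x. f (x *\<^sub>R v))"
      using B by (intro weak_conv_imp_integral_bdd_continuous_conv[OF _ N weak, where B = B] real_distribution.intro
          real_distribution_axioms.intro M.prob_space_distr) auto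
    then show ?thesis by (simp add: integral_distr)
  qed
  moreover have "prob_space (distr N borel (\<lambda>x. x *\<^sub>R v))" by (rule N.prob_space_distr) simp
  ultimately show ?thesis by (simp add: conv_in_distribution_def)
qed

lemma measurable_vec_lambda_PiM:
  "(\<lambda>x. \<chi> i. x i) \<in> borel_measurable (\<Pi>\<^sub>M i\<in>(UNIV :: 'n::finite set). (std_normal_distribution :: real measure))"
proof (subst borel_measurable_euclidean_space, intro ballI)
  fix e :: "real^'n" assume "e \<in> Basis"
  then obtain i where e: "e = axis i 1" by (auto simp: Basis_vec_def)
  have "(\<lambda>x. x i) \<in> measurable (\<Pi>\<^sub>M i\<in>(UNIV :: 'n::finite set). (std_normal_distribution :: real measure)) std_normal_distribution"
    by (rule measurable_component_singleton) simp
  then have "(\<lambda>x. x i) \<in> borel_measurable (\<Pi>\<^sub>M i\<in>(UNIV :: 'n::finite set). (std_normal_distribution :: real measure))"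
    by (simp cong: measurable_cong_sets)
  then show "(\<lambda>x. (\<chi> i. x i) \<bullet> e) \<in> borel_measurable (\<Pi>\<^sub>M i\<in>(UNIV :: 'n::finite set). (std_normal_distribution :: real measure))"
    by (simp add: e inner_axis)
qed

text \<open>
  A square root of the covariance matrix with second column zero makes the image of a standard normal vector depend on
  its first coordinate only.
\<close>
lemma centred_normal_alternating:
  assumes "c \<ge> 0"
  shows "centred_normal (c *\<^sub>R alternating_matrix)
    (distr std_normal_distribution borel (\<lambda>x. (sqrt c * x) *\<^sub>R vector [1, - 1]))"
proof -
  let ?P = "\<Pi>\<^sub>M i\<in>(UNIV :: 2 set). (std_normal_distribution :: real measure)"
  let ?v = "vector [1, - 1] :: real^2"
  define A :: "real^2^2" where "A = vector [vector [sqrt c, 0], vector [- sqrt c, 0]]"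
  have cov: "A ** transpose A = c *\<^sub>R alternating_matrix"
    using assms by (simp add: A_def alternating_matrix_def vec_eq_iff forall_2 matrix_matrix_mult_def transpose_def sum_2)
  have Av: "A *v x = (sqrt c * x $ 1) *\<^sub>R ?v" for x
    by (simp add: A_def vec_eq_iff forall_2 matrix_vector_mult_def sum_2)
  have comp: "distr ?P std_normal_distribution (\<lambda>x. x 1) = std_normal_distribution"
    by (rule distr_PiM_component) (auto intro: prob_space_normal_density)
  have m1: "(\<lambda>x. x 1) \<in> measurable ?P std_normal_distribution"
    by (rule measurable_component_singleton) simp
  have m2: "(\<lambda>x. (sqrt c * x) *\<^sub>R ?v) \<in> borel_measurable std_normal_distribution" by simp
  have m3: "(\<lambda>x. (sqrt c * x $ 1) *\<^sub>R ?v) \<in> borel_measurable borel"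
    by (intro borel_measurable_continuous_onI continuous_intros)
  have "distr std_normal_vector borel ((*v) A) =
      distr ?P borel ((\<lambda>x :: real^2. (sqrt c * x $ 1) *\<^sub>R ?v) \<circ> (\<lambda>x. \<chi> i. x i))"
    unfolding std_normal_vector_def Av[abs_def] by (rule distr_distr[OF m3 measurable_vec_lambda_PiM])
  also have "\<dots> = distr ?P borel ((\<lambda>x. (sqrt c * x) *\<^sub>R ?v) \<circ> (\<lambda>x. x 1))"
    by (simp add: comp_def)
  also have "\<dots> = distr (distr ?P std_normal_distribution (\<lambda>x. x 1)) borel (\<lambda>x. (sqrt c * x) *\<^sub>R ?v)"
    by (rule distr_distr[OF m2 m1, symmetric])
  finally have "distr std_normal_distribution borel (\<lambda>x. (sqrt c * x) *\<^sub>R ?v) = distr std_normal_vector borel ((*v) A)"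
    unfolding comp by simp
  then show ?thesis using cov by (auto simp: centred_normal_def)
qed

context weighted_broadcast
begin

lemma freq_drift_le_freq_bound: "\<bar>freq_drift x y\<bar> \<le> freq_bound x y"
proof -
  have "\<bar>(2 * p - 1) * x\<bar> \<le> (1 + \<bar>\<alpha>\<bar>) * \<bar>x\<bar>" unfolding abs_mult using p_range by (intro mult_right_mono) auto
  moreover have "\<bar>drift * y\<bar> \<le> (1 + \<bar>\<alpha>\<bar>) * \<bar>y\<bar>" unfolding abs_mult using p_range by (intro mult_right_mono) (auto simp: drift_def)
  moreover have "\<bar>freq_drift x y\<bar> \<le> \<bar>(2 * p - 1) * x\<bar> + \<bar>drift * y\<bar>" unfolding freq_drift_def by (rule abs_triangle_ineq)
  ultimately show ?thesis unfolding freq_bound_def distrib_left by linarith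
qed

lemma freq_bound_scale: "freq_bound x (x * c) = (1 + \<bar>\<alpha>\<bar>) * \<bar>x\<bar> * (1 + \<bar>c\<bar>)"
  by (simp add: freq_bound_def abs_mult algebra_simps)

lemma EYY_nonneg: "EYY n \<ge> 0" and EXX_nonneg: "EXX n \<ge> 0"
  by (simp_all add: EYY_def EXX_def)

text \<open>
  With \<open>x = t / sqrt (G n)\<close> and \<open>H = C \<bar>x\<bar> (n powr \<mu>)\<close> up to a constant, all frequencies at step \<open>k\<close> are at most
  \<open>H (k powr (- \<mu>))\<close>, and \<open>H\<close> tends to \<open>0\<close>.  The cubic errors are summable in \<open>k\<close> since \<open>3 \<mu> > 1\<close>, and those with the
  second moment of \<open>Y\<close> since \<open>\<theta> < 1 + 2 \<mu>\<close>.  The bound on \<open>dual_freq\<close> is a hypothesis because \<open>p = 1/2\<close>, where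
  \<open>dual_freq\<close> vanishes, allows a smaller \<open>\<mu>\<close> than the general estimate.
\<close>
lemma char_X_tendsto:
  fixes G :: "nat \<Rightarrow> real"
  assumes C: "C > 0" "\<And>n k. 1 \<le> k \<Longrightarrow> k \<le> n \<Longrightarrow> 1 + \<bar>dual_freq n k\<bar> \<le> C * (real n / real k) powr \<mu>"
    and \<mu>: "\<mu> > 1 / 3"
    and \<theta>: "1 < \<theta>" "2 * drift / (1 + \<alpha>) < \<theta>" "\<theta> < 1 + 2 * \<mu>"
    and G: "eventually (\<lambda>n. G n > 0) sequentially" and G\<mu>: "(\<lambda>n. real n powr (2 * \<mu>) / G n) \<longlonglongrightarrow> 0"
    and zG: "(\<lambda>n. EXX n / G n) \<longlonglongrightarrow> s2"
  shows "(\<lambda>n. char_XY n (t / sqrt (G n)) 0) \<longlonglongrightarrow> exp (- (t\<^sup>2 * s2) / 2)"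
proof -
  obtain Cu where Cu: "Cu > 0" "\<And>n. n \<ge> 1 \<Longrightarrow> EYY n \<le> Cu * real n powr \<theta>"
    using EYY_powr_bound[OF \<theta>(1,2)] by blast
  let ?a = "1 + \<bar>\<alpha>\<bar>"
  define x where "x n = t / sqrt (G n)" for n
  define H where "H n = ?a * C * \<bar>x n\<bar> * real n powr \<mu>" for n
  define S1 where "S1 = (\<Sum>k. real k powr (- 3 * \<mu>))"
  define S2 where "S2 = (\<Sum>k. real k powr (\<theta> - 2 * \<mu> - 2))"
  define E where "E n = H n ^ 3 * S1 + 4 * Cu * (H n)\<^sup>2 * S2" for n
  define V where "V n = (\<Sum>k\<in>{1..<n}. step_form 1 (dual_freq n (Suc k)))" for n
  define D where "D n = (\<Sum>k\<in>{1..<n}. (freq_drift 1 (dual_freq n (Suc k)) / W k)\<^sup>2 * EYY k)" for n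
  have H0: "H n \<ge> 0" for n using C by (simp add: H_def)
  have "(\<lambda>n. ?a * C * \<bar>t\<bar> * sqrt (real n powr (2 * \<mu>) / G n)) \<longlonglongrightarrow> ?a * C * \<bar>t\<bar> * sqrt 0"
    by (intro tendsto_intros G\<mu>)
  moreover have "eventually (\<lambda>n. ?a * C * \<bar>t\<bar> * sqrt (real n powr (2 * \<mu>) / G n) = H n) sequentially"
    using G
  proof eventually_elim
    case (elim n)
    have "sqrt (real n powr (2 * \<mu>)) = real n powr \<mu>"
      by (intro real_sqrt_unique) (auto simp: power2_eq_square powr_add[symmetric])
    then show ?case using elim by (simp add: H_def x_def real_sqrt_divide abs_divide)
  qed
  ultimately have H: "H \<longlonglongrightarrow> 0" by (simp add: tendsto_cong)
  have fb: "freq_bound (x n) (x n * dual_freq n (Suc k)) \<le> H n * real k powr (- \<mu>)" if k: "k \<in> {1..<n}" for n k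
  proof -
    have "1 + \<bar>dual_freq n (Suc k)\<bar> \<le> C * (real n / real (Suc k)) powr \<mu>" using k by (intro C) auto
    also have "\<dots> \<le> C * (real n / real k) powr \<mu>"
      using k C \<mu> by (intro mult_left_mono powr_mono2 divide_left_mono) auto
    also have "\<dots> = C * real n powr \<mu> * real k powr (- \<mu>)"
      using k by (simp add: powr_divide powr_minus field_simps)
    finally have "?a * \<bar>x n\<bar> * (1 + \<bar>dual_freq n (Suc k)\<bar>) \<le> ?a * \<bar>x n\<bar> * (C * real n powr \<mu> * real k powr (- \<mu>))"
      by (intro mult_left_mono) auto
    then show ?thesis unfolding freq_bound_scale by (simp add: H_def mult_ac)
  qed
  have fb0: "freq_bound y c \<ge> 0" for y c by (simp add: freq_bound_def)
  have err: "step_error n (x n) k \<le> H n ^ 3 * real k powr (- 3 * \<mu>) + 4 * Cu * (H n)\<^sup>2 * real k powr (\<theta> - 2 * \<mu> - 2)"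
    if k: "k \<in> {1..<n}" for n k
  proof -
    \<comment> \<open>One factor \<open>k powr (- \<mu>)\<close> for each frequency; \<open>W k \<ge> k / 2\<close> accounts for the constant \<open>4\<close>.\<close>
    let ?h = "freq_bound (x n) (x n * dual_freq n (Suc k))"
    have "?h ^ 3 \<le> (H n * real k powr (- \<mu>)) ^ 3" by (intro power_mono fb[OF k] fb0)
    also have "\<dots> = H n ^ 3 * real k powr (- 3 * \<mu>)"
      using k by (simp add: power_mult_distrib powr_power mult.commute)
    finally have 1: "?h ^ 3 \<le> H n ^ 3 * real k powr (- 3 * \<mu>)" .
    have "?h\<^sup>2 \<le> (H n * real k powr (- \<mu>))\<^sup>2" by (intro power_mono fb[OF k] fb0)
    also have "\<dots> = (H n)\<^sup>2 * real k powr (- 2 * \<mu>)"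
      using k by (simp add: power_mult_distrib powr_power mult.commute)
    finally have h2: "?h\<^sup>2 \<le> (H n)\<^sup>2 * real k powr (- 2 * \<mu>)" .
    have W: "real k / 2 \<le> W k" using k by (intro total_weight_ge alpha_ge) auto
    have "?h\<^sup>2 * EYY k / (W k)\<^sup>2 \<le> ((H n)\<^sup>2 * real k powr (- 2 * \<mu>)) * (Cu * real k powr \<theta>) / (real k / 2)\<^sup>2"
      using k W h2 EYY_nonneg[of k] Cu by (intro frac_le mult_mono power_mono) auto
    also have "\<dots> = 4 * Cu * (H n)\<^sup>2 * (real k powr (- 2 * \<mu>) * real k powr \<theta> / real k powr 2)"
      using k by (simp add: powr_numeral field_simps)
    also have "real k powr (- 2 * \<mu>) * real k powr \<theta> / real k powr 2 = real k powr (\<theta> - 2 * \<mu> - 2)"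
      using k by (simp only: powr_add[symmetric] powr_diff[symmetric]) (simp add: algebra_simps)
    finally show ?thesis using 1 unfolding step_error_def by linarith
  qed
  have sum1: "summable (\<lambda>k. real k powr (- 3 * \<mu>))" using \<mu> by (simp add: summable_real_powr_iff)
  have sum2: "summable (\<lambda>k. real k powr (\<theta> - 2 * \<mu> - 2))" using \<theta> by (simp add: summable_real_powr_iff)
  have errsum: "(\<Sum>k\<in>{1..<n}. step_error n (x n) k) \<le> E n" for n
  proof -
    have "(\<Sum>k\<in>{1..<n}. step_error n (x n) k) \<le>
       (\<Sum>k\<in>{1..<n}. H n ^ 3 * real k powr (- 3 * \<mu>) + 4 * Cu * (H n)\<^sup>2 * real k powr (\<theta> - 2 * \<mu> - 2))"
      by (intro sum_mono err)
    also have "\<dots> = H n ^ 3 * (\<Sum>k\<in>{1..<n}. real k powr (- 3 * \<mu>)) +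
        4 * Cu * (H n)\<^sup>2 * (\<Sum>k\<in>{1..<n}. real k powr (\<theta> - 2 * \<mu> - 2))"
      by (simp only: sum.distrib sum_distrib_left)
    also have "\<dots> \<le> E n"
      unfolding E_def S1_def S2_def using H0[of n] Cu
      by (intro add_mono mult_left_mono sum_le_suminf sum1 sum2) auto
    finally show ?thesis .
  qed
  have "(\<lambda>n. H n ^ 3 * S1 + 4 * Cu * (H n)\<^sup>2 * S2) \<longlonglongrightarrow> 0 ^ 3 * S1 + 4 * Cu * 0\<^sup>2 * S2"
    by (intro tendsto_intros H)
  then have E: "E \<longlonglongrightarrow> 0" by (simp add: E_def[abs_def])
  have b1: "\<bar>x n\<bar> * (1 + \<bar>dual_freq n 1\<bar>) \<le> H n" if "n \<ge> 1" for n
  proof -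
    have "\<bar>x n\<bar> * (1 + \<bar>dual_freq n 1\<bar>) \<le> \<bar>x n\<bar> * (C * real n powr \<mu>)"
      using C(2)[of 1 n] that by (intro mult_left_mono) auto
    also have "\<dots> \<le> ?a * (\<bar>x n\<bar> * (C * real n powr \<mu>))"
      using C by (simp add: mult_le_cancel_right1 mult_nonneg_nonneg algebra_simps)
    finally show ?thesis by (simp add: H_def mult_ac)
  qed
  have D: "0 \<le> (x n)\<^sup>2 * D n" "(x n)\<^sup>2 * D n \<le> E n" for n
  proof -
    show "0 \<le> (x n)\<^sup>2 * D n" unfolding D_def by (intro mult_nonneg_nonneg sum_nonneg) (auto simp: EYY_nonneg)
    have "(x n)\<^sup>2 * D n = (\<Sum>k\<in>{1..<n}. (freq_drift (x n) (x n * dual_freq n (Suc k)))\<^sup>2 * EYY k / (W k)\<^sup>2)"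
      unfolding D_def sum_distrib_left
      by (intro sum.cong refl) (simp add: freq_drift_def power_divide power2_eq_square algebra_simps)
    also have "\<dots> \<le> (\<Sum>k\<in>{1..<n}. step_error n (x n) k)"
    proof (intro sum_mono)
      fix k
      let ?h = "freq_bound (x n) (x n * dual_freq n (Suc k))"
      have "(freq_drift (x n) (x n * dual_freq n (Suc k)))\<^sup>2 \<le> ?h\<^sup>2"
        using power_mono[OF freq_drift_le_freq_bound, of "x n" "x n * dual_freq n (Suc k)" 2] by simp
      then have "(freq_drift (x n) (x n * dual_freq n (Suc k)))\<^sup>2 * EYY k / (W k)\<^sup>2 \<le> ?h\<^sup>2 * EYY k / (W k)\<^sup>2"
        by (intro divide_right_mono mult_right_mono EYY_nonneg) auto
      moreover have "0 \<le> ?h ^ 3" using fb0 by simp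
      ultimately show "(freq_drift (x n) (x n * dual_freq n (Suc k)))\<^sup>2 * EYY k / (W k)\<^sup>2 \<le> step_error n (x n) k"
        unfolding step_error_def by linarith
    qed
    also have "\<dots> \<le> E n" by (rule errsum)
    finally show "(x n)\<^sup>2 * D n \<le> E n" .
  qed
  \<comment> \<open>By the decomposition of the variance, \<open>x\<^sup>2 V = x\<^sup>2 E X\<^sup>2 - x\<^sup>2 (1 + b)\<^sup>2 + x\<^sup>2 D\<close>; only the first term survives.\<close>
  have xD: "(\<lambda>n. (x n)\<^sup>2 * D n) \<longlonglongrightarrow> 0"
    by (rule tendsto_sandwich[OF _ _ tendsto_const E]) (use D in auto)
  have xb: "(\<lambda>n. (x n)\<^sup>2 * (1 + dual_freq n 1)\<^sup>2) \<longlonglongrightarrow> 0"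
  proof (rule tendsto_sandwich[OF _ _ tendsto_const])
    show "eventually (\<lambda>n. 0 \<le> (x n)\<^sup>2 * (1 + dual_freq n 1)\<^sup>2) sequentially" by simp
    show "(\<lambda>n. (H n)\<^sup>2) \<longlonglongrightarrow> 0" using tendsto_power[OF H, of 2] by simp
    show "eventually (\<lambda>n. (x n)\<^sup>2 * (1 + dual_freq n 1)\<^sup>2 \<le> (H n)\<^sup>2) sequentially"
    proof (rule eventually_sequentiallyI[of 1])
      fix n :: nat assume n: "n \<ge> 1"
      have "\<bar>x n * (1 + dual_freq n 1)\<bar> \<le> \<bar>x n\<bar> * (1 + \<bar>dual_freq n 1\<bar>)" unfolding abs_mult by (intro mult_left_mono) auto
      also have "\<dots> \<le> H n" by (rule b1[OF n])
      finally have "\<bar>x n * (1 + dual_freq n 1)\<bar>\<^sup>2 \<le> (H n)\<^sup>2" by (intro power_mono) auto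
      then show "(x n)\<^sup>2 * (1 + dual_freq n 1)\<^sup>2 \<le> (H n)\<^sup>2" by (simp add: power_mult_distrib)
    qed
  qed
  have "(\<lambda>n. t\<^sup>2 * (EXX n / G n)) \<longlonglongrightarrow> t\<^sup>2 * s2" by (intro tendsto_intros zG)
  moreover have "eventually (\<lambda>n. t\<^sup>2 * (EXX n / G n) = (x n)\<^sup>2 * EXX n) sequentially"
    using G by eventually_elim (simp add: x_def power_divide)
  ultimately have xz: "(\<lambda>n. (x n)\<^sup>2 * EXX n) \<longlonglongrightarrow> t\<^sup>2 * s2" by (rule Lim_transform_eventually)
  have "(\<lambda>n. (x n)\<^sup>2 * EXX n - (x n)\<^sup>2 * (1 + dual_freq n 1)\<^sup>2 + (x n)\<^sup>2 * D n) \<longlonglongrightarrow> t\<^sup>2 * s2 - 0 + 0"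
    by (intro tendsto_intros xz xb xD)
  moreover have "eventually (\<lambda>n. (x n)\<^sup>2 * EXX n - (x n)\<^sup>2 * (1 + dual_freq n 1)\<^sup>2 + (x n)\<^sup>2 * D n = (x n)\<^sup>2 * V n) sequentially"
  proof (rule eventually_sequentiallyI[of 1])
    fix n :: nat assume n: "n \<ge> 1"
    have z: "EXX n = (1 + dual_freq n 1)\<^sup>2 + (V n - D n)"
      using variance_decomposition[of 1 n] n moments_1
      unfolding V_def D_def by (simp add: sum_subtractf power2_eq_square algebra_simps)
    show "(x n)\<^sup>2 * EXX n - (x n)\<^sup>2 * (1 + dual_freq n 1)\<^sup>2 + (x n)\<^sup>2 * D n = (x n)\<^sup>2 * V n"
      unfolding z by (simp add: algebra_simps)
  qed
  ultimately have xV: "(\<lambda>n. (x n)\<^sup>2 * V n) \<longlonglongrightarrow> t\<^sup>2 * s2" by (simp add: tendsto_cong)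
  have "(\<lambda>n. exp (- ((x n)\<^sup>2 * V n) / 2)) \<longlonglongrightarrow> exp (- (t\<^sup>2 * s2) / 2)"
    by (intro tendsto_exp tendsto_divide tendsto_minus xV tendsto_const) simp
  moreover have "(\<lambda>n. char_XY 1 (x n) (x n * dual_freq n 1)) \<longlonglongrightarrow> 1"
  proof (rule LIM_zero_cancel, rule Lim_null_comparison[OF _ H], rule eventually_sequentiallyI[of 1])
    fix n :: nat assume n: "n \<ge> 1"
    have int: "integrable M (\<lambda>\<omega>. cis (x n * X 1 \<omega> + x n * dual_freq n 1 * Y 1 \<omega>))"
      by (rule integrable_XY[of "\<lambda>a c. cis (x n * a + x n * dual_freq n 1 * c)"])
    let ?f = "\<lambda>\<omega>. norm (cis (x n * X 1 \<omega> + x n * dual_freq n 1 * Y 1 \<omega>) - 1)"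
    have int2: "integrable M (\<lambda>\<omega>. ?f \<omega>)"
      by (rule integrable_XY[of "\<lambda>a c. norm (cis (x n * a + x n * dual_freq n 1 * c) - 1)"])
    have "char_XY 1 (x n) (x n * dual_freq n 1) - 1 = expectation (\<lambda>\<omega>. cis (x n * X 1 \<omega> + x n * dual_freq n 1 * Y 1 \<omega>) - 1)"
      unfolding char_XY_def using int by (simp add: prob_space)
    then have "norm (char_XY 1 (x n) (x n * dual_freq n 1) - 1) \<le> expectation (\<lambda>\<omega>. ?f \<omega>)"
      by (simp only: integral_norm_bound)
    also have "\<dots> \<le> expectation (\<lambda>\<omega>. H n)"
    proof (rule integral_mono[OF int2])
      fix \<omega> assume \<omega>: "\<omega> \<in> space M"
      have "?f \<omega> \<le> \<bar>x n * ((1 + dual_freq n 1) * root_sign \<sigma> \<omega>)\<bar>"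
        using cis_minus_one[of "x n * X 1 \<omega> + x n * dual_freq n 1 * Y 1 \<omega>"] unfolding XY_1[OF \<omega>] by (simp add: algebra_simps)
      also have "\<dots> = \<bar>x n\<bar> * \<bar>1 + dual_freq n 1\<bar>" by (simp add: abs_mult root_sign_def)
      also have "\<dots> \<le> \<bar>x n\<bar> * (1 + \<bar>dual_freq n 1\<bar>)" by (intro mult_left_mono) auto
      also have "\<dots> \<le> H n" by (rule b1[OF n])
      finally show "?f \<omega> \<le> H n" .
    qed simp
    finally show "norm (char_XY 1 (x n) (x n * dual_freq n 1) - 1) \<le> H n" by (simp add: prob_space)
  qed
  ultimately have main: "(\<lambda>n. exp (- ((x n)\<^sup>2 * V n) / 2) *\<^sub>R char_XY 1 (x n) (x n * dual_freq n 1)) \<longlonglongrightarrow> exp (- (t\<^sup>2 * s2) / 2) *\<^sub>R 1"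
    by (rule tendsto_scaleR)
  let ?d = "\<lambda>n. char_XY n (x n) 0 - exp (- ((x n)\<^sup>2 * V n) / 2) *\<^sub>R char_XY 1 (x n) (x n * dual_freq n 1)"
  have "(\<lambda>n. ?d n) \<longlonglongrightarrow> 0"
  proof (rule Lim_null_comparison, rule eventually_sequentiallyI[of 1])
    show "(\<lambda>n. 8 * ?a * E n) \<longlonglongrightarrow> 0" using tendsto_mult[OF tendsto_const E, of "8 * ?a"] by simp
    fix n :: nat assume n: "n \<ge> 1"
    have "norm (?d n) \<le>
       8 * ?a * (\<Sum>k\<in>{1..<n}. step_error n (x n) k)"
      using char_XY_telescope[of 1 n "x n"] n by (simp add: V_def)
    also have "\<dots> \<le> 8 * ?a * E n" by (intro mult_left_mono errsum) auto
    finally show "norm (?d n) \<le> 8 * ?a * E n" .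
  qed
  from tendsto_add[OF this main] have "(\<lambda>n. char_XY n (x n) 0) \<longlonglongrightarrow> exp (- (t\<^sup>2 * s2) / 2) *\<^sub>R 1" by simp
  then show ?thesis by (simp add: x_def scaleR_conv_of_real)
qed

lemma central_limit:
  fixes G :: "nat \<Rightarrow> real"
  assumes C: "C > 0" "\<And>n k. 1 \<le> k \<Longrightarrow> k \<le> n \<Longrightarrow> 1 + \<bar>dual_freq n k\<bar> \<le> C * (real n / real k) powr \<mu>"
    and \<mu>: "\<mu> > 1 / 3"
    and \<theta>: "1 < \<theta>" "2 * drift / (1 + \<alpha>) < \<theta>" "\<theta> < 1 + 2 * \<mu>"
    and G: "eventually (\<lambda>n. G n > 0) sequentially" and G\<mu>: "(\<lambda>n. real n powr (2 * \<mu>) / G n) \<longlonglongrightarrow> 0"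
    and zG: "(\<lambda>n. EXX n / G n) \<longlonglongrightarrow> 4 * c"
  shows "conv_to_centred_normal M
    (\<lambda>n \<omega>. (1 / sqrt (G n)) *\<^sub>R (RB \<sigma> n \<omega> - real n *\<^sub>R vector [1 / 2, 1 / 2])) (c *\<^sub>R alternating_matrix)"
proof -
  define T where "T n \<omega> = X n \<omega> / sqrt (G n) / 2" for n \<omega>
  define N where "N = distr std_normal_distribution borel (\<lambda>x. sqrt c * x)"
  have [measurable]: "T n \<in> borel_measurable M" for n unfolding T_def by measurable
  have "eventually (\<lambda>n. 0 \<le> EXX n / G n) sequentially"
    using G by eventually_elim (simp add: EXX_nonneg)
  then have "0 \<le> 4 * c" by (intro tendsto_lowerbound[OF zG]) auto
  then have c: "c \<ge> 0" by simp
  interpret std: real_distribution std_normal_distribution by (rule real_dist_normal_dist)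
  have N: "real_distribution N"
    unfolding N_def by (intro real_distribution.intro real_distribution_axioms.intro std.prob_space_distr) auto
  have weak: "weak_conv_m (\<lambda>n. distr M borel (T n)) N"
  proof (rule levy_continuity[OF _ N])
    show "real_distribution (distr M borel (T n))" for n
      by (intro real_distribution.intro real_distribution_axioms.intro prob_space_distr) auto
    fix t
    have "char (distr M borel (T n)) t = char_XY n (t / 2 / sqrt (G n)) 0" for n
      unfolding char_def char_XY_def by (subst integral_distr) (auto simp: T_def cis_conv_exp field_simps)
    moreover have "char N t = char std_normal_distribution (sqrt c * t)"
      unfolding char_def N_def by (subst integral_distr) (auto simp: mult_ac)
    then have "char N t = exp (- ((t / 2)\<^sup>2 * (4 * c)) / 2)"
      using c by (simp add: char_std_normal_distribution power_mult_distrib power_divide mult.commute)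
    ultimately show "(\<lambda>n. char (distr M borel (T n)) t) \<longlonglongrightarrow> char N t"
      using char_X_tendsto[OF C \<mu> \<theta> G G\<mu> zG, of "t / 2"] by simp
  qed
  have "conv_in_distribution M (\<lambda>n \<omega>. T n \<omega> *\<^sub>R (vector [1, - 1] :: real^2)) (distr N borel (\<lambda>x. x *\<^sub>R vector [1, - 1]))"
    by (rule conv_in_distribution_line[OF _ _ weak N]) (auto intro: prob_space_axioms)
  moreover have "distr N borel (\<lambda>x. x *\<^sub>R (vector [1, - 1] :: real^2)) =
      distr std_normal_distribution borel (\<lambda>x. (sqrt c * x) *\<^sub>R vector [1, - 1])"
    unfolding N_def by (subst distr_distr) (auto simp: comp_def)
  moreover have "(1 / sqrt (G n)) *\<^sub>R (RB \<sigma> n \<omega> - real n *\<^sub>R vector [1 / 2, 1 / 2]) = T n \<omega> *\<^sub>R vector [1, - 1]" for n \<omega>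
    by (simp add: RB_eq T_def)
  ultimately show ?thesis
    using centred_normal_alternating[OF c] unfolding conv_to_centred_normal_def by auto
qed

lemma gaussian_linear:
  assumes p: "p < (3 - \<alpha>) / 4 \<or> p = 1 / 2"
  shows "conv_to_centred_normal M
    (\<lambda>n \<omega>. (1 / sqrt (real n)) *\<^sub>R (RB \<sigma> n \<omega> - real n *\<^sub>R vector [1 / 2, 1 / 2]))
    (c_coeff \<alpha> p *\<^sub>R alternating_matrix)"
proof -
  define l where "l = drift / (1 + \<alpha>)"
  have l1: "l < 1" using p one_plus_alpha by (auto simp: l_def drift_def field_simps)
  define \<theta> where "\<theta> = max 1 (2 * l) / 2 + 1"
  have \<theta>: "1 < \<theta>" "2 * drift / (1 + \<alpha>) < \<theta>" "\<theta> < 2"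
  proof -
    have "1 < \<theta>" "2 * l < \<theta>" "\<theta> < 2" using l1 by (auto simp: \<theta>_def max_def)
    then show "1 < \<theta>" "2 * drift / (1 + \<alpha>) < \<theta>" "\<theta> < 2" by (auto simp: l_def)
  qed
  \<comment> \<open>The first entry is dropped for \<open>p = 1/2\<close>, where \<open>l\<close> may exceed \<open>1/2\<close>; the entry \<open>\<theta> / 4\<close> gives \<open>\<theta> < 1 + 2 \<mu>\<close>.\<close>
  define \<mu> where "\<mu> = max (if p = 1 / 2 then 0 else l) (max (2 / 5) (\<theta> / 4))"
  have "p \<noteq> 1 / 2 \<Longrightarrow> l < 1 / 2" using p one_plus_alpha by (auto simp: l_def drift_def field_simps)
  then have \<mu>2: "\<mu> < 1 / 2" using \<theta> by (auto simp: \<mu>_def)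
  have \<mu>: "\<mu> > 1 / 3" "\<theta> < 1 + 2 * \<mu>" using \<theta> by (auto simp: \<mu>_def max_def)
  obtain C where C: "C > 0" "\<And>n k. 1 \<le> k \<Longrightarrow> k \<le> n \<Longrightarrow> 1 + \<bar>dual_freq n k\<bar> \<le> C * (real n / real k) powr \<mu>"
  proof (cases "p = 1 / 2")
    case True
    have b0: "dual_freq n k = 0" for n k unfolding dual_freq_def using True by simp
    have "1 + \<bar>dual_freq n k\<bar> \<le> 1 * (real n / real k) powr \<mu>" if "1 \<le> k" "k \<le> n" for n k
      unfolding b0 using that \<mu> by (simp add: ge_one_powr_ge_zero)
    then show thesis by (intro that[of 1]) auto
  next
    case False
    then show thesis using dual_freq_bound[of \<mu>] that \<mu> by (auto simp: \<mu>_def l_def)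
  qed
  show ?thesis
  proof (rule central_limit[OF C \<mu>(1) \<theta>(1,2) \<mu>(2)])
    show "eventually (\<lambda>n. real n > 0) sequentially" by real_asymp
    show "(\<lambda>n. real n powr (2 * \<mu>) / real n) \<longlonglongrightarrow> 0" using \<mu>2 by real_asymp
    show "(\<lambda>n. EXX n / real n) \<longlonglongrightarrow> 4 * c_coeff \<alpha> p" by (rule EXX_linear[OF p])
  qed
qed

lemma gaussian_critical:
  assumes p: "p = (3 - \<alpha>) / 4"
  shows "conv_to_centred_normal M
    (\<lambda>n \<omega>. (1 / sqrt (real n * ln (real n))) *\<^sub>R (RB \<sigma> n \<omega> - real n *\<^sub>R vector [1 / 2, 1 / 2]))
    (((\<alpha> - 1)\<^sup>2 / (4 * (1 + \<alpha>))) *\<^sub>R alternating_matrix)"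
proof -
  have l: "drift / (1 + \<alpha>) = 1 / 2" using p one_plus_alpha by (simp add: drift_def field_simps)
  obtain C where C: "C > 0" "\<And>n k. 1 \<le> k \<Longrightarrow> k \<le> n \<Longrightarrow> 1 + \<bar>dual_freq n k\<bar> \<le> C * (real n / real k) powr (1 / 2)"
    using dual_freq_bound[of "1 / 2"] l by auto
  show ?thesis
  proof (rule central_limit[OF C, where \<theta> = "3 / 2"])
    show "eventually (\<lambda>n. real n * ln (real n) > 0) sequentially" by real_asymp
    show "(\<lambda>n. real n powr (2 * (1 / 2)) / (real n * ln (real n))) \<longlonglongrightarrow> 0" by real_asymp
    have "4 * ((\<alpha> - 1)\<^sup>2 / (4 * (1 + \<alpha>))) = (\<alpha> - 1)\<^sup>2 / (1 + \<alpha>)"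
    proof -
      have "4 * (r / (4 * s)) = r / s" for r s :: real by simp
      then show ?thesis .
    qed
    then show "(\<lambda>n. EXX n / (real n * ln (real n))) \<longlonglongrightarrow> 4 * ((\<alpha> - 1)\<^sup>2 / (4 * (1 + \<alpha>)))"
      using EXX_linear_log[OF p] by simp
    show "2 * drift / (1 + \<alpha>) < 3 / 2" using l by simp
  qed auto
qed

end

section \<open>Limits in mean square and in mean\<close>

lemma (in prob_space) expectation_abs_le_sqrt:
  fixes f :: "'a \<Rightarrow> real"
  assumes "f \<in> borel_measurable M" "integrable M (\<lambda>x. (f x)\<^sup>2)"
  shows "expectation (\<lambda>x. \<bar>f x\<bar>) \<le> sqrt (expectation (\<lambda>x. (f x)\<^sup>2))"
proof (rule real_le_rsqrt)
  have "integrable M (\<lambda>x. \<bar>f x\<bar>)" using square_integrable_imp_integrable[OF assms] by simp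
  then have "variance (\<lambda>x. \<bar>f x\<bar>) = expectation (\<lambda>x. \<bar>f x\<bar>\<^sup>2) - (expectation (\<lambda>x. \<bar>f x\<bar>))\<^sup>2"
    by (rule variance_eq) (use assms in simp)
  with variance_positive[of "\<lambda>x. \<bar>f x\<bar>"] show "(expectation (\<lambda>x. \<bar>f x\<bar>))\<^sup>2 \<le> expectation (\<lambda>x. (f x)\<^sup>2)"
    by simp
qed

lemma square_diff_bound: "(a - b)\<^sup>2 \<le> 2 * a\<^sup>2 + 2 * b\<^sup>2" for a b :: real
  using zero_le_power2[of "a + b"] by (simp add: power2_eq_square algebra_simps)

lemma integrable_square_diff:
  fixes f g :: "'a \<Rightarrow> real"
  assumes [measurable]: "f \<in> borel_measurable M" "g \<in> borel_measurable M"
    and "integrable M (\<lambda>x. (f x)\<^sup>2)" "integrable M (\<lambda>x. (g x)\<^sup>2)"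
  shows "integrable M (\<lambda>x. (f x - g x)\<^sup>2)"
proof (rule Bochner_Integration.integrable_bound)
  show "integrable M (\<lambda>x. 2 * (f x)\<^sup>2 + 2 * (g x)\<^sup>2)" using assms by simp
qed (use square_diff_bound in auto)

text \<open>
  Young's inequality.  Letting the difference tend to zero first and \<open>\<eta>\<close> afterwards, it transfers second moments to limits
  in mean square.
\<close>
lemma expectation_square_le:
  fixes f g :: "'a \<Rightarrow> real"
  assumes [measurable]: "f \<in> borel_measurable M" "g \<in> borel_measurable M"
    and f: "integrable M (\<lambda>x. (f x)\<^sup>2)" and g: "integrable M (\<lambda>x. (g x)\<^sup>2)" and \<eta>: "\<eta> > 0"
  shows "(\<integral>x. (f x)\<^sup>2 \<partial>M) \<le> (1 + \<eta>) * (\<integral>x. (g x)\<^sup>2 \<partial>M) + (1 + 1 / \<eta>) * (\<integral>x. (f x - g x)\<^sup>2 \<partial>M)"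
proof -
  have le: "a\<^sup>2 \<le> (1 + \<eta>) * b\<^sup>2 + (1 + 1 / \<eta>) * (a - b)\<^sup>2" for a b :: real
  proof -
    define d where "d = a - b"
    have "0 \<le> (\<eta> * b - d)\<^sup>2 / \<eta>" using \<eta> by simp
    also have "\<dots> = \<eta> * b\<^sup>2 - 2 * b * d + d\<^sup>2 / \<eta>"
      using \<eta> by (simp add: power2_eq_square field_simps)
    finally have "2 * b * d \<le> \<eta> * b\<^sup>2 + d\<^sup>2 / \<eta>" by simp
    moreover have "a\<^sup>2 = b\<^sup>2 + 2 * b * d + d\<^sup>2" by (simp add: d_def power2_eq_square algebra_simps)
    ultimately show ?thesis unfolding d_def[symmetric] by (simp add: distrib_right)
  qed
  have fg: "integrable M (\<lambda>x. (f x - g x)\<^sup>2)" by (rule integrable_square_diff) (use f g in auto)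
  have "(\<integral>x. (f x)\<^sup>2 \<partial>M) \<le> (\<integral>x. (1 + \<eta>) * (g x)\<^sup>2 + (1 + 1 / \<eta>) * (f x - g x)\<^sup>2 \<partial>M)"
    by (rule integral_mono) (use f g fg le in auto)
  also have "\<dots> = (1 + \<eta>) * (\<integral>x. (g x)\<^sup>2 \<partial>M) + (1 + 1 / \<eta>) * (\<integral>x. (f x - g x)\<^sup>2 \<partial>M)"
    using g fg by (subst Bochner_Integration.integral_add) auto
  finally show ?thesis .
qed

lemma le_if_le_mult_one_plus:
  fixes x y :: real
  assumes "\<And>\<eta>. \<eta> > 0 \<Longrightarrow> x \<le> (1 + \<eta>) * y" "y \<ge> 0"
  shows "x \<le> y"
proof (rule field_le_epsilon)
  fix e :: real assume "e > 0"
  then have "x \<le> (1 + e / (y + 1)) * y" using assms(2) by (intro assms(1)) auto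
  also have "\<dots> = y + e * (y / (y + 1))" by (simp add: distrib_right)
  also have "\<dots> \<le> y + e * 1" using \<open>e > 0\<close> assms(2) by (intro add_left_mono mult_left_mono) auto
  finally show "x \<le> y + e" by simp
qed

text \<open>
  Convergence of \<open>q\<close> makes \<open>N\<close> a Cauchy sequence in mean square, hence in mean, so a subsequence converges almost surely.
  Fatou's lemma bounds the distance of its limit to \<open>N n\<close> by \<open>L - q n\<close>, which also identifies the second moment.
\<close>
lemma (in prob_space) orthogonal_increments_L2_limit:
  fixes N :: "nat \<Rightarrow> 'a \<Rightarrow> real" and q :: "nat \<Rightarrow> real"
  assumes N [measurable]: "\<And>n. N n \<in> borel_measurable M"
    and int: "\<And>n. integrable M (\<lambda>x. (N n x)\<^sup>2)"
    and q: "\<And>n. n \<ge> 1 \<Longrightarrow> expectation (\<lambda>x. (N n x)\<^sup>2) = q n"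
    and incr: "\<And>m n. 1 \<le> m \<Longrightarrow> m \<le> n \<Longrightarrow> expectation (\<lambda>x. (N n x - N m x)\<^sup>2) = q n - q m"
    and L: "q \<longlonglongrightarrow> L"
  obtains Z where "Z \<in> borel_measurable M" "integrable M (\<lambda>x. (Z x)\<^sup>2)" "expectation (\<lambda>x. (Z x)\<^sup>2) = L"
    "(\<lambda>n. expectation (\<lambda>x. \<bar>N n x - Z x\<bar>)) \<longlonglongrightarrow> 0"
proof -
  have int1: "integrable M (N n)" for n by (rule square_integrable_imp_integrable[OF N int])
  have intd: "integrable M (\<lambda>x. (N n x - N m x)\<^sup>2)" for m n
    by (rule integrable_square_diff[OF N N int int])
  have incr': "expectation (\<lambda>x. (N i x - N j x)\<^sup>2) = \<bar>q i - q j\<bar>" if "i \<ge> 1" "j \<ge> 1" for i j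
  proof (cases "j \<le> i")
    case True
    have "0 \<le> expectation (\<lambda>x. (N i x - N j x)\<^sup>2)" by simp
    with incr[of j i] True that show ?thesis by simp
  next
    case False
    have "0 \<le> expectation (\<lambda>x. (N j x - N i x)\<^sup>2)" by simp
    with incr[of i j] False that show ?thesis by (simp add: power2_commute)
  qed
  have cauchy: "\<exists>K. \<forall>i\<ge>K. \<forall>j\<ge>K. (\<integral>x. norm (N i x - N j x) \<partial>M) < e" if e: "e > 0" for e :: real
  proof -
    obtain K where K: "\<And>i j. i \<ge> K \<Longrightarrow> j \<ge> K \<Longrightarrow> \<bar>q i - q j\<bar> < e\<^sup>2"
      using LIMSEQ_imp_Cauchy[OF L] e unfolding Cauchy_def dist_real_def by (meson zero_less_power)
    have "(\<integral>x. norm (N i x - N j x) \<partial>M) < e" if "i \<ge> max 1 K" "j \<ge> max 1 K" for i j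
    proof -
      have "(\<integral>x. norm (N i x - N j x) \<partial>M) \<le> sqrt \<bar>q i - q j\<bar>"
        using expectation_abs_le_sqrt[of "\<lambda>x. N i x - N j x"] intd[of i j] incr'[of i j] that by simp
      also have "\<dots> < sqrt (e\<^sup>2)" using K[of i j] that by (intro real_sqrt_less_mono) auto
      finally show ?thesis using e by simp
    qed
    then show ?thesis by blast
  qed
  obtain r where r: "strict_mono r" "AE x in M. Cauchy (\<lambda>i. N (r i) x)"
    using cauchy_L1_AE_cauchy_subseq[where s = N and M = M, OF int1 cauchy] by blast
  define Z where "Z x = lim (\<lambda>i. N (r i) x)" for x
  have [measurable]: "Z \<in> borel_measurable M" unfolding Z_def by measurable
  have conv: "AE x in M. (\<lambda>i. N (r i) x) \<longlonglongrightarrow> Z x"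
    using r(2) by eventually_elim (simp add: Z_def Cauchy_convergent_iff convergent_LIMSEQ_iff)
  have fatou: "(\<integral>\<^sup>+x. ennreal ((Z x - N n x)\<^sup>2) \<partial>M) \<le> ennreal (L - q n)" if n: "n \<ge> 1" for n
  proof -
    have "AE x in M. ennreal ((Z x - N n x)\<^sup>2) = liminf (\<lambda>i. ennreal ((N (r i) x - N n x)\<^sup>2))"
      using conv
    proof eventually_elim
      case (elim x)
      have "(\<lambda>i. ennreal ((N (r i) x - N n x)\<^sup>2)) \<longlonglongrightarrow> ennreal ((Z x - N n x)\<^sup>2)"
        by (intro tendsto_intros elim tendsto_ennrealI)
      then show ?case by (rule lim_imp_Liminf[OF trivial_limit_sequentially, symmetric])
    qed
    then have "(\<integral>\<^sup>+x. ennreal ((Z x - N n x)\<^sup>2) \<partial>M) = (\<integral>\<^sup>+x. liminf (\<lambda>i. ennreal ((N (r i) x - N n x)\<^sup>2)) \<partial>M)"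
      by (rule nn_integral_cong_AE)
    also have "\<dots> \<le> liminf (\<lambda>i. \<integral>\<^sup>+x. ennreal ((N (r i) x - N n x)\<^sup>2) \<partial>M)"
      by (rule nn_integral_liminf) measurable
    also have "\<dots> = ennreal (L - q n)"
    proof (rule lim_imp_Liminf)
      have "(\<lambda>i. ennreal (q (r i) - q n)) \<longlonglongrightarrow> ennreal (L - q n)"
        by (intro tendsto_ennrealI tendsto_intros LIMSEQ_subseq_LIMSEQ[OF L r(1), unfolded comp_def])
      moreover have "eventually (\<lambda>i. ennreal (q (r i) - q n) = (\<integral>\<^sup>+x. ennreal ((N (r i) x - N n x)\<^sup>2) \<partial>M)) sequentially"
      proof (rule eventually_sequentiallyI[of n])
        fix i assume "n \<le> i"
        then have "n \<le> r i" using seq_suble[OF r(1), of i] by simp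
        have "(\<integral>\<^sup>+x. ennreal ((N (r i) x - N n x)\<^sup>2) \<partial>M) = ennreal (expectation (\<lambda>x. (N (r i) x - N n x)\<^sup>2))"
          by (rule nn_integral_eq_integral[OF intd]) simp
        then show "ennreal (q (r i) - q n) = (\<integral>\<^sup>+x. ennreal ((N (r i) x - N n x)\<^sup>2) \<partial>M)"
          using incr[OF n \<open>n \<le> r i\<close>] by simp
      qed
      ultimately show "(\<lambda>i. \<integral>\<^sup>+x. ennreal ((N (r i) x - N n x)\<^sup>2) \<partial>M) \<longlonglongrightarrow> ennreal (L - q n)"
        by (rule Lim_transform_eventually)
    qed simp
    finally show ?thesis .
  qed
  have qL: "q n \<le> L" if n: "n \<ge> 1" for n
  proof (rule LIMSEQ_le_const[OF L], intro exI allI impI)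
    fix m assume "n \<le> m"
    have "0 \<le> expectation (\<lambda>x. (N m x - N n x)\<^sup>2)" by simp
    then show "q n \<le> q m" using incr[OF n \<open>n \<le> m\<close>] by simp
  qed
  have ZN: "integrable M (\<lambda>x. (Z x - N n x)\<^sup>2)" if "n \<ge> 1" for n
    using fatou[OF that] by (intro integrableI_bounded) (auto simp: le_less_trans)
  have ZN_le: "expectation (\<lambda>x. (Z x - N n x)\<^sup>2) \<le> L - q n" if n: "n \<ge> 1" for n
  proof -
    have "ennreal (expectation (\<lambda>x. (Z x - N n x)\<^sup>2)) \<le> ennreal (L - q n)"
      using fatou[OF n] by (subst nn_integral_eq_integral[OF ZN[OF n], symmetric]) auto
    then show ?thesis using qL[OF n] by (simp add: ennreal_le_iff)
  qed
  have Z2: "integrable M (\<lambda>x. (Z x)\<^sup>2)"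
  proof -
    have "integrable M (\<lambda>x. ((Z x - N 1 x) - (- N 1 x))\<^sup>2)"
      by (rule integrable_square_diff) (use ZN[of 1] int[of 1] in auto)
    then show ?thesis by simp
  qed
  have e: "(\<lambda>n. L - q n) \<longlonglongrightarrow> 0" using tendsto_diff[OF tendsto_const L, of L] by simp
  have EN: "expectation (\<lambda>x. (Z x)\<^sup>2) \<ge> 0" "L \<ge> 0"
    using qL[of 1] q[of 1] integral_nonneg_AE[of "\<lambda>x. (N 1 x)\<^sup>2" M] by auto
  have L2: "expectation (\<lambda>x. (Z x)\<^sup>2) = L"
  proof (rule antisym)
    show "expectation (\<lambda>x. (Z x)\<^sup>2) \<le> L"
    proof (rule le_if_le_mult_one_plus[OF _ EN(2)])
      fix \<eta> :: real assume \<eta>: "\<eta> > 0"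
      have "(\<lambda>n. (1 + \<eta>) * q n + (1 + 1 / \<eta>) * (L - q n)) \<longlonglongrightarrow> (1 + \<eta>) * L + (1 + 1 / \<eta>) * 0"
        by (intro tendsto_intros L e)
      moreover have "expectation (\<lambda>x. (Z x)\<^sup>2) \<le> (1 + \<eta>) * q n + (1 + 1 / \<eta>) * (L - q n)" if n: "n \<ge> 1" for n
      proof -
        have "expectation (\<lambda>x. (Z x)\<^sup>2) \<le> (1 + \<eta>) * q n + (1 + 1 / \<eta>) * expectation (\<lambda>x. (Z x - N n x)\<^sup>2)"
          using expectation_square_le[OF _ N Z2 int \<eta>, of n] q[OF n] by simp
        also have "\<dots> \<le> (1 + \<eta>) * q n + (1 + 1 / \<eta>) * (L - q n)"
          using ZN_le[OF n] \<eta> by (intro add_left_mono mult_left_mono) auto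
        finally show ?thesis .
      qed
      ultimately show "expectation (\<lambda>x. (Z x)\<^sup>2) \<le> (1 + \<eta>) * L" by (intro LIMSEQ_le_const) auto
    qed
    show "L \<le> expectation (\<lambda>x. (Z x)\<^sup>2)"
    proof (rule le_if_le_mult_one_plus[OF _ EN(1)])
      fix \<eta> :: real assume \<eta>: "\<eta> > 0"
      let ?E = "expectation (\<lambda>x. (Z x)\<^sup>2)"
      have "(\<lambda>n. (1 + \<eta>) * ?E + (1 + 1 / \<eta>) * (L - q n)) \<longlonglongrightarrow> (1 + \<eta>) * ?E + (1 + 1 / \<eta>) * 0"
        by (intro tendsto_intros e)
      moreover have "q n \<le> (1 + \<eta>) * ?E + (1 + 1 / \<eta>) * (L - q n)" if n: "n \<ge> 1" for n
      proof -
        have "q n \<le> (1 + \<eta>) * ?E + (1 + 1 / \<eta>) * expectation (\<lambda>x. (N n x - Z x)\<^sup>2)"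
          using expectation_square_le[OF N _ int Z2 \<eta>, of n] q[OF n] by simp
        also have "\<dots> \<le> (1 + \<eta>) * ?E + (1 + 1 / \<eta>) * (L - q n)"
          using ZN_le[OF n] \<eta> by (intro add_left_mono mult_left_mono) (auto simp: power2_commute)
        finally show ?thesis .
      qed
      ultimately show "L \<le> (1 + \<eta>) * ?E" by (intro LIMSEQ_le[OF L]) auto
    qed
  qed
  have "(\<lambda>n. expectation (\<lambda>x. \<bar>N n x - Z x\<bar>)) \<longlonglongrightarrow> 0"
  proof (rule tendsto_sandwich[OF _ _ tendsto_const])
    show "(\<lambda>n. sqrt (L - q n)) \<longlonglongrightarrow> 0" using tendsto_real_sqrt[OF e] by simp
    show "eventually (\<lambda>n. expectation (\<lambda>x. \<bar>N n x - Z x\<bar>) \<le> sqrt (L - q n)) sequentially"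
    proof (rule eventually_sequentiallyI[of 1])
      fix n :: nat assume n: "n \<ge> 1"
      have "expectation (\<lambda>x. \<bar>Z x - N n x\<bar>) \<le> sqrt (expectation (\<lambda>x. (Z x - N n x)\<^sup>2))"
        by (rule expectation_abs_le_sqrt) (use ZN[OF n] in auto)
      also have "\<dots> \<le> sqrt (L - q n)" using ZN_le[OF n] by simp
      finally show "expectation (\<lambda>x. \<bar>N n x - Z x\<bar>) \<le> sqrt (L - q n)" by (simp add: abs_minus_commute)
    qed
  qed auto
  then show thesis using that[of Z] Z2 L2 by auto
qed

text \<open>Characteristic functions are Lipschitz in mean: those of \<open>T n\<close> and \<open>S\<close> at \<open>t\<close> differ by at most \<open>\<bar>t\<bar>\<close> times the mean distance.\<close>
lemma L1_imp_conv_in_distribution: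
  fixes v :: "real^'n" and T :: "nat \<Rightarrow> 'w \<Rightarrow> real"
  assumes M: "prob_space M" and T: "\<And>n. integrable M (T n)" and S: "integrable M S"
    and L1: "(\<lambda>n. \<integral>\<omega>. \<bar>T n \<omega> - S \<omega>\<bar> \<partial>M) \<longlonglongrightarrow> 0"
  shows "conv_in_distribution M (\<lambda>n \<omega>. T n \<omega> *\<^sub>R v) (distr M borel (\<lambda>\<omega>. S \<omega> *\<^sub>R v))"
proof -
  interpret prob_space M by fact
  have [measurable]: "T n \<in> borel_measurable M" "S \<in> borel_measurable M" for n using T S by auto
  have rd: "real_distribution (distr M borel f)" if "f \<in> borel_measurable M" for f
    using that by (intro real_distribution.intro real_distribution_axioms.intro prob_space_distr) auto
  have weak: "weak_conv_m (\<lambda>n. distr M borel (T n)) (distr M borel S)"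
  proof (rule levy_continuity)
    show "real_distribution (distr M borel (T n))" "real_distribution (distr M borel S)" for n
      by (intro rd; measurable)+
    fix t
    have char: "char (distr M borel f) t = expectation (\<lambda>\<omega>. cis (t * f \<omega>))" if [measurable]: "f \<in> borel_measurable M" for f
      unfolding char_def by (subst integral_distr) (auto simp: cis_conv_exp)
    have int: "integrable M (\<lambda>\<omega>. cis (t * f \<omega>))" if [measurable]: "f \<in> borel_measurable M" for f
      by (rule integrable_const_bound[where B = 1]) (auto simp: cis_conv_exp)
    let ?d = "\<lambda>n. char (distr M borel (T n)) t - char (distr M borel S) t"
    show "(\<lambda>n. char (distr M borel (T n)) t) \<longlonglongrightarrow> char (distr M borel S) t"
    proof (rule LIM_zero_cancel, rule Lim_null_comparison)
      show "(\<lambda>n. \<bar>t\<bar> * (\<integral>\<omega>. \<bar>T n \<omega> - S \<omega>\<bar> \<partial>M)) \<longlonglongrightarrow> 0" using tendsto_mult[OF tendsto_const L1, of "\<bar>t\<bar>"] by simp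
      have "norm (?d n) \<le> \<bar>t\<bar> * (\<integral>\<omega>. \<bar>T n \<omega> - S \<omega>\<bar> \<partial>M)" for n
      proof -
        have "?d n = expectation (\<lambda>\<omega>. cis (t * T n \<omega>) - cis (t * S \<omega>))"
          by (subst Bochner_Integration.integral_diff) (auto simp: char int)
        then have "norm (?d n) \<le> expectation (\<lambda>\<omega>. norm (cis (t * T n \<omega>) - cis (t * S \<omega>)))"
          by (simp only: integral_norm_bound)
        also have "\<dots> \<le> expectation (\<lambda>\<omega>. \<bar>t\<bar> * \<bar>T n \<omega> - S \<omega>\<bar>)"
        proof (rule integral_mono)
          show "integrable M (\<lambda>\<omega>. norm (cis (t * T n \<omega>) - cis (t * S \<omega>)))"
            by (intro integrable_norm Bochner_Integration.integrable_diff int) auto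
          show "integrable M (\<lambda>\<omega>. \<bar>t\<bar> * \<bar>T n \<omega> - S \<omega>\<bar>)" using T S by simp
          show "norm (cis (t * T n \<omega>) - cis (t * S \<omega>)) \<le> \<bar>t\<bar> * \<bar>T n \<omega> - S \<omega>\<bar>" for \<omega>
          proof -
            have "cis (t * T n \<omega>) - cis (t * S \<omega>) = cis (t * S \<omega>) * (cis (t * T n \<omega> - t * S \<omega>) - 1)"
              by (simp add: right_diff_distrib cis_mult)
            then have "norm (cis (t * T n \<omega>) - cis (t * S \<omega>)) = norm (cis (t * T n \<omega> - t * S \<omega>) - 1)"
              by (simp add: norm_mult)
            also have "\<dots> \<le> \<bar>t * T n \<omega> - t * S \<omega>\<bar>" by (rule cis_minus_one)
            also have "\<dots> = \<bar>t\<bar> * \<bar>T n \<omega> - S \<omega>\<bar>" by (simp add: right_diff_distrib[symmetric] abs_mult)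
            finally show ?thesis .
          qed
        qed
        finally show ?thesis by simp
      qed
      then show "eventually (\<lambda>n. norm (?d n) \<le>
          \<bar>t\<bar> * (\<integral>\<omega>. \<bar>T n \<omega> - S \<omega>\<bar> \<partial>M)) sequentially" by simp
    qed
  qed
  have "conv_in_distribution M (\<lambda>n \<omega>. T n \<omega> *\<^sub>R v) (distr (distr M borel S) borel (\<lambda>x. x *\<^sub>R v))"
    by (rule conv_in_distribution_line[OF M _ weak rd]) auto
  also have "distr (distr M borel S) borel (\<lambda>x. x *\<^sub>R v) = distr M borel (\<lambda>\<omega>. S \<omega> *\<^sub>R v)"
    by (subst distr_distr) (auto simp: comp_def)
  finally show ?thesis .
qed

text \<open>
  As \<open>W j\<close> is \<open>1 + \<alpha>\<close> times \<open>j - 1 + 1 / (1 + \<alpha>)\<close>, the product is a quotient of two Pochhammer symbols, and Gauss's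
  product for the Gamma function gives its growth.
\<close>
lemma growth_product_asymptotics:
  fixes \<alpha> \<delta> :: real
  assumes \<alpha>: "\<alpha> \<ge> -1/2" and \<delta>: "\<delta> \<ge> 0"
  shows "(\<lambda>n. (\<Prod>j\<in>{1..<n}. 1 + \<delta> / total_weight \<alpha> j) / real n powr (\<delta> / (1 + \<alpha>)))
    \<longlonglongrightarrow> Gamma (1 / (1 + \<alpha>)) / Gamma ((1 + \<delta>) / (1 + \<alpha>))"
proof -
  define s where "s = 1 / (1 + \<alpha>)"
  define s' where "s' = (1 + \<delta>) / (1 + \<alpha>)"
  have a: "1 + \<alpha> > 0" using \<alpha> by simp
  have s: "s > 0" "s' > 0" using a \<delta> by (auto simp: s_def s'_def)
  have diff: "s' - s = \<delta> / (1 + \<alpha>)" by (simp add: s_def s'_def diff_divide_distrib[symmetric])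
  have ph: "pochhammer x n > 0" if "x > 0" for x :: real and n
    using that by (rule pochhammer_pos)
  have prod: "(\<Prod>j\<in>{1..<Suc n}. 1 + \<delta> / total_weight \<alpha> j) = pochhammer s' n / pochhammer s n" for n
  proof (induction n)
    case (Suc n)
    have W: "total_weight \<alpha> (Suc n) = (1 + \<alpha>) * (s + real n)"
      using a by (simp add: total_weight_def s_def field_simps)
    have "1 + \<delta> / total_weight \<alpha> (Suc n) = (total_weight \<alpha> (Suc n) + \<delta>) / total_weight \<alpha> (Suc n)"
      using total_weight_pos[OF \<alpha>, of "Suc n"] by (simp add: field_simps)
    also have "total_weight \<alpha> (Suc n) + \<delta> = (1 + \<alpha>) * (s' + real n)"
      unfolding W using a by (simp add: s_def s'_def field_simps)
    also have "(1 + \<alpha>) * (s' + real n) / total_weight \<alpha> (Suc n) = (s' + real n) / (s + real n)"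
      unfolding W using a by simp
    finally show ?case using Suc by (simp add: pochhammer_Suc)
  qed simp
  have lim: "(\<lambda>n. (real n / real (n + 2)) powr (\<delta> / (1 + \<alpha>)) * (Gamma_series s n / Gamma_series s' n))
      \<longlonglongrightarrow> 1 * (Gamma s / Gamma s')"
  proof (intro tendsto_mult tendsto_divide Gamma_series_LIMSEQ)
    show "(\<lambda>n. (real n / real (n + 2)) powr (\<delta> / (1 + \<alpha>))) \<longlonglongrightarrow> 1" by real_asymp
    show "Gamma s' \<noteq> 0" using Gamma_real_pos[OF s(2)] by simp
  qed
  have "eventually (\<lambda>n. (real n / real (n + 2)) powr (\<delta> / (1 + \<alpha>)) * (Gamma_series s n / Gamma_series s' n) =
      (\<Prod>j\<in>{1..<n + 2}. 1 + \<delta> / total_weight \<alpha> j) / real (n + 2) powr (\<delta> / (1 + \<alpha>))) sequentially"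
    using eventually_gt_at_top[of 0]
  proof eventually_elim
    case (elim n)
    have "Gamma_series s n / Gamma_series s' n = exp (s * ln (real n)) / exp (s' * ln (real n)) *
        (pochhammer s' (n + 1) / pochhammer s (n + 1))"
      using ph[OF s(1), of "n + 1"] ph[OF s(2), of "n + 1"] by (simp add: Gamma_series_def field_simps)
    also have "pochhammer s' (n + 1) / pochhammer s (n + 1) = (\<Prod>j\<in>{1..<n + 2}. 1 + \<delta> / total_weight \<alpha> j)"
      using prod[of "n + 1"] by simp
    also have "exp (s * ln (real n)) / exp (s' * ln (real n)) = 1 / real n powr (\<delta> / (1 + \<alpha>))"
      unfolding diff[symmetric] using elim by (simp add: powr_def left_diff_distrib exp_diff)
    finally show ?case using elim by (simp add: powr_divide)
  qed
  with lim have "(\<lambda>n. (\<Prod>j\<in>{1..<n + 2}. 1 + \<delta> / total_weight \<alpha> j) / real (n + 2) powr (\<delta> / (1 + \<alpha>))) \<longlonglongrightarrow> Gamma s / Gamma s'"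
    by (simp add: tendsto_cong)
  then show ?thesis unfolding s_def s'_def by (rule LIMSEQ_offset)
qed

section \<open>The supercritical regime\<close>

context weighted_broadcast
begin

text \<open>
  The martingale property of \<open>Y n\<close> divided by \<open>growth n\<close>, tested against functions of an earlier history in place of
  a conditional expectation.
\<close>
lemma martingale_step:
  fixes F :: "_ \<Rightarrow> real"
  assumes "m \<le> n" and n: "n \<ge> 1"
  shows "expectation (\<lambda>\<omega>. F (hist m \<omega>) * Y (Suc n) \<omega>) = (1 + drift / W n) * expectation (\<lambda>\<omega>. F (hist m \<omega>) * Y n \<omega>)"
proof -
  define F' where "F' h = F (restrict (fst h) {2..m}, restrict (snd h) {1..m})" for h
  have F': "F (hist m \<omega>) = F' (hist n \<omega>)" for \<omega>
    using hist_restrict[OF assms(1), of \<omega>] by (simp add: F'_def)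
  have step: "step_mean (\<lambda>a b. F' h * (y + b)) (y / W n) = (1 + drift / W n) * (F' h * y)" for h y
  proof -
    have "step_mean (\<lambda>a b. y + b) \<eta> = y + drift * \<eta>" for \<eta>
      by (simp add: step_mean_def drift_def field_simps)
    then show ?thesis unfolding step_mean_mult by (simp add: algebra_simps)
  qed
  have "expectation (\<lambda>\<omega>. F' (hist n \<omega>) * Y (Suc n) \<omega>) = expectation (\<lambda>\<omega>. (1 + drift / W n) * (F' (hist n \<omega>) * Y n \<omega>))"
    by (subst one_step_expectation[OF n, of "\<lambda>h x y. F' h * y"]) (simp only: step)
  then show ?thesis unfolding F' by simp
qed

definition growth :: "nat \<Rightarrow> real" where
  "growth n = (\<Prod>j\<in>{1..<n}. 1 + drift / W j)"

lemma growth_Suc: "n \<ge> 1 \<Longrightarrow> growth (Suc n) = (1 + drift / W n) * growth n"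
  by (simp add: growth_def)

lemma growth_1 [simp]: "growth (Suc 0) = 1"
  by (simp add: growth_def)

lemma growth_pos: "drift \<ge> 0 \<Longrightarrow> growth n > 0"
  unfolding growth_def using W_pos by (intro prod_pos) (auto intro!: add_pos_nonneg simp: less_imp_le)

lemma martingale_expectation:
  fixes F :: "_ \<Rightarrow> real"
  assumes "m \<le> n" "m \<ge> 1"
  shows "growth m * expectation (\<lambda>\<omega>. F (hist m \<omega>) * Y n \<omega>) = growth n * expectation (\<lambda>\<omega>. F (hist m \<omega>) * Y m \<omega>)"
  using assms
proof (induction n rule: dec_induct)
  case (step n)
  then show ?case by (simp add: martingale_step growth_Suc mult.assoc)
qed simp

lemma expectation_root_Y:
  assumes "n \<ge> 1"
  shows "expectation (\<lambda>\<omega>. root_sign \<sigma> \<omega> * Y n \<omega>) = growth n"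
proof -
  have r: "spin (snd (hist 1 \<omega>) 1) = root_sign \<sigma> \<omega>" for \<omega>
    by (simp add: hist_def root_sign_def spin_def)
  have "expectation (\<lambda>\<omega>. root_sign \<sigma> \<omega> * Y 1 \<omega>) = expectation (\<lambda>\<omega>. 1)"
    by (rule Bochner_Integration.integral_cong[OF refl]) (simp only: XY_1, simp add: root_sign_def)
  then show ?thesis
    using martingale_expectation[OF assms, of "\<lambda>h. spin (snd h 1)"] unfolding r by (simp add: prob_space)
qed

lemma expectation_increment_square:
  assumes "drift \<ge> 0" "1 \<le> m" "m \<le> n"
  shows "expectation (\<lambda>\<omega>. (Y n \<omega> / growth n - Y m \<omega> / growth m)\<^sup>2) = EYY n / (growth n)\<^sup>2 - EYY m / (growth m)\<^sup>2"
proof -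
  have pos: "growth n > 0" "growth m > 0" using growth_pos assms by auto
  have "growth m * expectation (\<lambda>\<omega>. Y m \<omega> * Y n \<omega>) = growth n * EYY m"
    using martingale_expectation[of m n "hist_Y m"] assms unfolding Y_def[symmetric] by (simp add: EYY_def power2_eq_square)
  then have cross: "expectation (\<lambda>\<omega>. Y m \<omega> * Y n \<omega>) = growth n * EYY m / growth m"
    using pos by (simp add: field_simps)
  define F where "F h = hist_Y m (restrict (fst h) {2..m}, restrict (snd h) {1..m}) * hist_Y n h" for h
  have "Y m \<omega> * Y n \<omega> = F (hist n \<omega>)" for \<omega>
    using hist_restrict[OF assms(3), of \<omega>] by (simp add: F_def Y_def)
  then have int: "integrable M (\<lambda>\<omega>. Y m \<omega> * Y n \<omega>)" by (simp add: integrable_hist)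
  have "(Y n \<omega> / growth n - Y m \<omega> / growth m)\<^sup>2 = 1 / (growth n)\<^sup>2 * (Y n \<omega>)\<^sup>2 - 2 / (growth n * growth m) * (Y m \<omega> * Y n \<omega>) +
      1 / (growth m)\<^sup>2 * (Y m \<omega>)\<^sup>2" for \<omega>
    using pos by (simp add: power2_eq_square field_simps)
  then have "expectation (\<lambda>\<omega>. (Y n \<omega> / growth n - Y m \<omega> / growth m)\<^sup>2) =
      1 / (growth n)\<^sup>2 * EYY n - 2 / (growth n * growth m) * expectation (\<lambda>\<omega>. Y m \<omega> * Y n \<omega>) + 1 / (growth m)\<^sup>2 * EYY m"
    by (simp add: integrable_moments int EYY_def)
  also have "\<dots> = 1 / (growth n)\<^sup>2 * EYY n - 2 / (growth n * growth m) * (growth n * EYY m / growth m) + 1 / (growth m)\<^sup>2 * EYY m"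
    by (simp only: cross)
  also have "\<dots> = EYY n / (growth n)\<^sup>2 - EYY m / (growth m)\<^sup>2"
    using pos by (simp add: power2_eq_square field_simps)
  finally show ?thesis .
qed

text \<open>
  A multiple of the total weight is a particular solution of the recursion, and the product of the factors is the
  homogeneous one.
\<close>
lemma EYY_closed_form:
  assumes k: "4 * p + \<alpha> - 3 \<noteq> 0" and n: "n \<ge> 1"
  shows "EYY n = (1 + step_var / (4 * p + \<alpha> - 3)) * (\<Prod>j\<in>{1..<n}. 1 + 2 * drift / W j) - step_var / (4 * p + \<alpha> - 3) * W n"
  using n
proof (induction n rule: dec_induct)
  case base
  have "W 1 = 1" by (simp add: total_weight_def)
  then show ?case using moments_1 by simp
next
  case (step n)
  define c where "c = step_var / (4 * p + \<alpha> - 3)"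
  have v: "step_var = c * (4 * p + \<alpha> - 3)" using k by (simp add: c_def)
  define g where "g = 1 + 2 * drift / W n"
  define P where "P = (\<Prod>j\<in>{1..<n}. 1 + 2 * drift / W j)"
  have "g * W n = W n + 2 * drift" using W_pos[OF step(1)] by (simp add: g_def field_simps)
  then have gW: "g * (c * W n) = c * W n + c * (2 * drift)"
    by (simp only: mult.left_commute[of _ c] distrib_left)
  have Pg: "(\<Prod>j\<in>{1..<Suc n}. 1 + 2 * drift / W j) = P * g"
    using step(1) by (simp add: P_def g_def)
  have cv: "step_var = c * (2 * drift) - c * (1 + \<alpha>)"
    unfolding v by (simp add: drift_def algebra_simps)
  have "EYY (Suc n) = g * ((1 + c) * P - c * W n) + step_var"
    using EYY_Suc[OF step(1)] step(3) by (simp only: c_def g_def P_def)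
  also have "\<dots> = (1 + c) * (P * g) - g * (c * W n) + step_var" by (simp add: algebra_simps)
  also have "\<dots> = (1 + c) * (P * g) - c * (W n + (1 + \<alpha>))"
    unfolding gW cv by (simp add: algebra_simps)
  finally show ?case unfolding c_def[symmetric] total_weight_Suc Pg .
qed

text \<open>
  For this \<open>c\<close> the drifts of \<open>X\<close> and \<open>c Y\<close> cancel, so \<open>X - c Y\<close> is a martingale whose increments have constant mean square.
\<close>
lemma expectation_residual_square:
  assumes c: "c * drift = 2 * p - 1" and n: "n \<ge> 1"
  shows "expectation (\<lambda>\<omega>. (X n \<omega> - c * Y n \<omega>)\<^sup>2) =
    (1 - c)\<^sup>2 + (real n - 1) * (1 - 2 * c * (1 + \<alpha> * (2 * p - 1)) + c\<^sup>2 * step_var)"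
proof -
  have "(X n \<omega> - c * Y n \<omega>)\<^sup>2 = (X n \<omega>)\<^sup>2 - 2 * c * (X n \<omega> * Y n \<omega>) + c\<^sup>2 * (Y n \<omega>)\<^sup>2" for \<omega>
    by (simp add: power2_eq_square algebra_simps)
  then have "expectation (\<lambda>\<omega>. (X n \<omega> - c * Y n \<omega>)\<^sup>2) = EXX n - 2 * c * EXY n + c\<^sup>2 * EYY n"
    by (simp add: integrable_moments EXX_def EXY_def EYY_def)
  also have "\<dots> = (1 - c)\<^sup>2 + (real n - 1) * (1 - 2 * c * (1 + \<alpha> * (2 * p - 1)) + c\<^sup>2 * step_var)"
    using n
  proof (induction n rule: dec_induct)
    case base
    then show ?case using moments_1 by (simp add: power2_eq_square algebra_simps)
  next
    case (step n)
    have "EXX (Suc n) - 2 * c * EXY (Suc n) + c\<^sup>2 * EYY (Suc n) =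
        (EXX n - 2 * c * EXY n + c\<^sup>2 * EYY n) + (1 - 2 * c * (1 + \<alpha> * (2 * p - 1)) + c\<^sup>2 * step_var)"
      unfolding EXX_Suc[OF step(1)] EXY_Suc[OF step(1)] EYY_Suc[OF step(1)] c[symmetric]
      by (simp add: algebra_simps power2_eq_square)
    then show ?case using step by (simp add: algebra_simps)
  qed
  finally show ?thesis .
qed

text \<open>
  With \<open>V\<close> the limit of \<open>Y n / growth n\<close> and \<open>K\<close> that of \<open>growth n / n powr l\<close>, the scaled \<open>X n\<close> tends to \<open>c K V\<close> in mean.
  Since the root sign squares to one, this is the root sign times \<open>c Z\<close> for \<open>Z = K * (root_sign * V)\<close>.  The mean of \<open>Z\<close> is
  \<open>K\<close>, because \<open>Y\<close> starts from the root sign and so \<open>root_sign * Y n / growth n\<close> always has mean one; its second moment is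
  the limit of the second moments of \<open>Y n / n powr l\<close>.
\<close>
lemma supercritical:
  assumes p: "p > (3 - \<alpha>) / 4"
  shows "\<exists>Z \<in> borel_measurable M.
    integrable M Z \<and> integrable M (\<lambda>\<omega>. (Z \<omega>)\<^sup>2) \<and>
    (\<integral>\<omega>. Z \<omega> \<partial>M) = Gamma (1 / (1 + \<alpha>)) / Gamma ((2 * p + \<alpha>) / (1 + \<alpha>)) \<and>
    (\<integral>\<omega>. (Z \<omega>)\<^sup>2 \<partial>M) =
      (Gamma (1 / (1 + \<alpha>)) * (1 + \<alpha>) * (4 * p + \<alpha> - 2)) /
      (Gamma ((4 * p + 2 * \<alpha> - 1) / (1 + \<alpha>)) * (4 * p + \<alpha> - 3)) \<and>
    conv_in_distribution M
      (\<lambda>n \<omega>. (1 / real n powr ((2 * p + \<alpha> - 1) / (1 + \<alpha>))) *\<^sub>R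
         (RB \<sigma> n \<omega> - real n *\<^sub>R vector [1 / 2, 1 / 2]))
      (distr M borel (\<lambda>\<omega>. (root_sign \<sigma> \<omega> * Z \<omega> / (2 * (2 * p + \<alpha> - 1))) *\<^sub>R
         vector [2 * p - 1, 1 - 2 * p]))"
proof -
  define k where "k = 4 * p + \<alpha> - 3"
  define l where "l = drift / (1 + \<alpha>)"
  define c where "c = (2 * p - 1) / drift"
  define K where "K = Gamma (1 / (1 + \<alpha>)) / Gamma ((2 * p + \<alpha>) / (1 + \<alpha>))"
  define K2 where "K2 = Gamma (1 / (1 + \<alpha>)) / Gamma ((4 * p + 2 * \<alpha> - 1) / (1 + \<alpha>))"
  define L where "L = (1 + step_var / k) * K2 / K\<^sup>2"
  have k: "k > 0" using p by (simp add: k_def)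
  have "2 * drift = k + (1 + \<alpha>)" by (simp add: k_def drift_def)
  then have drift: "drift > 0" "2 * drift > 1 + \<alpha>" using k one_plus_alpha by auto
  have l: "2 * l > 1" using drift one_plus_alpha by (simp add: l_def)
  have c: "c * drift = 2 * p - 1" using drift by (simp add: c_def)
  have pos: "(2 * p + \<alpha>) / (1 + \<alpha>) > 0" "(4 * p + 2 * \<alpha> - 1) / (1 + \<alpha>) > 0" "1 / (1 + \<alpha>) > 0"
    using drift one_plus_alpha by (auto simp: drift_def intro!: divide_pos_pos)
  have K: "K > 0" unfolding K_def by (rule divide_pos_pos[OF Gamma_real_pos[OF pos(3)] Gamma_real_pos[OF pos(1)]])
  have growth: "growth n > 0" for n using growth_pos drift by simp
  have growth_lim: "(\<lambda>n. growth n / real n powr l) \<longlonglongrightarrow> K"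
    using growth_product_asymptotics[OF alpha_ge, of drift] drift
    unfolding growth_def l_def K_def by (simp add: drift_def add.commute)
  let ?A = "\<lambda>n. \<Prod>j\<in>{1..<n}. 1 + 2 * drift / W j"
  have square_lim: "(\<lambda>n. ?A n / real n powr (2 * l)) \<longlonglongrightarrow> K2"
  proof -
    have eq: "4 * p + 2 * \<alpha> - 1 = 1 + 2 * drift" by (simp add: drift_def)
    show ?thesis
      using growth_product_asymptotics[OF alpha_ge, of "2 * drift"] drift unfolding l_def K2_def eq by simp
  qed
  have u_lim: "(\<lambda>n. EYY n / real n powr (2 * l)) \<longlonglongrightarrow> (1 + step_var / k) * K2"
  proof -
    have "(\<lambda>n. W n / real n powr (2 * l)) \<longlonglongrightarrow> 0" unfolding total_weight_def using l by real_asymp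
    then have "(\<lambda>n. (1 + step_var / k) * (?A n / real n powr (2 * l)) -
        step_var / k * (W n / real n powr (2 * l))) \<longlonglongrightarrow> (1 + step_var / k) * K2 - step_var / k * 0"
      by (intro tendsto_intros square_lim)
    moreover have "eventually (\<lambda>n. (1 + step_var / k) * (?A n / real n powr (2 * l)) -
        step_var / k * (W n / real n powr (2 * l)) = EYY n / real n powr (2 * l)) sequentially"
    proof (rule eventually_sequentiallyI[of 1])
      fix n :: nat assume n: "n \<ge> 1"
      have "EYY n = (1 + step_var / k) * ?A n - step_var / k * W n"
        unfolding k_def by (rule EYY_closed_form[OF _ n]) (use k in \<open>simp add: k_def\<close>)
      then show "(1 + step_var / k) * (?A n / real n powr (2 * l)) -
          step_var / k * (W n / real n powr (2 * l)) = EYY n / real n powr (2 * l)"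
        by (simp add: diff_divide_distrib)
    qed
    ultimately show ?thesis by (simp add: tendsto_cong)
  qed
  have q_lim: "(\<lambda>n. EYY n / (growth n)\<^sup>2) \<longlonglongrightarrow> L"
  proof -
    have "(\<lambda>n. EYY n / real n powr (2 * l) / (growth n / real n powr l)\<^sup>2) \<longlonglongrightarrow> (1 + step_var / k) * K2 / K\<^sup>2"
      using K by (intro tendsto_intros u_lim growth_lim) auto
    moreover have "eventually (\<lambda>n. EYY n / real n powr (2 * l) / (growth n / real n powr l)\<^sup>2 = EYY n / (growth n)\<^sup>2) sequentially"
    proof (rule eventually_sequentiallyI[of 1])
      fix n :: nat assume n: "n \<ge> 1"
      have "(real n powr l)\<^sup>2 = real n powr (2 * l)" using n by (simp add: powr_power mult.commute)
      then show "EYY n / real n powr (2 * l) / (growth n / real n powr l)\<^sup>2 = EYY n / (growth n)\<^sup>2"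
        using n by (simp add: power_divide)
    qed
    ultimately show ?thesis unfolding L_def by (rule Lim_transform_eventually)
  qed
  obtain V where V [measurable]: "V \<in> borel_measurable M" and V2: "integrable M (\<lambda>\<omega>. (V \<omega>)\<^sup>2)" "expectation (\<lambda>\<omega>. (V \<omega>)\<^sup>2) = L"
    and V1: "(\<lambda>n. expectation (\<lambda>\<omega>. \<bar>Y n \<omega> / growth n - V \<omega>\<bar>)) \<longlonglongrightarrow> 0"
  proof (rule orthogonal_increments_L2_limit[of "\<lambda>n \<omega>. Y n \<omega> / growth n" "\<lambda>n. EYY n / (growth n)\<^sup>2" L])
    show "(\<lambda>\<omega>. Y n \<omega> / growth n) \<in> borel_measurable M" for n by measurable
    show "integrable M (\<lambda>\<omega>. (Y n \<omega> / growth n)\<^sup>2)" for n by (rule integrable_XY[of "\<lambda>x y. (y / growth n)\<^sup>2"])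
    show "expectation (\<lambda>\<omega>. (Y n \<omega> / growth n)\<^sup>2) = EYY n / (growth n)\<^sup>2" for n by (simp add: power_divide EYY_def)
  qed (use expectation_increment_square drift q_lim in auto)
  have intV: "integrable M V" by (rule square_integrable_imp_integrable[OF V V2(1)])
  have rs [measurable]: "root_sign \<sigma> \<in> borel_measurable M"
  proof (rule measurable_cong[THEN iffD1])
    show "X 1 \<in> borel_measurable M" by measurable
  qed (rule XY_1)
  have rs_abs: "\<bar>root_sign \<sigma> \<omega>\<bar> = 1" "root_sign \<sigma> \<omega> * root_sign \<sigma> \<omega> = 1" for \<omega> by (auto simp: root_sign_def)
  have int_rs: "integrable M (\<lambda>\<omega>. root_sign \<sigma> \<omega> * f \<omega>)" if "integrable M f" for f :: "'w \<Rightarrow> real"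
    by (rule Bochner_Integration.integrable_bound[OF that]) (use that rs_abs in \<open>auto simp: abs_mult\<close>)
  have EV: "expectation (\<lambda>\<omega>. root_sign \<sigma> \<omega> * V \<omega>) = 1"
  proof -
    have "\<bar>1 - expectation (\<lambda>\<omega>. root_sign \<sigma> \<omega> * V \<omega>)\<bar> \<le> expectation (\<lambda>\<omega>. \<bar>Y n \<omega> / growth n - V \<omega>\<bar>)" if n: "n \<ge> 1" for n
    proof -
      have int: "integrable M (\<lambda>\<omega>. Y n \<omega> / growth n)" by (rule integrable_XY)
      have "expectation (\<lambda>\<omega>. root_sign \<sigma> \<omega> * (Y n \<omega> / growth n)) = 1"
        using expectation_root_Y[OF n] growth[of n] by simp
      then have "1 - expectation (\<lambda>\<omega>. root_sign \<sigma> \<omega> * V \<omega>) = expectation (\<lambda>\<omega>. root_sign \<sigma> \<omega> * (Y n \<omega> / growth n - V \<omega>))"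
        unfolding right_diff_distrib using int_rs[OF int] int_rs[OF intV] by simp
      then have "\<bar>1 - expectation (\<lambda>\<omega>. root_sign \<sigma> \<omega> * V \<omega>)\<bar> \<le> expectation (\<lambda>\<omega>. \<bar>root_sign \<sigma> \<omega> * (Y n \<omega> / growth n - V \<omega>)\<bar>)"
        using integral_abs_bound by simp
      then show ?thesis by (simp add: abs_mult rs_abs)
    qed
    then have "\<bar>1 - expectation (\<lambda>\<omega>. root_sign \<sigma> \<omega> * V \<omega>)\<bar> \<le> 0" by (intro LIMSEQ_le_const[OF V1]) auto
    then show ?thesis by simp
  qed
  define Z where "Z \<omega> = K * (root_sign \<sigma> \<omega> * V \<omega>)" for \<omega>
  have Z_meas: "Z \<in> borel_measurable M" unfolding Z_def by measurable
  have Z_int: "integrable M Z" unfolding Z_def using int_rs[OF intV] by simp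
  have Zsq: "(Z \<omega>)\<^sup>2 = K\<^sup>2 * (V \<omega>)\<^sup>2" for \<omega>
    by (simp add: Z_def power_mult_distrib power2_eq_square[of "root_sign \<sigma> \<omega>"] rs_abs)
  have EZ: "expectation Z = K" unfolding Z_def using EV by simp
  have "expectation (\<lambda>\<omega>. (Z \<omega>)\<^sup>2) = (1 + step_var / k) * K2" unfolding Zsq using V2 K by (simp add: L_def)
  also have "1 + step_var / k = (1 + \<alpha>) * (4 * p + \<alpha> - 2) / k"
    using k by (simp add: field_simps) (simp add: k_def step_var_def power2_eq_square algebra_simps)
  finally have EZ2: "expectation (\<lambda>\<omega>. (Z \<omega>)\<^sup>2) = (Gamma (1 / (1 + \<alpha>)) * (1 + \<alpha>) * (4 * p + \<alpha> - 2)) /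
      (Gamma ((4 * p + 2 * \<alpha> - 1) / (1 + \<alpha>)) * (4 * p + \<alpha> - 3))"
    by (simp add: K2_def k_def mult_ac)
  define T where "T n \<omega> = X n \<omega> / real n powr l / 2" for n \<omega>
  define S where "S \<omega> = c * K * V \<omega> / 2" for \<omega>
  have T_int: "integrable M (T n)" for n unfolding T_def by (rule integrable_XY)
  have S_int: "integrable M S" unfolding S_def using intV by simp
  have L1: "(\<lambda>n. expectation (\<lambda>\<omega>. \<bar>T n \<omega> - S \<omega>\<bar>)) \<longlonglongrightarrow> 0"
  proof -
    define d where "d = 1 - 2 * c * (1 + \<alpha> * (2 * p - 1)) + c\<^sup>2 * step_var"
    define R where "R n = sqrt (((1 - c)\<^sup>2 + (real n - 1) * d) / real n powr (2 * l))" for n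
    \<comment> \<open>\<open>R\<close> bounds the mean of \<open>\<bar>X - c Y\<bar>\<close> after scaling, \<open>Q\<close> that of \<open>c\<close> times the error in approximating the scaled \<open>Y\<close> by \<open>K V\<close>.\<close>
    define Q where "Q n = \<bar>c\<bar> * (growth n / real n powr l) * expectation (\<lambda>\<omega>. \<bar>Y n \<omega> / growth n - V \<omega>\<bar>) +
        \<bar>c\<bar> * \<bar>growth n / real n powr l - K\<bar> * expectation (\<lambda>\<omega>. \<bar>V \<omega>\<bar>)" for n
    have "(\<lambda>n. ((1 - c)\<^sup>2 + (real n - 1) * d) / real n powr (2 * l)) \<longlonglongrightarrow> 0" using l by real_asymp
    then have R: "R \<longlonglongrightarrow> 0" unfolding R_def using tendsto_real_sqrt by fastforce
    have "Q \<longlonglongrightarrow> \<bar>c\<bar> * K * 0 + \<bar>c\<bar> * \<bar>K - K\<bar> * expectation (\<lambda>\<omega>. \<bar>V \<omega>\<bar>)"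
      unfolding Q_def by (intro tendsto_intros growth_lim V1)
    then have Q: "Q \<longlonglongrightarrow> 0" by simp
    have bound: "expectation (\<lambda>\<omega>. \<bar>T n \<omega> - S \<omega>\<bar>) \<le> (R n + Q n) / 2" if n: "n \<ge> 1" for n
    proof -
      let ?r = "real n powr l"
      have r: "?r > 0" using n by simp
      let ?E = "\<lambda>\<omega>. \<bar>(X n \<omega> - c * Y n \<omega>) / ?r\<bar>"
      let ?B = "\<lambda>\<omega>. \<bar>c\<bar> * (growth n / ?r) * \<bar>Y n \<omega> / growth n - V \<omega>\<bar>"
      let ?C = "\<lambda>\<omega>. \<bar>c\<bar> * \<bar>growth n / ?r - K\<bar> * \<bar>V \<omega>\<bar>"
      have "\<bar>T n \<omega> - S \<omega>\<bar> \<le> (?E \<omega> + ?B \<omega> + ?C \<omega>) / 2" for \<omega>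
      proof -
        have "2 * (T n \<omega> - S \<omega>) = (X n \<omega> - c * Y n \<omega>) / ?r + c * (growth n / ?r) * (Y n \<omega> / growth n - V \<omega>) + c * (growth n / ?r - K) * V \<omega>"
          using growth[of n] r by (simp add: T_def S_def field_simps)
        also have "\<bar>\<dots>\<bar> \<le> ?E \<omega> + \<bar>c * (growth n / ?r) * (Y n \<omega> / growth n - V \<omega>)\<bar> + \<bar>c * (growth n / ?r - K) * V \<omega>\<bar>"
          by (intro order_trans[OF abs_triangle_ineq] add_right_mono abs_triangle_ineq)
        also have "\<dots> = ?E \<omega> + ?B \<omega> + ?C \<omega>" using growth[of n] r by (simp add: abs_mult)
        finally have "\<bar>T n \<omega> - S \<omega>\<bar> * 2 \<le> ?E \<omega> + ?B \<omega> + ?C \<omega>"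
          by (simp only: abs_mult abs_numeral mult.commute[of _ 2])
        then show ?thesis by (simp only: le_divide_eq_numeral1)
      qed
      moreover have intA: "integrable M ?E" by (rule integrable_XY)
      moreover have intYV: "integrable M (\<lambda>\<omega>. \<bar>Y n \<omega> / growth n - V \<omega>\<bar>)"
        using integrable_XY[of "\<lambda>x y. y / growth n" n] intV by auto
      ultimately have "expectation (\<lambda>\<omega>. \<bar>T n \<omega> - S \<omega>\<bar>) \<le> expectation (\<lambda>\<omega>. (?E \<omega> + ?B \<omega> + ?C \<omega>) / 2)"
        using T_int[of n] S_int intV by (intro integral_mono) auto
      also have "\<dots> = (expectation ?E + Q n) / 2"
        using intA intYV intV by (simp add: Q_def)
      also have "expectation ?E \<le> R n"
      proof -
        have "expectation ?E \<le> sqrt (expectation (\<lambda>\<omega>. ((X n \<omega> - c * Y n \<omega>) / ?r)\<^sup>2))"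
          by (rule expectation_abs_le_sqrt) (auto intro!: integrable_XY[of "\<lambda>x y. ((x - c * y) / ?r)\<^sup>2"])
        also have "expectation (\<lambda>\<omega>. ((X n \<omega> - c * Y n \<omega>) / ?r)\<^sup>2) = ((1 - c)\<^sup>2 + (real n - 1) * d) / ?r\<^sup>2"
          using expectation_residual_square[OF c n] by (simp add: power_divide d_def)
        also have "?r\<^sup>2 = real n powr (2 * l)" using n by (simp add: powr_power mult.commute)
        finally show ?thesis unfolding R_def .
      qed
      finally show ?thesis by simp
    qed
    show ?thesis
    proof (rule tendsto_sandwich[OF _ _ tendsto_const])
      show "(\<lambda>n. (R n + Q n) / 2) \<longlonglongrightarrow> 0" using tendsto_divide[OF tendsto_add[OF R Q] tendsto_const, of 2] by simp
      show "eventually (\<lambda>n. expectation (\<lambda>\<omega>. \<bar>T n \<omega> - S \<omega>\<bar>) \<le> (R n + Q n) / 2) sequentially"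
        using bound by (rule eventually_sequentiallyI)
    qed auto
  qed
  have "conv_in_distribution M (\<lambda>n \<omega>. T n \<omega> *\<^sub>R (vector [1, - 1] :: real^2)) (distr M borel (\<lambda>\<omega>. S \<omega> *\<^sub>R vector [1, - 1]))"
    by (rule L1_imp_conv_in_distribution[OF prob_space_axioms T_int S_int L1])
  moreover have "T n \<omega> *\<^sub>R vector [1, - 1] = (1 / real n powr ((2 * p + \<alpha> - 1) / (1 + \<alpha>))) *\<^sub>R
      (RB \<sigma> n \<omega> - real n *\<^sub>R vector [1 / 2, 1 / 2])" for n \<omega>
    by (simp add: RB_eq T_def l_def drift_def algebra_simps)
  moreover have "S \<omega> *\<^sub>R (vector [1, - 1] :: real^2) = (root_sign \<sigma> \<omega> * Z \<omega> / (2 * (2 * p + \<alpha> - 1))) *\<^sub>R vector [2 * p - 1, 1 - 2 * p]" for \<omega>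
  proof -
    have "root_sign \<sigma> \<omega> * Z \<omega> = K * V \<omega>" using rs_abs(2)[of \<omega>] by (simp add: Z_def)
    moreover have "2 * p + \<alpha> - 1 = drift" by (simp add: drift_def)
    moreover have "(vector [2 * p - 1, 1 - 2 * p] :: real^2) = (2 * p - 1) *\<^sub>R vector [1, - 1]"
      by (simp add: vec_eq_iff forall_2)
    ultimately show ?thesis by (simp add: S_def c_def mult_ac)
  qed
  ultimately have "conv_in_distribution M
      (\<lambda>n \<omega>. (1 / real n powr ((2 * p + \<alpha> - 1) / (1 + \<alpha>))) *\<^sub>R
         (RB \<sigma> n \<omega> - real n *\<^sub>R vector [1 / 2, 1 / 2]))
      (distr M borel (\<lambda>\<omega>. (root_sign \<sigma> \<omega> * Z \<omega> / (2 * (2 * p + \<alpha> - 1))) *\<^sub>R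
         vector [2 * p - 1, 1 - 2 * p]))" by simp
  moreover have "integrable M (\<lambda>\<omega>. (Z \<omega>)\<^sup>2)" unfolding Zsq using V2 by simp
  ultimately show ?thesis using Z_meas Z_int EZ[unfolded K_def] EZ2 by blast
qed

end

section \<open>The limit theorem\<close>

theorem theorem2p1:
  fixes M :: "'w measure" and \<alpha> p :: real
    and parent :: "nat \<Rightarrow> 'w \<Rightarrow> nat" and \<sigma> :: "nat \<Rightarrow> 'w \<Rightarrow> colour"
  assumes \<alpha>: "\<alpha> \<in> {0..} \<union> {- 1 / real_of_int d |d. d \<ge> 2}"
    and p: "p \<in> {0..1}"
    and process: "broadcast_pref_attachment M \<alpha> p parent \<sigma>"
  shows
    "(p < 1 \<longrightarrow> (AE \<omega> in M. (\<lambda>n. (1 / real n) *\<^sub>R RB \<sigma> n \<omega>) \<longlonglongrightarrow> vector [1 / 2, 1 / 2])) \<and>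
     (p < (3 - \<alpha>) / 4 \<or> p = 1 / 2 \<longrightarrow>
       conv_to_centred_normal M
         (\<lambda>n \<omega>. (1 / sqrt (real n)) *\<^sub>R (RB \<sigma> n \<omega> - real n *\<^sub>R vector [1 / 2, 1 / 2]))
         (c_coeff \<alpha> p *\<^sub>R alternating_matrix)) \<and>
     (p = (3 - \<alpha>) / 4 \<and> p \<noteq> 1 / 2 \<longrightarrow>
       conv_to_centred_normal M
         (\<lambda>n \<omega>. (1 / sqrt (real n * ln (real n))) *\<^sub>R
            (RB \<sigma> n \<omega> - real n *\<^sub>R vector [1 / 2, 1 / 2]))
         (((\<alpha> - 1)\<^sup>2 / (4 * (1 + \<alpha>))) *\<^sub>R alternating_matrix)) \<and>
     (p > (3 - \<alpha>) / 4 \<and> p \<noteq> 1 / 2 \<longrightarrow>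
       (\<exists>Z \<in> borel_measurable M.
          integrable M Z \<and> integrable M (\<lambda>\<omega>. (Z \<omega>)\<^sup>2) \<and>
          (\<integral>\<omega>. Z \<omega> \<partial>M) = Gamma (1 / (1 + \<alpha>)) / Gamma ((2 * p + \<alpha>) / (1 + \<alpha>)) \<and>
          (\<integral>\<omega>. (Z \<omega>)\<^sup>2 \<partial>M) =
            (Gamma (1 / (1 + \<alpha>)) * (1 + \<alpha>) * (4 * p + \<alpha> - 2)) /
            (Gamma ((4 * p + 2 * \<alpha> - 1) / (1 + \<alpha>)) * (4 * p + \<alpha> - 3)) \<and>
          conv_in_distribution M
            (\<lambda>n \<omega>. (1 / real n powr ((2 * p + \<alpha> - 1) / (1 + \<alpha>))) *\<^sub>R
               (RB \<sigma> n \<omega> - real n *\<^sub>R vector [1 / 2, 1 / 2]))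
            (distr M borel (\<lambda>\<omega>. (root_sign \<sigma> \<omega> * Z \<omega> / (2 * (2 * p + \<alpha> - 1))) *\<^sub>R
               vector [2 * p - 1, 1 - 2 * p]))))"
proof -
  have "\<alpha> \<ge> -1/2"
  proof (cases "\<alpha> \<ge> 0")
    case False
    then obtain d :: int where d: "\<alpha> = - 1 / real_of_int d" "d \<ge> 2" using \<alpha> by auto
    then have "1 / real_of_int d \<le> 1 / 2" by (intro divide_left_mono) auto
    with d show ?thesis by simp
  qed simp
  then interpret weighted_broadcast M \<alpha> p parent \<sigma>
    using process p by (intro weighted_broadcast.intro weighted_broadcast_axioms.intro) auto
  show ?thesis
    using strong_law gaussian_linear gaussian_critical supercritical by (intro conjI impI) blast+
qed

end
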